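(* Let $q$ be a complex-valued function on $\mathbb{R}$ with $q\in L_1[0,1]$, $\int_0^1 q(x)\,dx=0$, $q(x+1)=q(x)$ and $\overline{q(-x)}=q(x)$, and suppose $q\in W_1^s[0,1]$ for some integer $s\ge 0$. Let $f=\operatorname{Re}q$, $g=\operatorname{Im}q$ and $$f_n=\int_0^1 f(x)\cos 2\pi nx\,dx,\qquad g_n=\int_0^1 g(x)\sin 2\pi nx\,dx.$$ If there exist $\delta>1$, $\beta>0$ and $m>0$ such that $$|g_n|>\beta n^{-s-1},\qquad |g_n|>\delta|f_n|$$ for all $n>m$, then $q$ is a finite-zone potential.
   Context: $L(q)$ is the operator generated in $L_2(-\infty,\infty)$ by the expression $-y''(x)+q(x)y(x)$, and $\sigma(L(q))$ is its spectrum. The real part of the spectrum is $\operatorname{Re}(\sigma(L(q))):=\sigma(L(q))\cap\mathbb{R}$. The potential $q$ is called finite-zone if $\operatorname{Re}(\sigma(L(q)))$ contains a half-line $[R,\infty)$ for some number $R$ (which implies that the number of gaps in $\operatorname{Re}(\sigma(L(q)))$ is finite). For a $1$-periodic function $u$ on $\mathbb{R}$ and an integer $s\ge0$, $u\in W_1^s[0,1]$ means that (as a periodic function on $\mathbb{R}$) $u,u',\dots,u^{(s-1)}$ are locally absolutely continuous and $u^{(s)}$ is integrable on $[0,1]$; $W_1^0[0,1]=L_1[0,1]$. *)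

theory Defs
  imports "HOL-Analysis.Analysis"
begin

definition absolutely_continuous_on_interval :: "real \<Rightarrow> real \<Rightarrow> (real \<Rightarrow> complex) \<Rightarrow> bool" where
  "absolutely_continuous_on_interval a b u \<longleftrightarrow>
     (\<forall>\<epsilon>>0. \<exists>\<delta>>0. \<forall>(n::nat) l r.
        (\<forall>i<n. a \<le> l i \<and> l i \<le> r i \<and> r i \<le> b) \<and>
        (\<forall>i<n. \<forall>j<n. i \<noteq> j \<longrightarrow> {l i<..<r i} \<inter> {l j<..<r j} = {}) \<and>
        (\<Sum>i<n. r i - l i) < \<delta> \<longrightarrow>
        (\<Sum>i<n. norm (u (r i) - u (l i))) < \<epsilon>)"

definition locally_absolutely_continuous :: "(real \<Rightarrow> complex) \<Rightarrow> bool" where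
  "locally_absolutely_continuous u \<longleftrightarrow> (\<forall>a b. absolutely_continuous_on_interval a b u)"

text \<open>
  Derivatives are pointwise. At a point where \<open>u\<close> is not differentiable the value of
  \<open>derivative u\<close> is an unspecified constant; for a locally absolutely continuous \<open>u\<close>
  this concerns a null set only.
\<close>

definition derivative :: "(real \<Rightarrow> complex) \<Rightarrow> real \<Rightarrow> complex" where
  "derivative u x = vector_derivative u (at x)"

text \<open>
  The class \<open>W\<^sub>1\<^sup>s[0,1]\<close> for a 1-periodic \<open>u\<close> on the real line: \<open>u, u', ..., u\<^sup>(\<^sup>s\<^sup>-\<^sup>1\<^sup>)\<close> exist
  everywhere and are locally absolutely continuous on the line, and \<open>u\<^sup>(\<^sup>s\<^sup>)\<close>, which for
  \<open>s > 0\<close> need only exist almost everywhere, is Lebesgue integrable on \<open>[0,1]\<close>.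
\<close>

definition periodic_W1 :: "nat \<Rightarrow> (real \<Rightarrow> complex) set" where
  "periodic_W1 s = {u.
     (\<forall>x. u (x + 1) = u x) \<and>
     (\<forall>k<s. locally_absolutely_continuous ((derivative ^^ k) u)) \<and>
     (\<forall>k. k + 1 < s \<longrightarrow> (\<forall>x. (derivative ^^ k) u differentiable at x)) \<and>
     (derivative ^^ s) u absolutely_integrable_on {0..1}}"

text \<open>
  Elements of \<open>L\<^sub>2(-\<infinity>,\<infinity>)\<close> are represented by functions; equality in \<open>L\<^sub>2\<close> is equality
  almost everywhere and is written out below.
\<close>

definition square_integrable :: "(real \<Rightarrow> complex) set" where
  "square_integrable =
     {u. u \<in> borel_measurable lebesgue \<and> integrable lebesgue (\<lambda>x. (norm (u x))\<^sup>2)}"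

definition norm_L2 :: "(real \<Rightarrow> complex) \<Rightarrow> real" where
  "norm_L2 u = sqrt (\<integral>x. (norm (u x))\<^sup>2 \<partial>lebesgue)"

text \<open>
  For an operator \<open>T\<close> in \<open>L\<^sub>2\<close> with domain \<open>D\<close>, the resolvent set consists of those \<open>z\<close>
  for which \<open>T - z\<close> is injective on \<open>D\<close>, maps \<open>D\<close> onto \<open>L\<^sub>2\<close> and has a bounded inverse.
\<close>

definition resolvent_set ::
    "(real \<Rightarrow> complex) set \<Rightarrow> ((real \<Rightarrow> complex) \<Rightarrow> real \<Rightarrow> complex) \<Rightarrow> complex set" where
  "resolvent_set D T = {z.
     (\<forall>u\<in>D. (AE x in lebesgue. T u x - z * u x = 0) \<longrightarrow> (AE x in lebesgue. u x = 0)) \<and>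
     (\<forall>h\<in>square_integrable. \<exists>u\<in>D. AE x in lebesgue. T u x - z * u x = h x) \<and>
     (\<exists>C. \<forall>u\<in>D. norm_L2 u \<le> C * norm_L2 (\<lambda>x. T u x - z * u x))}"

definition spectrum ::
    "(real \<Rightarrow> complex) set \<Rightarrow> ((real \<Rightarrow> complex) \<Rightarrow> real \<Rightarrow> complex) \<Rightarrow> complex set" where
  "spectrum D T = - resolvent_set D T"

definition hill_expr :: "(real \<Rightarrow> complex) \<Rightarrow> (real \<Rightarrow> complex) \<Rightarrow> real \<Rightarrow> complex" where
  "hill_expr q y x = - derivative (derivative y) x + q x * y x"

text \<open>
  The maximal domain of \<open>-y'' + q y\<close> in \<open>L\<^sub>2(-\<infinity>,\<infinity>)\<close>. An \<open>L\<^sub>2\<close> class in the domain is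
  represented by its unique continuous representative.
\<close>

definition hill_domain :: "(real \<Rightarrow> complex) \<Rightarrow> (real \<Rightarrow> complex) set" where
  "hill_domain q = {y \<in> square_integrable.
     (\<forall>x. y differentiable at x) \<and>
     locally_absolutely_continuous y \<and>
     locally_absolutely_continuous (derivative y) \<and>
     hill_expr q y \<in> square_integrable}"

definition hill_spectrum :: "(real \<Rightarrow> complex) \<Rightarrow> complex set" where
  "hill_spectrum q = spectrum (hill_domain q) (hill_expr q)"

definition Re_spectrum :: "(real \<Rightarrow> complex) \<Rightarrow> complex set" where
  "Re_spectrum q = hill_spectrum q \<inter> \<real>"

definition finite_zone :: "(real \<Rightarrow> complex) \<Rightarrow> bool" where
  "finite_zone q \<longleftrightarrow> (\<exists>R::real. complex_of_real ` {R..} \<subseteq> Re_spectrum q)"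

definition fourier_cos :: "(real \<Rightarrow> real) \<Rightarrow> nat \<Rightarrow> real" where
  "fourier_cos f n = integral {0..1} (\<lambda>x. f x * cos (2 * pi * real n * x))"

definition fourier_sin :: "(real \<Rightarrow> real) \<Rightarrow> nat \<Rightarrow> real" where
  "fourier_sin g n = integral {0..1} (\<lambda>x. g x * sin (2 * pi * real n * x))"

end

(*
  For real E close to (pi n)^2 we look for a Bloch solution of -y'' + q y = E y,
  y(x) = exp(i kappa x) sum_m a_m exp(-2 pi i m x) with kappa = pi n + t. By PT symmetry the
  Fourier coefficients of q are real. Eliminating all modes except the resonant ones m = 0 and
  m = n by a Neumann series leaves a real 2x2 system, hence a real continuous function D(t) whose
  zeros are the admissible t. At t = 3 the unperturbed diagonal entries have opposite signs and
  are of order n, so D(3) < 0. At t = 0 reflection symmetry makes the two diagonal entries equal,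
  so D(0) is a square minus the product of the two couplings. These are f_n + g_n and f_n - g_n
  up to an error o(n^(-s-1)), so |g_n| > delta |f_n| makes their product negative and D(0) > 0.
  The intermediate value theorem gives t in (0,3). Cutting off the bounded solution y yields a
  singular sequence, so E lies in the spectrum; thus every large real E does.
*)
theory Submission
  imports Defs
begin

subsection \<open>The Lebesgue differentiation theorem on the line\<close>

text \<open>The critical scale is n^(-s-1), that of the lower bound on |g_n|. Let S be the sum of
  the moduli of the non-resonant Green function. Term-by-term bounds give n * S^2 -> 0, which
  disposes of all orders of the Neumann series from the third on, the factor n^(-s) being carried by
  the submultiplicative weight (1 + |k|)^s. Second order is the obstacle. For s >= 1, decay of one
  Fourier coefficient at distance n/2 plus decay of the other is enough. For s = 0 absolute values
  lose a logarithm, and cancellation is used: the sum is minus a Fourier coefficient of Q^2, where Q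
  is the mean-zero primitive of q, and periodic absolutely continuous functions have coefficients
  o(1/n). The couplings have to be known this precisely only for E within a bounded distance of (pi
  n)^2; farther away the square in D(0) dominates by itself. Since 0 < t < 3 < pi, the multiplier
  exp(i kappa) is not 1. Hence integration has a unique quasi-periodic choice of constant. This
  turns the series for y, which is only absolutely summable, into a genuine solution without
  termwise differentiation.\<close>

lemma negligible_interval_density_failure:
  fixes f :: "real \<Rightarrow> complex"
  assumes f: "f integrable_on {a..b}" and e: "e > 0"
  shows "negligible {x\<in>{a<..<b}. \<forall>d>0. \<exists>u v. a \<le> u \<and> u \<le> x \<and> x \<le> v \<and> v \<le> b \<and> u < v \<and> v - u < d
            \<and> norm ((v - u) *\<^sub>R f x - integral {u..v} f) > e * (v - u)}" (is "negligible ?S")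
proof -
  have "\<exists>T. ?S \<subseteq> T \<and> T \<in> lmeasurable \<and> measure lebesgue T \<le> \<epsilon>" if "\<epsilon> > 0" for \<epsilon>
  proof -
    \<comment> \<open>Henstock's lemma bounds by \<open>\<epsilon>'\<close> the total Riemann error
      over any fine family of non-overlapping tagged intervals. On a bad interval this error exceeds
      \<open>e\<close> times the length, so disjoint bad intervals have total length below
      \<open>\<epsilon>' / e\<close>. The 5 pays for the Vitali enlargement.\<close>
    define \<epsilon>' where "\<epsilon>' = e * \<epsilon> / 5"
    have \<epsilon>': "\<epsilon>' > 0" using e that by (simp add: \<epsilon>'_def)
    have f': "f integrable_on cbox a b" using f by simp
    obtain \<gamma> where \<gamma>: "gauge \<gamma>" and
      H: "\<And>p. \<lbrakk>p tagged_partial_division_of (cbox a b); \<gamma> fine p\<rbrakk> \<Longrightarrow>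
             sum (\<lambda>(x,K). norm(measure lborel K *\<^sub>R f x - integral K f)) p < \<epsilon>'"
      by (rule Henstock_lemma[OF f' \<epsilon>']) blast
    \<comment> \<open>The tag is stored apart from the interval because it need not be the midpoint,
      while Vitali covering works with centres \<open>c\<close> and radii \<open>r\<close>.\<close>
    define K where "K = {(x,u,v). x \<in> ?S \<and> a \<le> u \<and> u \<le> x \<and> x \<le> v \<and> v \<le> b \<and> u < v \<and> {u..v} \<subseteq> \<gamma> x
            \<and> norm ((v - u) *\<^sub>R f x - integral {u..v} f) > e * (v - u)}"
    define c where "c = (\<lambda>(x::real,u::real,v::real). (u+v)/2)"
    define r where "r = (\<lambda>(x::real,u::real,v::real). (v-u)/2)"
    have cb: "cball (c i) (r i) = {fst (snd i)..snd (snd i)}" for i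
      by (cases i) (auto simp: c_def r_def cball_eq_atLeastAtMost field_simps)
    have "?S \<subseteq> (\<Union>i\<in>K. cball (c i) (r i))"
    proof
      fix x assume x: "x \<in> ?S"
      obtain d where d: "d > 0" "ball x d \<subseteq> \<gamma> x"
        using \<gamma> by (meson gauge_def open_contains_ball)
      from x d(1) obtain u v where uv: "a \<le> u" "u \<le> x" "x \<le> v" "v \<le> b" "u < v" "v - u < d"
            "norm ((v - u) *\<^sub>R f x - integral {u..v} f) > e * (v - u)" by blast
      have "{u..v} \<subseteq> ball x d" using uv by (auto simp: dist_real_def)
      then have "(x,u,v) \<in> K" using uv x d unfolding K_def by blast
      moreover have "x \<in> cball (c (x,u,v)) (r (x,u,v))" unfolding cb using uv by simp
      ultimately show "x \<in> (\<Union>i\<in>K. cball (c i) (r i))" by blast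
    qed
    moreover have "0 < r i \<and> r i \<le> \<bar>b - a\<bar>" if "i \<in> K" for i
      using that unfolding K_def r_def by (auto simp: case_prod_beta)
    ultimately obtain C where C: "countable C" "C \<subseteq> K"
     "pairwise (\<lambda>i j. disjnt (cball (c i) (r i)) (cball (c j) (r j))) C"
     "?S \<subseteq> (\<Union>i\<in>C. cball (c i) (5 * r i))"
      by (rule Vitali_covering_lemma_cballs) blast+
    have fin: "measure lebesgue (\<Union>i\<in>F. cball (c i) (5 * r i)) \<le> \<epsilon>" if F: "F \<subseteq> C" "finite F" for F
    proof -
      define p where "p = (\<lambda>(x,u,v). (x, {u..v})) ` F"
      have inj: "inj_on (\<lambda>(x::real,u::real,v::real). (x, {u..v})) F"
        unfolding inj_on_def using F C unfolding K_def
        by (auto simp: Icc_eq_Icc)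
      have tag: "p tagged_partial_division_of (cbox a b)"
        unfolding tagged_partial_division_of_def
      proof (intro conjI allI impI)
        show "finite p" using F by (simp add: p_def)
        fix x k assume "(x,k) \<in> p"
        then obtain u v where i: "(x,u,v) \<in> F" "k = {u..v}" by (auto simp: p_def)
        then have K: "(x,u,v) \<in> K" using F C by blast
        then show "x \<in> k" "k \<subseteq> cbox a b" using i by (auto simp: K_def)
        show "\<exists>a b. k = cbox a b" using i by auto
      next
        fix x k x' k' assume A: "(x,k) \<in> p \<and> (x',k') \<in> p \<and> (x,k) \<noteq> (x',k')"
        then have ne: "(x,k) \<noteq> (x',k')" by blast
        from A obtain u v where i: "(x,u,v) \<in> F" "k = {u..v}" by (auto simp: p_def)
        from A obtain u' v' where i': "(x',u',v') \<in> F" "k' = {u'..v'}" by (auto simp: p_def)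
        have "(x,u,v) \<noteq> (x',u',v')" using ne i i' by auto
        then have "disjnt (cball (c (x,u,v)) (r (x,u,v))) (cball (c (x',u',v')) (r (x',u',v')))"
          using C(3) i i' F by (meson pairwiseD subsetD)
        then have "k \<inter> k' = {}" unfolding cb using i i' by (simp add: disjnt_def)
        then show "interior k \<inter> interior k' = {}" using interior_subset by blast
      qed
      have fine: "\<gamma> fine p" using F C unfolding fine_def p_def K_def by fast
      have "(\<Sum>i\<in>F. 5 * (e * (2 * r i))) \<le> 5 * (\<Sum>i\<in>F. (\<lambda>(x,K). norm(measure lborel K *\<^sub>R f x - integral K f)) ((\<lambda>(x,u,v). (x, {u..v})) i))"
        unfolding sum_distrib_left
      proof (rule sum_mono)
        fix i assume "i \<in> F"
        then have "i \<in> K" using F C by blast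
        then show "5 * (e * (2 * r i)) \<le> 5 * (\<lambda>(x,K). norm(measure lborel K *\<^sub>R f x - integral K f)) ((\<lambda>(x,u,v). (x, {u..v})) i)"
          by (auto simp: K_def r_def)
      qed
      also have "(\<Sum>i\<in>F. (\<lambda>(x,K). norm(measure lborel K *\<^sub>R f x - integral K f)) ((\<lambda>(x,u,v). (x, {u..v})) i))
          = sum (\<lambda>(x,K). norm(measure lborel K *\<^sub>R f x - integral K f)) p"
        unfolding p_def by (subst sum.reindex[OF inj]) (simp add: o_def)
      also have "\<dots> < \<epsilon>'" by (rule H[OF tag fine])
      finally have le: "e * (\<Sum>i\<in>F. 2 * (5 * r i)) \<le> e * \<epsilon>"
        by (simp add: \<epsilon>'_def sum_distrib_left mult_ac)
      have "measure lebesgue (\<Union>i\<in>F. cball (c i) (5 * r i)) \<le> (\<Sum>i\<in>F. measure lebesgue (cball (c i) (5 * r i)))"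
        by (rule measure_UNION_le) (use F in auto)
      also have "\<dots> = (\<Sum>i\<in>F. 2 * (5 * r i))"
      proof (rule sum.cong[OF refl])
        fix i assume "i \<in> F"
        then have "i \<in> K" using F C by blast
        then have "r i > 0" by (auto simp: K_def r_def)
        then show "measure lebesgue (cball (c i) (5 * r i)) = 2 * (5 * r i)"
          by (simp add: cball_eq_atLeastAtMost)
      qed
      also have "\<dots> \<le> \<epsilon>" using le e by simp
      finally show ?thesis .
    qed
    show ?thesis
      using C(4) fmeasurable_UN_bound[OF C(1) _ fin] measure_UN_bound[OF C(1) _ fin]
      by (intro exI[of _ "\<Union>i\<in>C. cball (c i) (5 * r i)"]) auto
  qed
  then show ?thesis unfolding negligible_outer_le by blast
qed

text \<open>The exceptional set is the countable union of the bad sets for the thresholds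
  \<open>1 / (n + 1)\<close>. A bad set allows its point to be either endpoint of the interval, so
  both one-sided quotients are controlled together. The purpose is to differentiate
  \<open>y'\<close> almost everywhere.\<close>

theorem lebesgue_differentiation:
  fixes f :: "real \<Rightarrow> complex"
  assumes f: "f integrable_on {a..b}"
  obtains N where "negligible N"
    "\<And>x. x \<in> {a<..<b} - N \<Longrightarrow> ((\<lambda>x. integral {a..x} f) has_vector_derivative f x) (at x)"
proof -
  define S where "S = (\<lambda>e. {x\<in>{a<..<b}. \<forall>d>0. \<exists>u v. a \<le> u \<and> u \<le> x \<and> x \<le> v \<and> v \<le> b \<and> u < v \<and> v - u < d
            \<and> norm ((v - u) *\<^sub>R f x - integral {u..v} f) > e * (v - u)})"
  define N where "N = (\<Union>n. S (inverse (real (Suc n))))"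
  have "negligible N" unfolding N_def S_def
  proof (rule negligible_countable_Union)
    fix T assume "T \<in> range (\<lambda>n. {x\<in>{a<..<b}. \<forall>d>0. \<exists>u v. a \<le> u \<and> u \<le> x \<and> x \<le> v \<and> v \<le> b \<and> u < v \<and> v - u < d
            \<and> norm ((v - u) *\<^sub>R f x - integral {u..v} f) > inverse (real (Suc n)) * (v - u)})"
    then show "negligible T" by (elim imageE, simp only:) (rule negligible_interval_density_failure[OF f], simp)
  qed auto
  moreover have "((\<lambda>x. integral {a..x} f) has_vector_derivative f x) (at x)" if x: "x \<in> {a<..<b} - N" for x
    unfolding has_vector_derivative_def has_derivative_at_alt
  proof (intro conjI allI impI)
    show "bounded_linear (\<lambda>t. t *\<^sub>R f x)" by (rule bounded_linear_scaleR_left)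
    fix e :: real assume "e > 0"
    then obtain n where n: "inverse (real (Suc n)) < e" using reals_Archimedean by blast
    from x have "x \<notin> S (inverse (real (Suc n)))" by (auto simp: N_def)
    with x obtain d where d: "d > 0" and D: "\<And>u v. \<lbrakk>a \<le> u; u \<le> x; x \<le> v; v \<le> b; u < v; v - u < d\<rbrakk>
        \<Longrightarrow> norm ((v - u) *\<^sub>R f x - integral {u..v} f) \<le> inverse (real (Suc n)) * (v - u)"
      unfolding S_def by force
    show "\<exists>d>0. \<forall>y. norm (y - x) < d \<longrightarrow>
        norm (integral {a..y} f - integral {a..x} f - (y - x) *\<^sub>R f x) \<le> e * norm (y - x)"
    proof (intro exI conjI allI impI)
      show "min d (min (x - a) (b - x)) > 0" using d x by auto
      fix y assume y: "norm (y - x) < min d (min (x - a) (b - x))"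
      consider "y < x" | "y = x" | "x < y" by linarith
      then show "norm (integral {a..y} f - integral {a..x} f - (y - x) *\<^sub>R f x) \<le> e * norm (y - x)"
      proof cases
        case 1
        have "f integrable_on {a..x}" using f by (rule integrable_on_subinterval) (use x in auto)
        then have "integral {a..y} f + integral {y..x} f = integral {a..x} f"
          using y x 1 by (intro Henstock_Kurzweil_Integration.integral_combine) (auto simp: abs_if)
        then have *: "integral {a..y} f - integral {a..x} f = - integral {y..x} f"
          by (metis add_diff_cancel_left' minus_diff_eq diff_add_cancel add.commute)
        have "norm (integral {a..y} f - integral {a..x} f - (y - x) *\<^sub>R f x) =
              norm ((x - y) *\<^sub>R f x - integral {y..x} f)"
          unfolding * by (simp add: algebra_simps)
        also have "\<dots> \<le> inverse (real (Suc n)) * (x - y)"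
          by (rule D) (use y x 1 in \<open>auto simp: abs_if\<close>)
        also have "\<dots> \<le> e * (x - y)" using n 1 by (intro mult_right_mono) auto
        finally show ?thesis using 1 by simp
      next
        case 3
        have "f integrable_on {a..y}" using f by (rule integrable_on_subinterval) (use x y 3 in auto)
        then have "integral {a..x} f + integral {x..y} f = integral {a..y} f"
          using y x 3 by (intro Henstock_Kurzweil_Integration.integral_combine) (auto simp: abs_if)
        then have *: "integral {a..y} f - integral {a..x} f = integral {x..y} f"
          by (metis add_diff_cancel_left')
        have "norm (integral {a..y} f - integral {a..x} f - (y - x) *\<^sub>R f x) =
              norm ((y - x) *\<^sub>R f x - integral {x..y} f)"
          unfolding * by (simp add: norm_minus_commute)
        also have "\<dots> \<le> inverse (real (Suc n)) * (y - x)"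
          by (rule D) (use y x 3 in \<open>auto simp: abs_if\<close>)
        also have "\<dots> \<le> e * (y - x)" using n 3 by (intro mult_right_mono) auto
        finally show ?thesis using 3 by simp
      qed auto
    qed
  qed
  ultimately show ?thesis using that by blast
qed


subsection \<open>Absolute continuity\<close>

lemma integral_disjoint_intervals_le:
  fixes h :: "real \<Rightarrow> real"
  assumes h: "h integrable_on {a..b}" "\<And>x. x \<in> {a..b} \<Longrightarrow> 0 \<le> h x"
    and lr: "\<And>i. i < n \<Longrightarrow> a \<le> l i \<and> l i \<le> r i \<and> r i \<le> b"
    and disj: "\<And>i j. \<lbrakk>i < n; j < n; i \<noteq> j\<rbrakk> \<Longrightarrow> {l i<..<r i} \<inter> {l j<..<r j} = {}"
  shows "(\<Sum>i<n::nat. integral {l i..r i} h) \<le> integral {a..b} h"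
proof -
  have int: "(\<lambda>x. if x \<in> {l i<..<r i} then h x else 0) integrable_on {a..b}" if "i < n" for i
  proof -
    have "{l i<..<r i} \<inter> {a..b} = {l i<..<r i}" using lr[OF that] by auto
    moreover have "h integrable_on {l i<..<r i}"
      using integrable_on_subinterval[OF h(1)] lr[OF that]
      by (metis atLeastatMost_subset_iff integrable_on_Icc_iff_Ioo)
    ultimately show ?thesis unfolding integrable_restrict_Int by simp
  qed
  have "(\<Sum>i<n. integral {l i..r i} h) = (\<Sum>i<n. integral {a..b} (\<lambda>x. if x \<in> {l i<..<r i} then h x else 0))"
  proof (rule sum.cong[OF refl])
    fix i assume "i \<in> {..<n}"
    then have "{l i<..<r i} \<inter> {a..b} = {l i<..<r i}" using lr[of i] by auto
    then show "integral {l i..r i} h = integral {a..b} (\<lambda>x. if x \<in> {l i<..<r i} then h x else 0)"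
      unfolding integral_open_interval_real Henstock_Kurzweil_Integration.integral_restrict_Int by simp
  qed
  also have "\<dots> = integral {a..b} (\<lambda>x. \<Sum>i<n. if x \<in> {l i<..<r i} then h x else 0)"
    by (rule integral_sum[symmetric]) (use int in auto)
  also have "\<dots> \<le> integral {a..b} h"
  proof (rule integral_le)
    show "(\<lambda>x. \<Sum>i<n. if x \<in> {l i<..<r i} then h x else 0) integrable_on {a..b}"
      by (rule integrable_sum) (use int in auto)
    fix x assume x: "x \<in> {a..b}"
    show "(\<Sum>i<n. if x \<in> {l i<..<r i} then h x else 0) \<le> h x"
    proof (cases "\<exists>i<n. x \<in> {l i<..<r i}")
      case True
      then obtain i where i: "i < n" "x \<in> {l i<..<r i}" by blast
      have "(\<Sum>k<n. if x \<in> {l k<..<r k} then h x else 0) = (\<Sum>k<n. if k = i then h x else 0)"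
        by (rule sum.cong[OF refl]) (use disj i in force)
      also have "\<dots> = h x" using i by simp
      finally show ?thesis by simp
    next
      case False
      then have "(\<Sum>i<n. if x \<in> {l i<..<r i} then h x else 0) = 0"
        by (intro sum.neutral) auto
      then show ?thesis using h(2)[OF x] by simp
    qed
  qed (use h in auto)
  finally show ?thesis .
qed

text \<open>Uniform integrability of a single function, by dominated convergence along integer
  levels.\<close>

lemma integral_excess_small:
  fixes g :: "real \<Rightarrow> real"
  assumes g: "g absolutely_integrable_on {a..b}" and e: "e > 0"
  obtains M where "M > 0" "(\<lambda>x. max (g x - M) 0) absolutely_integrable_on {a..b}"
    "integral {a..b} (\<lambda>x. max (g x - M) 0) < e"
proof -
  have ai: "(\<lambda>x. max (g x - real k) 0) absolutely_integrable_on {a..b}" for k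
    by (intro absolutely_integrable_max_1 set_integral_diff g absolutely_integrable_on_const) auto
  have "(\<lambda>k. integral {a..b} (\<lambda>x. max (g x - real k) 0)) \<longlonglongrightarrow> integral {a..b} (\<lambda>x. 0)"
  proof (rule dominated_convergence(2))
    show "(\<lambda>x. max (g x - real k) 0) integrable_on {a..b}" for k
      using ai set_lebesgue_integral_eq_integral(1) by blast
    show "(\<lambda>x. \<bar>g x\<bar>) integrable_on {a..b}"
      using g unfolding absolutely_integrable_on_def by simp
    show "norm (max (g x - real k) 0) \<le> \<bar>g x\<bar>" for x k by auto
    show "(\<lambda>k. max (g x - real k) 0) \<longlonglongrightarrow> 0" for x
    proof (rule tendsto_eventually)
      obtain k0 :: nat where "g x \<le> real k0" using real_arch_simple by blast
      then show "\<forall>\<^sub>F k in sequentially. max (g x - real k) 0 = 0"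
        by (intro eventually_sequentiallyI[of k0]) auto
    qed
  qed
  then have "(\<lambda>k. integral {a..b} (\<lambda>x. max (g x - real k) 0)) \<longlonglongrightarrow> 0" by simp
  then have "\<forall>\<^sub>F k in sequentially. integral {a..b} (\<lambda>x. max (g x - real k) 0) < e"
    using e by (rule order_tendstoD)
  then have "\<forall>\<^sub>F k in sequentially. integral {a..b} (\<lambda>x. max (g x - real k) 0) < e \<and> k > 0"
    using eventually_gt_at_top by (rule eventually_conj)
  then obtain k where "integral {a..b} (\<lambda>x. max (g x - real k) 0) < e" "k > 0"
    by (metis (no_types, lifting) eventually_sequentially order_refl)
  then show ?thesis using that[of "real k"] ai by simp
qed

text \<open>Cut \<open>g\<close> at a high level \<open>M\<close>: the part below contributes at
  most \<open>M\<close> times the total length of the intervals, the part above less than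
  \<open>e/2\<close> over all of \<open>{a..b}\<close>. This dictates the choice
  \<open>e / (2 * M)\<close>.\<close>

lemma absolutely_continuous_onI_integral:
  fixes g :: "real \<Rightarrow> real"
  assumes g: "g absolutely_integrable_on {a..b}" "\<And>x. x \<in> {a..b} \<Longrightarrow> 0 \<le> g x"
    and u: "\<And>l r. \<lbrakk>a \<le> l; l \<le> r; r \<le> b\<rbrakk> \<Longrightarrow> norm (u r - u l) \<le> integral {l..r} g"
  shows "absolutely_continuous_on_interval a b u"
  unfolding absolutely_continuous_on_interval_def
proof (intro allI impI)
  fix e :: real assume e: "e > 0"
  obtain M where M: "M > 0" "(\<lambda>x. max (g x - M) 0) absolutely_integrable_on {a..b}"
    "integral {a..b} (\<lambda>x. max (g x - M) 0) < e/2"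
    using integral_excess_small[OF g(1), of "e/2"] e by auto
  let ?h = "\<lambda>x. max (g x - M) 0"
  have hi: "?h integrable_on {a..b}" using M(2) set_lebesgue_integral_eq_integral(1) by blast
  have gi: "g integrable_on {a..b}" using g(1) set_lebesgue_integral_eq_integral(1) by blast
  show "\<exists>\<delta>>0. \<forall>(n::nat) l r.
        (\<forall>i<n. a \<le> l i \<and> l i \<le> r i \<and> r i \<le> b) \<and>
        (\<forall>i<n. \<forall>j<n. i \<noteq> j \<longrightarrow> {l i<..<r i} \<inter> {l j<..<r j} = {}) \<and>
        (\<Sum>i<n. r i - l i) < \<delta> \<longrightarrow> (\<Sum>i<n. norm (u (r i) - u (l i))) < e"
  proof (intro exI[of _ "e / (2 * M)"] conjI allI impI)
    show "e / (2 * M) > 0" using e M by simp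
    fix n l r
    assume A: "(\<forall>i<n::nat. a \<le> l i \<and> l i \<le> r i \<and> r i \<le> b) \<and>
        (\<forall>i<n. \<forall>j<n. i \<noteq> j \<longrightarrow> {l i<..<r i} \<inter> {l j<..<r j} = {}) \<and>
        (\<Sum>i<n. r i - l i) < e / (2 * M)"
    have "(\<Sum>i<n. norm (u (r i) - u (l i))) \<le> (\<Sum>i<n. M * (r i - l i) + integral {l i..r i} ?h)"
    proof (rule sum_mono)
      fix i assume "i \<in> {..<n}"
      then have i: "a \<le> l i" "l i \<le> r i" "r i \<le> b" using A by auto
      have sub: "{l i..r i} \<subseteq> {a..b}" using i by auto
      have hi': "?h integrable_on {l i..r i}" by (rule integrable_on_subinterval[OF hi sub])
      have "norm (u (r i) - u (l i)) \<le> integral {l i..r i} g" using u i by simp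
      also have "\<dots> \<le> integral {l i..r i} (\<lambda>x. M + ?h x)"
        by (rule integral_le) (auto intro!: integrable_add hi' integrable_on_subinterval[OF gi sub])
      also have "\<dots> = integral {l i..r i} (\<lambda>x. M) + integral {l i..r i} ?h"
        by (rule Henstock_Kurzweil_Integration.integral_add) (auto intro: hi')
      also have "\<dots> = M * (r i - l i) + integral {l i..r i} ?h" using i by simp
      finally show "norm (u (r i) - u (l i)) \<le> M * (r i - l i) + integral {l i..r i} ?h" .
    qed
    also have "\<dots> = M * (\<Sum>i<n. r i - l i) + (\<Sum>i<n. integral {l i..r i} ?h)"
      by (simp add: sum.distrib sum_distrib_left)
    also have "\<dots> \<le> M * (\<Sum>i<n. r i - l i) + integral {a..b} ?h"
      using integral_disjoint_intervals_le[OF hi, of n l r] A by auto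
    also have "\<dots> < M * (e / (2 * M)) + e / 2"
      using A M by (intro add_strict_mono mult_strict_left_mono) auto
    also have "\<dots> = e" using M by simp
    finally show "(\<Sum>i<n. norm (u (r i) - u (l i))) < e" .
  qed
qed

section \<open>Integration by parts for primitives of integrable functions\<close>

lemma absolutely_integrable_continuous_mult:
  fixes w \<phi> :: "real \<Rightarrow> complex"
  assumes "w absolutely_integrable_on {a..b}" "continuous_on {a..b} \<phi>"
  shows "(\<lambda>x. w x * \<phi> x) absolutely_integrable_on {a..b}"
proof -
  have "(\<lambda>x. \<phi> x * w x) absolutely_integrable_on {a..b}"
  proof (rule absolutely_integrable_bounded_measurable_product[where h = "(*)"])
    show "\<phi> \<in> borel_measurable (lebesgue_on {a..b})"
      using assms(2) by (intro continuous_imp_measurable_on_sets_lebesgue) auto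
    show "bounded (\<phi> ` {a..b})"
      using assms(2) by (intro compact_imp_bounded compact_continuous_image) auto
  qed (use assms in \<open>auto intro: bilinear_times\<close>)
  then show ?thesis by (simp add: mult.commute)
qed

text \<open>Increments bounded by length times an integral are of second order: over
  \<open>N\<close> equal pieces the bounds add up to \<open>C * (b - a) / N\<close> times one fixed
  integral. This stands in for the theorem that an absolutely continuous function with derivative 0
  almost everywhere is constant.\<close>

lemma eq_0_if_locally_small:
  fixes G :: "real \<Rightarrow> complex" and g :: "real \<Rightarrow> real"
  assumes g: "g integrable_on {a..b}" and "a \<le> b" "C \<ge> 0"
    and G: "\<And>l r. \<lbrakk>a \<le> l; l \<le> r; r \<le> b\<rbrakk> \<Longrightarrow> norm (G r - G l) \<le> C * (r - l) * integral {l..r} g"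
  shows "G b = G a"
proof -
  have "norm (G b - G a) \<le> C * (b - a) * integral {a..b} g / real N" if N: "N > 0" for N :: nat
  proof -
    define t where "t = (\<lambda>i::nat. a + (b - a) * real i / real N)"
    have t0: "t 0 = a" "t N = b" using N by (auto simp: t_def)
    have tm: "t i \<le> t j" if "i \<le> j" for i j using that assms(2) N
      by (auto simp: t_def intro!: divide_right_mono mult_left_mono)
    have *: "norm (G (t k) - G a) \<le> C * ((b - a) / real N) * integral {a..t k} g" if "k \<le> N" for k
      using that
    proof (induction k)
      case 0
      then show ?case by (simp add: t0)
    next
      case (Suc k)
      have b: "a \<le> t k" "t k \<le> t (Suc k)" "t (Suc k) \<le> b"
        using tm[of 0 k] tm[of k "Suc k"] tm[of "Suc k" N] t0 Suc.prems by auto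
      have d: "t (Suc k) - t k = (b - a) / real N" using N by (simp add: t_def field_simps)
      have I: "integral {a..t k} g + integral {t k..t (Suc k)} g = integral {a..t (Suc k)} g"
        using b by (intro Henstock_Kurzweil_Integration.integral_combine integrable_on_subinterval[OF g]) auto
      have "norm (G (t (Suc k)) - G (t k)) \<le> C * ((b - a) / real N) * integral {t k..t (Suc k)} g"
        using G[OF b] unfolding d .
      moreover have "norm (G (t (Suc k)) - G a) \<le> norm (G (t (Suc k)) - G (t k)) + norm (G (t k) - G a)"
        using norm_triangle_ineq[of "G (t (Suc k)) - G (t k)" "G (t k) - G a"] by simp
      moreover have "norm (G (t k) - G a) \<le> C * ((b - a) / real N) * integral {a..t k} g"
        using Suc.IH Suc.prems by simp
      ultimately show ?case
        using distrib_left[of "C * ((b - a) / real N)" "integral {a..t k} g" "integral {t k..t (Suc k)} g", unfolded I]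
        by linarith
    qed
    from *[of N] t0 show ?thesis by simp
  qed
  then have "\<forall>\<^sub>F N in sequentially. norm (G b - G a) \<le> C * (b - a) * integral {a..b} g / real N"
    by (intro eventually_sequentiallyI[of 1]) auto
  moreover have "(\<lambda>N. C * (b - a) * integral {a..b} g / real N) \<longlonglongrightarrow> 0"
    by (rule lim_const_over_n)
  ultimately have "norm (G b - G a) \<le> 0"
    using tendsto_lowerbound by (metis trivial_limit_sequentially)
  then show ?thesis by simp
qed

text \<open>The difference \<open>G\<close> of the two sides, with variable upper limit, has over
  \<open>{l..r}\<close> the increment \<open>integral of w (\<phi> r - \<phi>)\<close> minus
  \<open>integral of (F - F l) \<phi>'\<close>. Either term is at most \<open>M * (r - l)\<close>
  times the integral of \<open>norm (w x)\<close>, so \<open>G\<close> is constant by the preceding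
  criterion.\<close>

lemma integral_by_parts_primitive:
  fixes w \<phi> \<phi>' :: "real \<Rightarrow> complex"
  assumes w: "w absolutely_integrable_on {a..b}" and "a \<le> b"
    and c': "continuous_on {a..b} \<phi>'"
    and d: "\<And>x. x \<in> {a..b} \<Longrightarrow> (\<phi> has_vector_derivative \<phi>' x) (at x within {a..b})"
    and F: "\<And>x. x \<in> {a..b} \<Longrightarrow> F x = c + integral {a..x} w"
  shows "integral {a..b} (\<lambda>x. F x * \<phi>' x) = F b * \<phi> b - F a * \<phi> a - integral {a..b} (\<lambda>x. w x * \<phi> x)"
proof -
  have wi: "w integrable_on {a..b}" using w set_lebesgue_integral_eq_integral(1) by blast
  have ni: "(\<lambda>x. norm (w x)) integrable_on {a..b}" using w unfolding absolutely_integrable_on_def by simp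
  have contphi: "continuous_on {a..b} \<phi>"
    using d by (meson continuous_on_eq_continuous_within has_vector_derivative_continuous)
  have "continuous_on {a..b} (\<lambda>x. c + integral {a..x} w)"
    by (intro continuous_intros indefinite_integral_continuous_1 wi)
  then have contF: "continuous_on {a..b} F"
    using F by (subst continuous_on_cong) auto
  obtain M where M: "\<And>x. x \<in> {a..b} \<Longrightarrow> norm (\<phi>' x) \<le> M" "M \<ge> 0"
  proof -
    have "bounded (\<phi>' ` {a..b})"
      using c' by (intro compact_imp_bounded compact_continuous_image) auto
    then obtain M where "M > 0" "\<forall>y\<in>\<phi>' ` {a..b}. norm y \<le> M"
      unfolding bounded_pos by blast
    then show ?thesis using that[of M] by auto
  qed
  define G where "G = (\<lambda>x. F x * \<phi> x - integral {a..x} (\<lambda>x. F x * \<phi>' x) - integral {a..x} (\<lambda>x. w x * \<phi> x))"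
  have i1: "(\<lambda>x. F x * \<phi>' x) integrable_on {a..b}"
    by (intro integrable_continuous_interval continuous_intros contF c')
  have i2: "(\<lambda>x. w x * \<phi> x) integrable_on {a..b}"
    using absolutely_integrable_continuous_mult[OF w contphi] set_lebesgue_integral_eq_integral(1) by blast
  have "G b = G a"
  proof (rule eq_0_if_locally_small[OF ni \<open>a \<le> b\<close>, of "2 * M"])
    show "2 * M \<ge> 0" using M by simp
    fix l r assume lr: "a \<le> l" "l \<le> r" "r \<le> b"
    have sub: "{l..r} \<subseteq> {a..b}" using lr by auto
    have comb: "integral {a..r} h - integral {a..l} h = integral {l..r} h"
      if "h integrable_on {a..b}" for h :: "real \<Rightarrow> complex"
    proof -
      have "h integrable_on {a..r}" by (rule integrable_on_subinterval[OF that]) (use lr in auto)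
      then show ?thesis using Henstock_Kurzweil_Integration.integral_combine[of a l r h] lr by (metis add_diff_cancel_left')
    qed
    have wlr: "w integrable_on {l..r}" by (rule integrable_on_subinterval[OF wi sub])
    have nlr: "(\<lambda>x. norm (w x)) integrable_on {l..r}" by (rule integrable_on_subinterval[OF ni sub])
    have FF: "F r - F l = integral {l..r} w" using F lr comb[OF wi] by simp
    have pp: "integral {l..r} \<phi>' = \<phi> r - \<phi> l"
      by (rule integral_unique, rule fundamental_theorem_of_calculus)
         (use lr d in \<open>auto intro: has_vector_derivative_within_subset[OF _ sub]\<close>)
    have phidiff: "norm (\<phi> r - \<phi> x) \<le> M * (r - l)" if x: "x \<in> {l..r}" for x
    proof -
      have bnd: "\<bar>h\<bar> * norm (\<phi>' y) \<le> M * \<bar>h\<bar>" if "y \<in> {a..b}" for h y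
        using mult_left_mono[OF M(1)[OF that], of "\<bar>h\<bar>"] by (simp add: mult.commute)
      have "norm (\<phi> r - \<phi> x) \<le> M * norm (r - x)"
        by (rule differentiable_bound[of "{a..b}" \<phi> "\<lambda>x h. h *\<^sub>R \<phi>' x"])
           (use d lr x M in \<open>auto simp: has_vector_derivative_def intro!: onorm_le bnd\<close>)
      also have "\<dots> \<le> M * (r - l)" using x M by (intro mult_left_mono) auto
      finally show ?thesis .
    qed
    have Fdiff: "norm (F x - F l) \<le> integral {l..r} (\<lambda>x. norm (w x))" if x: "x \<in> {l..r}" for x
    proof -
      have "F x - F l = integral {l..x} w"
      proof -
        have "w integrable_on {a..x}" by (rule integrable_on_subinterval[OF wi]) (use lr x in auto)
        then have "integral {a..l} w + integral {l..x} w = integral {a..x} w"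
          by (intro Henstock_Kurzweil_Integration.integral_combine) (use lr x in auto)
        then show ?thesis using F lr x by (auto simp: algebra_simps)
      qed
      moreover have "norm (integral {l..x} w) \<le> integral {l..x} (\<lambda>x. norm (w x))"
        by (rule Henstock_Kurzweil_Integration.integral_norm_bound_integral)
           (use x in \<open>auto intro: integrable_on_subinterval[OF wlr] integrable_on_subinterval[OF nlr]\<close>)
      moreover have "integral {l..x} (\<lambda>x. norm (w x)) \<le> integral {l..r} (\<lambda>x. norm (w x))"
        by (rule integral_subset_le) (use x in \<open>auto intro: integrable_on_subinterval[OF nlr] nlr\<close>)
      ultimately show ?thesis by simp
    qed
    have i3: "(\<lambda>x. w x * (\<phi> r - \<phi> x)) integrable_on {l..r}"
    proof -
      have "(\<lambda>x. w x * (\<phi> r - \<phi> x)) absolutely_integrable_on {l..r}"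
        by (intro absolutely_integrable_continuous_mult continuous_intros continuous_on_subset[OF contphi sub]
            absolutely_integrable_on_subinterval[OF w sub])
      then show ?thesis using set_lebesgue_integral_eq_integral(1) by blast
    qed
    have i4: "(\<lambda>x. (F x - F l) * \<phi>' x) integrable_on {l..r}"
      by (intro integrable_continuous_interval continuous_intros continuous_on_subset[OF contF sub]
          continuous_on_subset[OF c' sub])
    have e1: "integral {l..r} (\<lambda>x. w x * (\<phi> r - \<phi> x)) = integral {l..r} w * \<phi> r - integral {l..r} (\<lambda>x. w x * \<phi> x)"
      unfolding right_diff_distrib
      by (subst Henstock_Kurzweil_Integration.integral_diff)
         (auto intro!: integrable_on_mult_left wlr integrable_on_subinterval[OF i2 sub])
    have e2: "integral {l..r} (\<lambda>x. (F x - F l) * \<phi>' x) = integral {l..r} (\<lambda>x. F x * \<phi>' x) - F l * (\<phi> r - \<phi> l)"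
      unfolding left_diff_distrib
      by (subst Henstock_Kurzweil_Integration.integral_diff)
         (auto intro!: integrable_on_mult_right integrable_on_subinterval[OF i1 sub]
             integrable_continuous_interval continuous_on_mult_left continuous_on_subset[OF c' sub] simp: pp)
    have "G r - G l = integral {l..r} (\<lambda>x. w x * (\<phi> r - \<phi> x)) - integral {l..r} (\<lambda>x. (F x - F l) * \<phi>' x)"
      unfolding e1 e2 FF[symmetric] G_def using comb[OF i1] comb[OF i2]
      by (simp add: algebra_simps)
    moreover have "norm (integral {l..r} (\<lambda>x. w x * (\<phi> r - \<phi> x))) \<le> integral {l..r} (\<lambda>x. norm (w x) * (M * (r - l)))"
      by (rule Henstock_Kurzweil_Integration.integral_norm_bound_integral)
         (use i3 nlr phidiff in \<open>auto simp: norm_mult intro!: mult_left_mono integrable_on_mult_left\<close>)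
    moreover have "norm (integral {l..r} (\<lambda>x. (F x - F l) * \<phi>' x)) \<le> integral {l..r} (\<lambda>x. integral {l..r} (\<lambda>x. norm (w x)) * M)"
      by (rule Henstock_Kurzweil_Integration.integral_norm_bound_integral)
         (use i4 Fdiff M lr in \<open>auto simp: norm_mult intro!: mult_mono integral_nonneg nlr\<close>)
    ultimately have "norm (G r - G l) \<le> integral {l..r} (\<lambda>x. norm (w x) * (M * (r - l))) + integral {l..r} (\<lambda>x. integral {l..r} (\<lambda>x. norm (w x)) * M)"
      by (smt (verit) norm_triangle_ineq4)
    also have "\<dots> = 2 * M * (r - l) * integral {l..r} (\<lambda>x. norm (w x))"
      using lr by (simp add: mult_ac)
    finally show "norm (G r - G l) \<le> 2 * M * (r - l) * integral {l..r} (\<lambda>x. norm (w x))" .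
  qed
  then show ?thesis unfolding G_def by (simp add: algebra_simps)
qed


section \<open>Riemann-Stieltjes sums on uniform grids\<close>

lemma uniform_partition_close:
  fixes h :: "real \<Rightarrow> 'a::metric_space"
  assumes "continuous_on {0..1} h" "e > 0"
  obtains N0 :: nat where "N0 > 0"
    "\<And>N x y. \<lbrakk>N \<ge> N0; x \<in> {0..1}; y \<in> {0..1}; \<bar>x - y\<bar> \<le> 1 / real N\<rbrakk> \<Longrightarrow> dist (h x) (h y) < e"
proof -
  have "uniformly_continuous_on {0..1} h"
    using assms(1) by (intro compact_uniformly_continuous) auto
  then obtain d where d: "d > 0" "\<And>x y. \<lbrakk>x \<in> {0..1}; y \<in> {0..1}; dist y x < d\<rbrakk> \<Longrightarrow> dist (h y) (h x) < e"
    using assms(2) unfolding uniformly_continuous_on_def by metis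
  obtain N0 :: nat where N0: "inverse (real (Suc N0)) < d" using d(1) reals_Archimedean by blast
  show ?thesis
  proof (rule that[of "Suc N0"])
    fix N :: nat and x y :: real
    assume A: "N \<ge> Suc N0" "x \<in> {0..1}" "y \<in> {0..1}" "\<bar>x - y\<bar> \<le> 1 / real N"
    have "1 / real N \<le> inverse (real (Suc N0))" using A(1) by (simp add: inverse_eq_divide frac_le)
    then show "dist (h x) (h y) < e" using A N0 d(2)[of y x] by (auto simp: dist_real_def)
  qed simp
qed

lemma integral_uniform_partition:
  fixes h :: "real \<Rightarrow> 'a::banach"
  assumes h: "h integrable_on {0..1}" and N: "N > 0"
  shows "integral {0..1} h = (\<Sum>i<N. integral {real i / real N..real (Suc i) / real N} h)"
proof -
  have "integral {0..real k / real N} h = (\<Sum>i<k. integral {real i / real N..real (Suc i) / real N} h)"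
    if "k \<le> N" for k
    using that
  proof (induction k)
    case (Suc k)
    have le1: "real (Suc k) / real N \<le> 1" using Suc.prems N by simp
    have le2: "real k / real N \<le> real (Suc k) / real N" using N by (simp add: divide_right_mono)
    have "integral {0..real k / real N} h + integral {real k / real N..real (Suc k) / real N} h
         = integral {0..real (Suc k) / real N} h"
      by (rule Henstock_Kurzweil_Integration.integral_combine[OF _ le2 integrable_on_subinterval[OF h]]) (use le1 in auto)
    then show ?case using Suc by simp
  qed simp
  from this[of N] N show ?thesis by simp
qed

lemma sum_by_parts:
  fixes a b :: "nat \<Rightarrow> 'a::comm_ring"
  shows "(\<Sum>i<n. a i * (b (Suc i) - b i)) = a n * b n - a 0 * b 0 - (\<Sum>i<n. b (Suc i) * (a (Suc i) - a i))"
  by (induction n) (simp_all add: algebra_simps)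

lemma absolutely_continuous_on_intervalD_uniform:
  assumes "absolutely_continuous_on_interval 0 1 u" "e > 0"
  obtains d where "d > 0" "\<And>N I. \<lbrakk>I \<subseteq> {..<N}; real (card I) / real N < d; N > 0\<rbrakk> \<Longrightarrow>
      (\<Sum>i\<in>I. norm (u (real (Suc i) / real N) - u (real i / real N))) < e"
proof -
  obtain d where d: "d > 0" and D: "\<And>(n::nat) l r.
        (\<forall>i<n. 0 \<le> l i \<and> l i \<le> r i \<and> r i \<le> 1) \<and>
        (\<forall>i<n. \<forall>j<n. i \<noteq> j \<longrightarrow> {l i<..<r i} \<inter> {l j<..<r j} = {}) \<and>
        (\<Sum>i<n. r i - l i) < d \<longrightarrow> (\<Sum>i<n. norm (u (r i) - u (l i))) < e"
    using assms(1)[unfolded absolutely_continuous_on_interval_def, rule_format, OF assms(2)] by blast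
  show ?thesis
  proof (rule that[OF d])
    fix N :: nat and I assume I: "I \<subseteq> {..<N}" "real (card I) / real N < d" and N: "N > 0"
    define l where "l = (\<lambda>i::nat. real i / real N)"
    \<comment> \<open>Cells outside \<open>I\<close> are collapsed to points, which avoids
      enumerating \<open>I\<close>: the family keeps its length \<open>N\<close> and only cells in
      \<open>I\<close> contribute.\<close>
    define r where "r = (\<lambda>i. if i \<in> I then real (Suc i) / real N else real i / real N)"
    have disj: "{l i<..<r i} \<inter> {l j<..<r j} = {}" if "i < j" for i j
    proof -
      have "r i \<le> real (Suc i) / real N" using N by (auto simp: r_def divide_right_mono)
      also have "\<dots> \<le> l j" unfolding l_def using that N by (intro divide_right_mono) auto
      finally show ?thesis by auto
    qed
    have "(\<Sum>i<N. r i - l i) = (\<Sum>i<N. if i \<in> I then 1 / real N else 0)"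
      by (rule sum.cong) (auto simp: r_def l_def field_simps)
    also have "\<dots> = real (card I) / real N"
      using I(1) by (simp add: sum.If_cases Int_absorb1)
    finally have "(\<Sum>i<N. r i - l i) < d" using I by simp
    moreover have "\<forall>i<N. \<forall>j<N. i \<noteq> j \<longrightarrow> {l i<..<r i} \<inter> {l j<..<r j} = {}"
      using disj by (metis Int_commute linorder_neqE_nat)
    moreover have "\<forall>i<N. 0 \<le> l i \<and> l i \<le> r i \<and> r i \<le> 1"
      using N by (auto simp: l_def r_def divide_right_mono)
    ultimately have "(\<Sum>i<N. norm (u (r i) - u (l i))) < e" using D by blast
    also have "(\<Sum>i<N. norm (u (r i) - u (l i))) =
        (\<Sum>i<N. if i \<in> I then norm (u (real (Suc i) / real N) - u (real i / real N)) else 0)"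
      by (rule sum.cong) (auto simp: r_def l_def)
    also have "\<dots> = (\<Sum>i\<in>I. norm (u (real (Suc i) / real N) - u (real i / real N)))"
      using I(1) by (simp add: sum.If_cases Int_absorb1)
    finally show "(\<Sum>i\<in>I. norm (u (real (Suc i) / real N) - u (real i / real N))) < e" .
  qed
qed

text \<open>A grid of \<open>K * L\<close> cells splits into \<open>K\<close> blocks of
  \<open>L\<close> cells. Each block has total length \<open>1 / K\<close>, short enough for
  variation at most 1, and this does not depend on the refinement \<open>L\<close>.\<close>

lemma absolutely_continuous_variation_bound:
  assumes "absolutely_continuous_on_interval 0 1 u"
  obtains K :: nat where "K > 0" "\<And>L. L > 0 \<Longrightarrow>
      (\<Sum>i<K*L. norm (u (real (Suc i) / real (K*L)) - u (real i / real (K*L)))) \<le> real K"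
proof -
  obtain d where d: "d > 0" "\<And>N I. \<lbrakk>I \<subseteq> {..<N}; real (card I) / real N < d; N > 0\<rbrakk> \<Longrightarrow>
      (\<Sum>i\<in>I. norm (u (real (Suc i) / real N) - u (real i / real N))) < 1"
    by (rule absolutely_continuous_on_intervalD_uniform[OF assms zero_less_one]) blast
  obtain k :: nat where k: "inverse (real (Suc k)) < d" using d(1) reals_Archimedean by blast
  define K where "K = Suc k"
  show ?thesis
  proof (rule that)
    show "K > 0" by (simp add: K_def)
    fix L :: nat assume L: "L > 0"
    define F where "F = (\<lambda>i. norm (u (real (Suc i) / real (K*L)) - u (real i / real (K*L))))"
    have "sum F {m*L..<m*L+L} \<le> 1" if "m < K" for m
    proof -
      have "m * L + L \<le> K * L" using that by (metis Suc_leI add.commute mult_Suc mult_le_mono1)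
      then have "{m*L..<m*L+L} \<subseteq> {..<K*L}" by auto
      moreover have "real (card {m*L..<m*L+L}) / real (K*L) < d"
      proof -
        have c: "real L / (c * real L) = inverse c" for c
          using L by (simp add: inverse_eq_divide)
        have "real (card {m*L..<m*L+L}) / real (K*L) = inverse (real (Suc k))"
          unfolding K_def of_nat_mult card_atLeastLessThan add_diff_cancel_left' by (rule c)
        then show ?thesis using k by simp
      qed
      ultimately show ?thesis unfolding F_def using d(2)[of "{m*L..<m*L+L}" "K*L"] L by (simp add: K_def)
    qed
    then have "(\<Sum>m<K. sum F {m*L..<m*L+L}) \<le> (\<Sum>m<K. 1)" by (intro sum_mono) auto
    then show "sum F {..<K*L} \<le> real K" by (simp add: sum.nat_group)
  qed
qed

text \<open>\<open>\<integral> \<phi>' u\<close> stands for \<open>- \<integral> \<phi> du\<close>. Working with this functional lets one treat the decay of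
  Fourier coefficients without an integrable derivative of \<open>u\<close>.\<close>

lemma absolutely_continuous_functional_small:
  assumes ac: "absolutely_continuous_on_interval 0 1 u" and cu: "continuous_on {0..1} u"
    and u01: "u 0 = u 1" and e: "e > 0"
  obtains \<eta> where "\<eta> > 0" "\<And>\<phi> \<phi>'. \<lbrakk>continuous_on {0..1} \<phi>';
      \<And>x. x \<in> {0..1} \<Longrightarrow> (\<phi> has_vector_derivative \<phi>' x) (at x within {0..1}); \<phi> 0 = \<phi> 1;
      \<And>x. x \<in> {0..1} \<Longrightarrow> norm (\<phi> x) \<le> 1; integral {0..1} (\<lambda>x. (norm (\<phi> x))\<^sup>2) < \<eta>\<rbrakk>
      \<Longrightarrow> norm (integral {0..1} (\<lambda>x. \<phi>' x * u x)) \<le> e"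
proof -
  obtain K :: nat where K: "K > 0" "\<And>L. L > 0 \<Longrightarrow>
      (\<Sum>i<K*L. norm (u (real (Suc i) / real (K*L)) - u (real i / real (K*L)))) \<le> real K"
    by (rule absolutely_continuous_variation_bound[OF ac]) blast
  obtain d where d: "d > 0" "\<And>N I. \<lbrakk>I \<subseteq> {..<N}; real (card I) / real N < d; N > 0\<rbrakk> \<Longrightarrow>
      (\<Sum>i\<in>I. norm (u (real (Suc i) / real N) - u (real i / real N))) < e/3"
    by (rule absolutely_continuous_on_intervalD_uniform[OF ac, of "e/3"]) (use e in \<open>simp, blast\<close>)
  \<comment> \<open>The budget \<open>e\<close> is split in three: replacing the integral by a
    Riemann sum, nodes where \<open>\<phi>\<close> is at most \<open>\<rho>\<close> (these cost
    \<open>\<rho>\<close> times the variation bound \<open>K\<close>), and the remaining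
    nodes.\<close>
  define \<rho> where "\<rho> = e / (3 * real K)"
  have \<rho>: "\<rho> > 0" using e K by (simp add: \<rho>_def)
  \<comment> \<open>Chebyshev: on a fine grid the mean square of \<open>\<phi>\<close> is below
    \<open>2 * \<eta>\<close>, so a fraction of less than
    \<open>2 * \<eta> / \<rho>\<^sup>2 = d\<close> of the nodes has \<open>\<phi>\<close> above
    \<open>\<rho>\<close>. It is essential that \<open>\<eta>\<close> is fixed before
    \<open>\<phi>\<close>; the grid may depend on \<open>\<phi>\<close>.\<close>
  define \<eta> where "\<eta> = \<rho>\<^sup>2 * d / 2"
  have \<eta>: "\<eta> > 0" using \<rho> d by (simp add: \<eta>_def)
  show ?thesis
  proof (rule that[OF \<eta>])
    fix \<phi> \<phi>' :: "real \<Rightarrow> complex"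
    assume c': "continuous_on {0..1} \<phi>'"
      and der: "\<And>x. x \<in> {0..1} \<Longrightarrow> (\<phi> has_vector_derivative \<phi>' x) (at x within {0..1})"
      and per: "\<phi> 0 = \<phi> 1" and b1: "\<And>x. x \<in> {0..1} \<Longrightarrow> norm (\<phi> x) \<le> 1"
      and small: "integral {0..1} (\<lambda>x. (norm (\<phi> x))\<^sup>2) < \<eta>"
    have cphi: "continuous_on {0..1} \<phi>"
      using der by (meson continuous_on_eq_continuous_within has_vector_derivative_continuous)
    obtain M where M: "M > 0" "\<And>x. x \<in> {0..1} \<Longrightarrow> norm (\<phi>' x) \<le> M"
    proof -
      have "bounded (\<phi>' ` {0..1})"
        using c' by (intro compact_imp_bounded compact_continuous_image) auto
      then obtain M where "M > 0" "\<forall>y\<in>\<phi>' ` {0..1}. norm y \<le> M"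
        unfolding bounded_pos by blast
      then show ?thesis using that[of M] by auto
    qed
    obtain N1 where N1: "N1 > 0" "\<And>N x y. \<lbrakk>N \<ge> N1; x \<in> {0..1}; y \<in> {0..1}; \<bar>x - y\<bar> \<le> 1 / real N\<rbrakk> \<Longrightarrow> dist (u x) (u y) < e / (3 * M)"
      by (rule uniform_partition_close[OF cu, of "e / (3 * M)"]) (use e M in \<open>simp, blast\<close>)
    have c2: "continuous_on {0..1} (\<lambda>x. (norm (\<phi> x))\<^sup>2)" by (intro continuous_intros cphi)
    obtain N2 where N2: "N2 > 0" "\<And>N x y. \<lbrakk>N \<ge> N2; x \<in> {0..1}; y \<in> {0..1}; \<bar>x - y\<bar> \<le> 1 / real N\<rbrakk> \<Longrightarrow> dist ((norm (\<phi> x))\<^sup>2) ((norm (\<phi> y))\<^sup>2) < \<eta>"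
      by (rule uniform_partition_close[OF c2 \<eta>]) blast
    define L where "L = N1 + N2"
    define N where "N = K * L"
    have L: "L > 0" using N1 by (simp add: L_def)
    have N: "N \<ge> N1" "N \<ge> N2" "N > 0" using K(1) N1(1) unfolding N_def L_def
      by (auto intro: order_trans[OF _ mult_le_mono1[of 1]])
    define t where "t = (\<lambda>i. real i / real N)"
    have t: "0 \<le> t i" "t i \<le> t (Suc i)" "t (Suc i) \<le> 1" "t (Suc i) - t i = 1 / real N" if "i < N" for i
      using that N by (auto simp: t_def field_simps)
    have sub: "{t i..t (Suc i)} \<subseteq> {0..1}" if "i < N" for i using t[OF that] by auto
    have var: "(\<Sum>i<N. norm (u (t (Suc i)) - u (t i))) \<le> real K"
      using K(2)[OF L] unfolding N_def t_def .
    have pd: "integral {t i..t (Suc i)} \<phi>' = \<phi> (t (Suc i)) - \<phi> (t i)" if "i < N" for i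
      by (rule integral_unique, rule fundamental_theorem_of_calculus)
         (use t[OF that] der in \<open>auto intro: has_vector_derivative_within_subset[OF _ sub[OF that]]\<close>)
    have i1: "(\<lambda>x. \<phi>' x * u x) integrable_on {0..1}"
      by (intro integrable_continuous_interval continuous_intros c' cu)
    define A where "A = (\<Sum>i<N. u (t i) * (\<phi> (t (Suc i)) - \<phi> (t i)))"
    have "norm (integral {0..1} (\<lambda>x. \<phi>' x * u x) - A) \<le> e / 3"
    proof -
      have "integral {0..1} (\<lambda>x. \<phi>' x * u x) - A =
          (\<Sum>i<N. integral {t i..t (Suc i)} (\<lambda>x. \<phi>' x * u x) - u (t i) * (\<phi> (t (Suc i)) - \<phi> (t i)))"
        unfolding A_def integral_uniform_partition[OF i1 N(3)] t_def by (simp add: sum_subtractf)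
      also have "norm \<dots> \<le> (\<Sum>i<N. e / 3 * (1 / real N))"
      proof (rule sum_norm_le)
        fix i assume "i \<in> {..<N}"
        then have i: "i < N" by simp
        have ii: "(\<lambda>x. \<phi>' x * u x) integrable_on {t i..t (Suc i)}"
          by (rule integrable_on_subinterval[OF i1 sub[OF i]])
        have ip: "\<phi>' integrable_on {t i..t (Suc i)}"
          by (intro integrable_continuous_interval continuous_on_subset[OF c' sub[OF i]])
        have "integral {t i..t (Suc i)} (\<lambda>x. \<phi>' x * (u x - u (t i))) =
           integral {t i..t (Suc i)} (\<lambda>x. \<phi>' x * u x) - u (t i) * (\<phi> (t (Suc i)) - \<phi> (t i))"
          unfolding right_diff_distrib pd[OF i, symmetric]
          by (subst Henstock_Kurzweil_Integration.integral_diff)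
             (auto intro!: integrable_on_mult_left ii ip simp: mult.commute)
        moreover have "norm (integral {t i..t (Suc i)} (\<lambda>x. \<phi>' x * (u x - u (t i)))) \<le> M * (e / (3 * M)) * (t (Suc i) - t i)"
        proof (rule integral_bound)
          show "continuous_on {t i..t (Suc i)} (\<lambda>x. \<phi>' x * (u x - u (t i)))"
            by (intro continuous_intros continuous_on_subset[OF c' sub[OF i]] continuous_on_subset[OF cu sub[OF i]])
          show "norm (\<phi>' x * (u x - u (t i))) \<le> M * (e / (3 * M))" if x: "x \<in> {t i..t (Suc i)}" for x
          proof -
            have "dist (u x) (u (t i)) < e / (3 * M)"
              by (rule N1(2)[OF N(1)]) (use x t[OF i] in auto)
            moreover have "norm (\<phi>' x) \<le> M" using M(2) sub[OF i] x by blast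
            ultimately show ?thesis unfolding norm_mult dist_norm using M(1)
              by (intro mult_mono) auto
          qed
        qed (use t[OF i] in auto)
        ultimately show "norm (integral {t i..t (Suc i)} (\<lambda>x. \<phi>' x * u x) - u (t i) * (\<phi> (t (Suc i)) - \<phi> (t i))) \<le> e / 3 * (1 / real N)"
          using M(1) t(4)[OF i] by simp
      qed
      also have "\<dots> = e / 3" using N by simp
      finally show ?thesis .
    qed
    moreover have "norm A \<le> 2 * e / 3"
    proof -
      have tt: "t 0 = 0" "t N = 1" using N by (auto simp: t_def)
      \<comment> \<open>Abel summation moves the difference from \<open>\<phi>\<close> to
        \<open>u\<close>; the boundary terms cancel because both functions take equal values at 0
        and 1.\<close>
      have "A = - (\<Sum>i<N. \<phi> (t (Suc i)) * (u (t (Suc i)) - u (t i)))"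
        unfolding A_def sum_by_parts[of "\<lambda>i. u (t i)" "\<lambda>i. \<phi> (t i)"] tt using u01 per by simp
      then have "norm A \<le> (\<Sum>i<N. norm (\<phi> (t (Suc i))) * norm (u (t (Suc i)) - u (t i)))"
        by (simp add: sum_norm_le norm_mult)
      also have "\<dots> \<le> (\<Sum>i<N. \<rho> * norm (u (t (Suc i)) - u (t i)) +
          (if norm (\<phi> (t (Suc i))) > \<rho> then norm (u (t (Suc i)) - u (t i)) else 0))"
      proof (rule sum_mono)
        fix i assume "i \<in> {..<N}"
        then have "norm (\<phi> (t (Suc i))) \<le> 1" using b1 t[of i] by auto
        then have "norm (\<phi> (t (Suc i))) * norm (u (t (Suc i)) - u (t i)) \<le> 1 * norm (u (t (Suc i)) - u (t i))"
          by (intro mult_right_mono) auto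
        moreover have "0 \<le> \<rho> * norm (u (t (Suc i)) - u (t i))" using \<rho> by simp
        ultimately show "norm (\<phi> (t (Suc i))) * norm (u (t (Suc i)) - u (t i)) \<le> \<rho> * norm (u (t (Suc i)) - u (t i)) +
          (if norm (\<phi> (t (Suc i))) > \<rho> then norm (u (t (Suc i)) - u (t i)) else 0)"
          using mult_right_mono[of "norm (\<phi> (t (Suc i)))" \<rho> "norm (u (t (Suc i)) - u (t i))"] by auto
      qed
      also have "\<dots> = \<rho> * (\<Sum>i<N. norm (u (t (Suc i)) - u (t i))) + (\<Sum>i\<in>{i\<in>{..<N}. norm (\<phi> (t (Suc i))) > \<rho>}. norm (u (t (Suc i)) - u (t i)))"
        by (simp add: sum.distrib sum_distrib_left sum.If_cases Int_def conj_commute)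
      also have "\<dots> \<le> \<rho> * real K + e / 3"
      proof (rule add_mono)
        show "\<rho> * (\<Sum>i<N. norm (u (t (Suc i)) - u (t i))) \<le> \<rho> * real K"
          using var \<rho> by (intro mult_left_mono) auto
        let ?I = "{i\<in>{..<N}. norm (\<phi> (t (Suc i))) > \<rho>}"
        have "(\<Sum>i\<in>?I. norm (u (t (Suc i)) - u (t i))) < e/3"
          unfolding t_def
        proof (rule d(2))
          have int2: "(\<lambda>x. (norm (\<phi> x))\<^sup>2) integrable_on {0..1}" by (intro integrable_continuous_interval c2)
          have "\<rho>\<^sup>2 * real (card ?I) = (\<Sum>i\<in>?I. \<rho>\<^sup>2)" by simp
          also have "\<dots> \<le> (\<Sum>i\<in>?I. (norm (\<phi> (t (Suc i))))\<^sup>2)"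
            using \<rho> by (intro sum_mono power_mono) auto
          also have "\<dots> \<le> (\<Sum>i<N. (norm (\<phi> (t (Suc i))))\<^sup>2)" by (intro sum_mono2) auto
          also have "\<dots> \<le> (\<Sum>i<N. real N * integral {t i..t (Suc i)} (\<lambda>x. (norm (\<phi> x))\<^sup>2) + \<eta>)"
          proof (rule sum_mono)
            fix i assume "i \<in> {..<N}"
            then have i: "i < N" by simp
            have "integral {t i..t (Suc i)} (\<lambda>x. (norm (\<phi> (t (Suc i))))\<^sup>2 - \<eta>) \<le> integral {t i..t (Suc i)} (\<lambda>x. (norm (\<phi> x))\<^sup>2)"
            proof (rule integral_le)
              show "(\<lambda>x. (norm (\<phi> x))\<^sup>2) integrable_on {t i..t (Suc i)}"
                by (rule integrable_on_subinterval[OF int2 sub[OF i]])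
              fix x assume x: "x \<in> {t i..t (Suc i)}"
              have "dist ((norm (\<phi> (t (Suc i))))\<^sup>2) ((norm (\<phi> x))\<^sup>2) < \<eta>"
                by (rule N2(2)[OF N(2)]) (use x t[OF i] in auto)
              then show "(norm (\<phi> (t (Suc i))))\<^sup>2 - \<eta> \<le> (norm (\<phi> x))\<^sup>2" by (auto simp: dist_real_def)
            qed auto
            then have "(1 / real N) * ((norm (\<phi> (t (Suc i))))\<^sup>2 - \<eta>) \<le> integral {t i..t (Suc i)} (\<lambda>x. (norm (\<phi> x))\<^sup>2)"
              using t[OF i] by simp
            then show "(norm (\<phi> (t (Suc i))))\<^sup>2 \<le> real N * integral {t i..t (Suc i)} (\<lambda>x. (norm (\<phi> x))\<^sup>2) + \<eta>"
              using N(3) by (simp add: field_simps)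
          qed
          also have "\<dots> = real N * integral {0..1} (\<lambda>x. (norm (\<phi> x))\<^sup>2) + real N * \<eta>"
            unfolding integral_uniform_partition[OF int2 N(3)] t_def by (simp add: sum.distrib sum_distrib_left)
          also have "\<dots> < real N * (2 * \<eta>)" using small N(3) by (simp add: algebra_simps)
          also have "\<dots> = \<rho>\<^sup>2 * (d * real N)" by (simp add: \<eta>_def)
          finally have "real (card ?I) < d * real N" using \<rho> by simp
          then show "real (card {i\<in>{..<N}. norm (\<phi> (real (Suc i) / real N)) > \<rho>}) / real N < d"
            using N(3) by (simp add: field_simps t_def)
        qed (use N in auto)
        then show "(\<Sum>i\<in>?I. norm (u (t (Suc i)) - u (t i))) \<le> e/3" by simp
      qed
      also have "\<dots> = 2 * e / 3" using K(1) by (simp add: \<rho>_def)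
      finally show ?thesis .
    qed
    ultimately show "norm (integral {0..1} (\<lambda>x. \<phi>' x * u x)) \<le> e"
      using norm_triangle_ineq[of "integral {0..1} (\<lambda>x. \<phi>' x * u x) - A" A] by simp
  qed
qed

subsection \<open>Fourier coefficients\<close>

definition fourier_exp :: "int \<Rightarrow> real \<Rightarrow> complex" where
  "fourier_exp k x = cis (2 * pi * of_int k * x)"

definition fourier_coeff :: "(real \<Rightarrow> complex) \<Rightarrow> int \<Rightarrow> complex" where
  "fourier_coeff u k = integral {0..1} (\<lambda>x. u x * fourier_exp (- k) x)"

lemma fourier_exp_add: "fourier_exp (j + k) x = fourier_exp j x * fourier_exp k x"
  by (simp add: fourier_exp_def cis_mult algebra_simps)

lemma fourier_exp_0 [simp]: "fourier_exp 0 x = 1"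
  by (simp add: fourier_exp_def)

lemma fourier_exp_at_0 [simp]: "fourier_exp k 0 = 1"
  by (simp add: fourier_exp_def)

lemma cnj_fourier_exp: "cnj (fourier_exp k x) = fourier_exp (- k) x"
  by (simp add: fourier_exp_def cis_cnj)

lemma norm_fourier_exp [simp]: "norm (fourier_exp k x) = 1"
  by (simp add: fourier_exp_def)

lemma fourier_exp_at_1 [simp]: "fourier_exp k 1 = 1"
  by (simp add: fourier_exp_def cis_multiple_2pi)

lemma fourier_exp_periodic: "fourier_exp k (x + 1) = fourier_exp k x"
proof -
  have "fourier_exp k (x + 1) = fourier_exp k x * fourier_exp k 1"
    by (simp add: fourier_exp_def cis_mult algebra_simps)
  then show ?thesis by simp
qed

lemma fourier_exp_has_vector_derivative:
  "(fourier_exp k has_vector_derivative (2 * of_real pi * \<i> * of_int k) * fourier_exp k x) (at x within S)"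
proof -
  let ?c = "2 * of_real pi * \<i> * of_int k"
  have *: "fourier_exp k = (\<lambda>x. exp (?c * of_real x))"
    by (rule ext) (simp add: fourier_exp_def cis_conv_exp mult_ac)
  have "((\<lambda>z. exp (?c * z)) has_field_derivative ?c * exp (?c * of_real x)) (at (of_real x))"
    by (rule derivative_eq_intros refl | simp)+
  then show ?thesis unfolding * by (rule has_vector_derivative_real_field)
qed

lemma continuous_on_fourier_exp [continuous_intros]: "continuous_on S (fourier_exp k)"
  unfolding fourier_exp_def by (intro continuous_intros)

lemma integral_fourier_exp: "integral {0..1} (fourier_exp k) = (if k = 0 then 1 else 0)"
proof (cases "k = 0")
  case False
  have "((\<lambda>x. (2 * of_real pi * \<i> * of_int k) * fourier_exp k x) has_integral fourier_exp k 1 - fourier_exp k 0) {0..1}"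
    by (rule fundamental_theorem_of_calculus[OF _ fourier_exp_has_vector_derivative]) simp
  then have "(2 * of_real pi * \<i> * of_int k) * integral {0..1} (fourier_exp k) = 0"
    by (auto dest!: integral_unique)
  then show ?thesis using False by simp
next
  case True
  have "fourier_exp 0 = (\<lambda>x. 1)" by (rule ext) simp
  then show ?thesis using True by simp
qed

text \<open>Completing the square in orthonormal coordinates. It covers best approximation
  (\<open>c\<close> equal to the Fourier coefficients), the lower bound when those coefficients
  vanish, and Parseval for finite sums (\<open>f = 0\<close>).\<close>

lemma fourier_trig_poly_distance:
  assumes f: "continuous_on {0..1} f" and F: "finite F"
  shows "integral {0..1} (\<lambda>x. (norm (f x - (\<Sum>k\<in>F. c k * fourier_exp k x)))\<^sup>2) =
    integral {0..1} (\<lambda>x. (norm (f x))\<^sup>2) - (\<Sum>k\<in>F. (norm (fourier_coeff f k))\<^sup>2)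
      + (\<Sum>k\<in>F. (norm (fourier_coeff f k - c k))\<^sup>2)"
proof -
  define S where "S = (\<lambda>x. \<Sum>k\<in>F. c k * fourier_exp k x)"
  have cS: "continuous_on {0..1} S" unfolding S_def by (intro continuous_intros)
  note ci = integrable_continuous_interval
  have of_real_int: "integral {0..1} (\<lambda>x. complex_of_real (h x)) = complex_of_real (integral {0..1} h)"
    if "continuous_on {0..1} h" for h :: "real \<Rightarrow> real"
    using that by (intro integral_unique has_integral_of_real integrable_integral) (rule ci)
  have I1: "integral {0..1} (\<lambda>x. f x * cnj (S x)) = (\<Sum>k\<in>F. fourier_coeff f k * cnj (c k))"
  proof -
    have "integral {0..1} (\<lambda>x. f x * cnj (S x)) = integral {0..1} (\<lambda>x. \<Sum>k\<in>F. (f x * fourier_exp (-k) x) * cnj (c k))"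
      by (simp add: S_def cnj_fourier_exp sum_distrib_left mult_ac)
    also have "\<dots> = (\<Sum>k\<in>F. fourier_coeff f k * cnj (c k))"
      unfolding fourier_coeff_def
      by (subst integral_sum) (use F in \<open>auto intro!: ci continuous_intros f\<close>)
    finally show ?thesis .
  qed
  have I2: "integral {0..1} (\<lambda>x. S x * cnj (f x)) = (\<Sum>k\<in>F. c k * cnj (fourier_coeff f k))"
  proof -
    have "integral {0..1} (\<lambda>x. S x * cnj (f x)) = integral {0..1} (\<lambda>x. cnj (f x * cnj (S x)))"
      by (simp add: mult.commute)
    also have "\<dots> = cnj (integral {0..1} (\<lambda>x. f x * cnj (S x)))"
      by (rule integral_cnj[symmetric])
    finally show ?thesis unfolding I1 by (simp add: mult.commute)
  qed
  have I3: "integral {0..1} (\<lambda>x. S x * cnj (S x)) = (\<Sum>k\<in>F. c k * cnj (c k))"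
  proof -
    have "integral {0..1} (\<lambda>x. S x * cnj (S x)) = integral {0..1} (\<lambda>x. \<Sum>k\<in>F. \<Sum>l\<in>F. (c k * cnj (c l)) * fourier_exp (k - l) x)"
      by (simp add: S_def cnj_fourier_exp sum_product mult_ac fourier_exp_add[symmetric])
    also have "\<dots> = (\<Sum>k\<in>F. \<Sum>l\<in>F. (c k * cnj (c l)) * integral {0..1} (fourier_exp (k - l)))"
      by (subst integral_sum, use F in \<open>auto intro!: ci continuous_intros\<close>)+
    also have "\<dots> = (\<Sum>k\<in>F. \<Sum>l\<in>F. if l = k then c k * cnj (c l) else 0)"
      by (intro sum.cong refl) (auto simp: integral_fourier_exp)
    also have "\<dots> = (\<Sum>k\<in>F. c k * cnj (c k))" using F by simp
    finally show ?thesis .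
  qed
  have "complex_of_real (integral {0..1} (\<lambda>x. (norm (f x - S x))\<^sup>2)) =
      integral {0..1} (\<lambda>x. f x * cnj (f x) - f x * cnj (S x) - S x * cnj (f x) + S x * cnj (S x))"
    by (subst of_real_int[symmetric])
       (auto intro!: continuous_intros f cS simp: complex_norm_square algebra_simps simp del: of_real_power)
  also have "\<dots> = integral {0..1} (\<lambda>x. f x * cnj (f x)) - integral {0..1} (\<lambda>x. f x * cnj (S x))
      - integral {0..1} (\<lambda>x. S x * cnj (f x)) + integral {0..1} (\<lambda>x. S x * cnj (S x))"
    by (simp add: Henstock_Kurzweil_Integration.integral_add Henstock_Kurzweil_Integration.integral_diff
         ci continuous_intros f cS)
  also have "integral {0..1} (\<lambda>x. f x * cnj (f x)) = complex_of_real (integral {0..1} (\<lambda>x. (norm (f x))\<^sup>2))"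
    by (subst of_real_int[symmetric])
       (auto intro!: continuous_intros f simp: complex_norm_square simp del: of_real_power)
  also have "complex_of_real (integral {0..1} (\<lambda>x. (norm (f x))\<^sup>2)) - integral {0..1} (\<lambda>x. f x * cnj (S x))
      - integral {0..1} (\<lambda>x. S x * cnj (f x)) + integral {0..1} (\<lambda>x. S x * cnj (S x)) =
     complex_of_real (integral {0..1} (\<lambda>x. (norm (f x))\<^sup>2) - (\<Sum>k\<in>F. (norm (fourier_coeff f k))\<^sup>2)
      + (\<Sum>k\<in>F. (norm (fourier_coeff f k - c k))\<^sup>2))"
    unfolding I1 I2 I3 of_real_diff of_real_add of_real_sum complex_norm_square
    by (simp add: sum.distrib sum_subtractf algebra_simps)
  finally show ?thesis unfolding S_def of_real_eq_iff .
qed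

lemma integral_norm_trig_poly:
  assumes F: "finite F"
  shows "integral {0..1} (\<lambda>x. (norm (\<Sum>k\<in>F. c k * fourier_exp k x))\<^sup>2) = (\<Sum>k\<in>F. (norm (c k))\<^sup>2)"
  using fourier_trig_poly_distance[of "\<lambda>x. 0" F c] F by (simp add: fourier_coeff_def)

section \<open>Density of trigonometric polynomials, uniqueness of coefficients and products\<close>

inductive trig_poly :: "(real \<Rightarrow> complex) \<Rightarrow> bool" where
  monom: "trig_poly (\<lambda>x. c * fourier_exp k x)"
| add: "trig_poly f \<Longrightarrow> trig_poly g \<Longrightarrow> trig_poly (\<lambda>x. f x + g x)"

lemma trig_poly_mult_monom: "trig_poly f \<Longrightarrow> trig_poly (\<lambda>x. f x * (c * fourier_exp k x))"
proof (induction rule: trig_poly.induct)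
  case (monom d j)
  have "(\<lambda>x. d * fourier_exp j x * (c * fourier_exp k x)) = (\<lambda>x. (d * c) * fourier_exp (j + k) x)"
    by (auto simp: fourier_exp_add)
  then show ?case using trig_poly.monom by metis
next
  case (add f g)
  then show ?case by (simp add: distrib_right trig_poly.add)
qed

lemma trig_poly_mult: "trig_poly g \<Longrightarrow> trig_poly f \<Longrightarrow> trig_poly (\<lambda>x. f x * g x)"
  by (induction rule: trig_poly.induct) (simp_all add: trig_poly_mult_monom distrib_left trig_poly.add)

lemma trig_poly_const: "trig_poly (\<lambda>x. c)"
  using trig_poly.monom[of c 0] by simp

lemma trig_poly_real_polynomial:
  fixes r :: "complex \<Rightarrow> real"
  assumes "real_polynomial_function r"
  shows "trig_poly (\<lambda>x. complex_of_real (r (fourier_exp 1 x)))"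
  using assms
proof (induction rule: real_polynomial_function.induct)
  case (linear r)
  \<comment> \<open>A real-linear functional of \<open>z\<close> is a combination of
    \<open>z\<close> and \<open>cnj z\<close>, which on the circle are the frequencies 1 and
    -1.\<close>
  have r: "complex_of_real (r z) = (r 1 - \<i> * r \<i>) / 2 * z + (r 1 + \<i> * r \<i>) / 2 * cnj z" for z
  proof -
    have "r z = r (Re z *\<^sub>R 1 + Im z *\<^sub>R \<i>)" by (rule arg_cong[of _ _ r]) (simp add: complex_eq_iff)
    also have "\<dots> = Re z * r 1 + Im z * r \<i>"
      using linear by (simp add: linear_simps)
    finally show ?thesis by (simp add: complex_eq_iff field_simps)
  qed
  have "(\<lambda>x. complex_of_real (r (fourier_exp 1 x))) =
      (\<lambda>x. (r 1 - \<i> * r \<i>) / 2 * fourier_exp 1 x + (r 1 + \<i> * r \<i>) / 2 * fourier_exp (-1) x)"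
    by (rule ext, subst r, simp add: cnj_fourier_exp)
  then show ?case by (simp only:) (intro trig_poly.intros)
next
  case (const c)
  then show ?case by (rule trig_poly_const)
next
  case (add f g)
  then show ?case by (simp add: trig_poly.add)
next
  case (mult f g)
  then show ?case by (simp add: trig_poly_mult)
qed

lemma trig_poly_eq_sum:
  assumes "trig_poly f"
  obtains F c where "finite F" "\<And>x. f x = (\<Sum>k\<in>F. c k * fourier_exp k x)"
proof -
  have "\<exists>F c. finite F \<and> (\<forall>x. f x = (\<Sum>k\<in>F. c k * fourier_exp k x))"
    using assms
  proof (induction rule: trig_poly.induct)
    case (monom c k)
    then show ?case by (intro exI[of _ "{k}"] exI[of _ "\<lambda>_. c"]) simp
  next
    case (add f g)
    then obtain F c G d where F: "finite F" "\<And>x. f x = (\<Sum>k\<in>F. c k * fourier_exp k x)"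
      and G: "finite G" "\<And>x. g x = (\<Sum>k\<in>G. d k * fourier_exp k x)" by blast
    have 1: "f x = (\<Sum>k\<in>F\<union>G. (if k \<in> F then c k else 0) * fourier_exp k x)" for x
      unfolding F(2) by (rule sum.mono_neutral_cong_left) (use F G in auto)
    have 2: "g x = (\<Sum>k\<in>F\<union>G. (if k \<in> G then d k else 0) * fourier_exp k x)" for x
      unfolding G(2) by (rule sum.mono_neutral_cong_left) (use F G in auto)
    show ?case
      by (intro exI[of _ "F \<union> G"] exI[of _ "\<lambda>k. (if k \<in> F then c k else 0) + (if k \<in> G then d k else 0)"])
         (use F G in \<open>simp add: 1 2 distrib_right sum.distrib\<close>)
  qed
  then show ?thesis using that by blast
qed

lemma trig_poly_dense:
  assumes f: "continuous_on {0..1} f" "f 0 = f 1" and e: "e > 0"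
  obtains F and c :: "int \<Rightarrow> complex" where "finite F"
    "\<And>x. x \<in> {0..1} \<Longrightarrow> norm (f x - (\<Sum>k\<in>F. c k * fourier_exp k x)) < e"
proof -
  \<comment> \<open>A trivial homotopy, used only to obtain continuity of \<open>f\<close>
    transported to the unit circle, where Stone-Weierstrass applies.\<close>
  have "homotopic_loops UNIV f f"
    using f by (simp add: homotopic_loops_refl path_def pathfinish_def pathstart_def)
  then have "homotopic_with_canon (\<lambda>h. True) (sphere 0 1) UNIV
               (f \<circ> (\<lambda>z. Arg2pi z / (2*pi))) (f \<circ> (\<lambda>z. Arg2pi z / (2*pi)))"
    by (rule homotopic_loops_imp_homotopic_circlemaps)
  then have ch: "continuous_on (sphere 0 1) (f \<circ> (\<lambda>z. Arg2pi z / (2*pi)))"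
    using homotopic_with_imp_continuous by blast
  obtain g where g: "polynomial_function g"
    "\<forall>z\<in>sphere 0 1. norm ((f \<circ> (\<lambda>z. Arg2pi z / (2*pi))) z - g z) < e"
    using Stone_Weierstrass_polynomial_function[OF compact_sphere ch e] by blast
  have "real_polynomial_function (Re \<circ> g)" "real_polynomial_function (Im \<circ> g)"
    using g(1) bounded_linear_Re bounded_linear_Im unfolding polynomial_function_def by blast+
  then have "trig_poly (\<lambda>x. complex_of_real ((Re \<circ> g) (fourier_exp 1 x)) + complex_of_real ((Im \<circ> g) (fourier_exp 1 x)) * \<i>)"
    by (intro trig_poly.add trig_poly_mult[OF trig_poly_const] trig_poly_real_polynomial)
  also have "(\<lambda>x. complex_of_real ((Re \<circ> g) (fourier_exp 1 x)) + complex_of_real ((Im \<circ> g) (fourier_exp 1 x)) * \<i>)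
      = (\<lambda>x. g (fourier_exp 1 x))"
    by (auto simp: complex_eq_iff)
  finally obtain F c where F: "finite F" "\<And>x. g (fourier_exp 1 x) = (\<Sum>k\<in>F. c k * fourier_exp k x)"
    using trig_poly_eq_sum by blast
  show ?thesis
  proof (rule that[OF F(1)])
    fix x :: real assume x: "x \<in> {0..1}"
    have "(f \<circ> (\<lambda>z. Arg2pi z / (2*pi))) (fourier_exp 1 x) = f x"
    \<comment> \<open>The point 1 of the circle has argument 0, so at \<open>x = 1\<close> the
      transported function returns \<open>f 0\<close>; here \<open>f 0 = f 1\<close> enters.\<close>
    proof (cases "x = 1")
      case True
      then show ?thesis using f(2) by (simp add: Arg2pi_of_real[of 1, simplified])
    next
      case False
      have "Arg2pi (fourier_exp 1 x) = 2 * pi * x"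
        by (rule Arg2pi_unique[of 1]) (use x False in \<open>auto simp: fourier_exp_def cis_conv_exp\<close>)
      then show ?thesis by simp
    qed
    moreover have "norm ((f \<circ> (\<lambda>z. Arg2pi z / (2*pi))) (fourier_exp 1 x) - g (fourier_exp 1 x)) < e"
      by (rule bspec[OF g(2)]) simp
    ultimately show "norm (f x - (\<Sum>k\<in>F. c k * fourier_exp k x)) < e"
      unfolding F(2)[symmetric] by simp
  qed
qed

lemma trig_poly_dense_L2:
  assumes f: "continuous_on {0..1} f" "f 0 = f 1" and e: "e > 0"
  obtains F and c :: "int \<Rightarrow> complex" where "finite F"
    "integral {0..1} (\<lambda>x. (norm (f x - (\<Sum>k\<in>F. c k * fourier_exp k x)))\<^sup>2) \<le> e\<^sup>2"
proof -
  obtain F and c :: "int \<Rightarrow> complex" where F: "finite F"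
    "\<And>x. x \<in> {0..1} \<Longrightarrow> norm (f x - (\<Sum>k\<in>F. c k * fourier_exp k x)) < e"
    by (rule trig_poly_dense[OF f e]) blast
  have "integral {0..1} (\<lambda>x. (norm (f x - (\<Sum>k\<in>F. c k * fourier_exp k x)))\<^sup>2) \<le> integral {0..1} (\<lambda>x::real. e\<^sup>2)"
  proof (rule integral_le)
    show "(\<lambda>x. (norm (f x - (\<Sum>k\<in>F. c k * fourier_exp k x)))\<^sup>2) integrable_on {0..1}"
      by (intro integrable_continuous_interval continuous_intros f)
    show "(norm (f x - (\<Sum>k\<in>F. c k * fourier_exp k x)))\<^sup>2 \<le> e\<^sup>2" if "x \<in> {0..1}" for x
      using F(2)[OF that] by (intro power_mono) auto
  qed auto
  then show ?thesis using that[OF F(1)] by simp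
qed

text \<open>If all coefficients of the difference \<open>h\<close> vanish, every trigonometric
  polynomial has L2 distance at least that of 0 from \<open>h\<close>; density forces the norm of
  \<open>h\<close> to be 0, and continuity makes this pointwise. It later identifies a Bloch series
  with its own twofold primitive.\<close>

theorem fourier_coeff_unique:
  assumes f: "continuous_on {0..1} f" "f 0 = f 1"
    and g: "continuous_on {0..1} g" "g 0 = g 1"
    and eq: "\<And>k. fourier_coeff f k = fourier_coeff g k" and x: "x \<in> {0..1}"
  shows "f x = g x"
proof -
  define h where "h = (\<lambda>x. f x - g x)"
  have h: "continuous_on {0..1} h" "h 0 = h 1" using f g by (auto simp: h_def intro!: continuous_intros)
  have z: "fourier_coeff h k = 0" for k
  proof -
    have "fourier_coeff h k = fourier_coeff f k - fourier_coeff g k"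
      unfolding fourier_coeff_def h_def left_diff_distrib
      by (rule Henstock_Kurzweil_Integration.integral_diff)
         (intro integrable_continuous_interval continuous_intros f g)+
    then show ?thesis using eq by simp
  qed
  have ch: "continuous_on {0..1} (\<lambda>x. (norm (h x))\<^sup>2)" by (intro continuous_intros h)
  have "integral {0..1} (\<lambda>x. (norm (h x))\<^sup>2) \<le> e" if e: "e > 0" for e
  proof -
    obtain F and c :: "int \<Rightarrow> complex" where F: "finite F"
      "integral {0..1} (\<lambda>x. (norm (h x - (\<Sum>k\<in>F. c k * fourier_exp k x)))\<^sup>2) \<le> (sqrt e)\<^sup>2"
      by (rule trig_poly_dense_L2[OF h, of "sqrt e"]) (use e in \<open>simp, blast\<close>)
    moreover have "integral {0..1} (\<lambda>x. (norm (h x - (\<Sum>k\<in>F. c k * fourier_exp k x)))\<^sup>2)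
        \<ge> integral {0..1} (\<lambda>x. (norm (h x))\<^sup>2)"
      unfolding fourier_trig_poly_distance[OF h(1) F(1)] by (simp add: z sum_nonneg)
    ultimately show ?thesis using e by simp
  qed
  then have "integral {0..1} (\<lambda>x. (norm (h x))\<^sup>2) \<le> 0" by (rule field_le_epsilon[of _ 0, simplified])
  moreover have "integral {0..1} (\<lambda>x. (norm (h x))\<^sup>2) \<ge> 0"
    by (intro integral_nonneg integrable_continuous_interval ch) auto
  ultimately have "integral {0..1} (\<lambda>x. (norm (h x))\<^sup>2) = 0" by simp
  then have "(norm (h x))\<^sup>2 = 0"
    using integral_eq_0_iff[OF ch] x by auto
  then show ?thesis by (simp add: h_def)
qed

text \<open>A finite partial sum is the coefficient of \<open>S * f\<close>, where \<open>S\<close>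
  is the partial Fourier sum of \<open>f\<close>. The error is controlled by the L2 distance of
  \<open>f\<close> and \<open>S\<close>, which is small as soon as the index set contains the
  frequencies of one good approximant.\<close>

theorem fourier_coeff_square:
  assumes f: "continuous_on {0..1} f" "f 0 = f 1"
  shows "((\<lambda>k. fourier_coeff f k * fourier_coeff f (n - k)) has_sum fourier_coeff (\<lambda>x. f x * f x) n) UNIV"
  unfolding has_sum_def
proof (rule tendstoI)
  fix \<epsilon> :: real assume \<epsilon>: "\<epsilon> > 0"
  obtain M where M: "M > 0" "\<And>x. x \<in> {0..1} \<Longrightarrow> norm (f x) \<le> M"
  proof -
    have "bounded (f ` {0..1})"
      using f by (intro compact_imp_bounded compact_continuous_image) auto
    then obtain M where "M > 0" "\<forall>y\<in>f ` {0..1}. norm y \<le> M"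
      unfolding bounded_pos by blast
    then show ?thesis using that[of M] by auto
  qed
  define e where "e = \<epsilon> / (2 * M)"
  have e: "e > 0" using \<epsilon> M by (simp add: e_def)
  obtain F and c :: "int \<Rightarrow> complex" where F: "finite F"
    "integral {0..1} (\<lambda>x. (norm (f x - (\<Sum>k\<in>F. c k * fourier_exp k x)))\<^sup>2) \<le> e\<^sup>2"
    by (rule trig_poly_dense_L2[OF f e]) blast
  have "dist (\<Sum>k\<in>G. fourier_coeff f k * fourier_coeff f (n - k)) (fourier_coeff (\<lambda>x. f x * f x) n) < \<epsilon>"
    if G: "finite G" "F \<subseteq> G" for G
  proof -
    define S where "S = (\<lambda>x. \<Sum>k\<in>G. fourier_coeff f k * fourier_exp k x)"
    have cS: "continuous_on {0..1} S" unfolding S_def by (intro continuous_intros)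
    define d where "d = (\<lambda>k. if k \<in> F then c k else 0)"
    have d: "(\<Sum>k\<in>G. d k * fourier_exp k x) = (\<Sum>k\<in>F. c k * fourier_exp k x)" for x
      by (rule sum.mono_neutral_cong_right) (use G in \<open>auto simp: d_def\<close>)
    have "integral {0..1} (\<lambda>x. (norm (f x - S x))\<^sup>2) \<le> integral {0..1} (\<lambda>x. (norm (f x - (\<Sum>k\<in>G. d k * fourier_exp k x)))\<^sup>2)"
      unfolding S_def fourier_trig_poly_distance[OF f(1) G(1)] by (simp add: sum_nonneg)
    also have "\<dots> \<le> e\<^sup>2" unfolding d by (rule F(2))
    finally have le: "integral {0..1} (\<lambda>x. (norm (f x - S x))\<^sup>2) \<le> e\<^sup>2" .
    have c2: "continuous_on {0..1} (\<lambda>x. (norm (f x - S x))\<^sup>2)" by (intro continuous_intros f cS)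
    have "(\<Sum>k\<in>G. fourier_coeff f k * fourier_coeff f (n - k)) = integral {0..1} (\<lambda>x. S x * f x * fourier_exp (- n) x)"
    proof -
      have "integral {0..1} (\<lambda>x. S x * f x * fourier_exp (- n) x) =
          integral {0..1} (\<lambda>x. \<Sum>k\<in>G. fourier_coeff f k * (f x * fourier_exp (- (n - k)) x))"
        by (simp add: S_def sum_distrib_left sum_distrib_right mult_ac fourier_exp_add[symmetric])
      also have "\<dots> = (\<Sum>k\<in>G. fourier_coeff f k * fourier_coeff f (n - k))"
        unfolding fourier_coeff_def[of f "n - _"]
        by (subst integral_sum) (use G in \<open>auto intro!: integrable_continuous_interval continuous_intros f\<close>)
      finally show ?thesis ..
    qed
    then have "fourier_coeff (\<lambda>x. f x * f x) n - (\<Sum>k\<in>G. fourier_coeff f k * fourier_coeff f (n - k)) =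
       integral {0..1} (\<lambda>x. (f x - S x) * (f x * fourier_exp (- n) x))"
      unfolding fourier_coeff_def left_diff_distrib
      by (subst Henstock_Kurzweil_Integration.integral_diff)
         (auto intro!: integrable_continuous_interval continuous_intros f cS simp: mult_ac)
    also have "norm \<dots> \<le> integral {0..1} (\<lambda>x. (e + (norm (f x - S x))\<^sup>2 / e) / 2 * M)"
    proof (rule Henstock_Kurzweil_Integration.integral_norm_bound_integral)
      show "(\<lambda>x. (f x - S x) * (f x * fourier_exp (- n) x)) integrable_on {0..1}"
        by (intro integrable_continuous_interval continuous_intros f cS)
      show "(\<lambda>x. (e + (norm (f x - S x))\<^sup>2 / e) / 2 * M) integrable_on {0..1}"
        using e by (intro integrable_continuous_interval continuous_intros f cS) auto
      fix x :: real assume x: "x \<in> {0..1}"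
      \<comment> \<open>The pointwise inequality of arithmetic and geometric means replaces
        Cauchy-Schwarz; it turns the L2 bound \<open>e\<^sup>2\<close> into an L1 bound
        \<open>e\<close>, and \<open>e * M\<close> is \<open>\<epsilon> / 2\<close>.\<close>
      have "0 \<le> (e - norm (f x - S x))\<^sup>2 / e" using e by simp
      then have "norm (f x - S x) \<le> (e + (norm (f x - S x))\<^sup>2 / e) / 2"
        using e by (simp add: power2_eq_square field_simps)
      then show "norm ((f x - S x) * (f x * fourier_exp (- n) x)) \<le> (e + (norm (f x - S x))\<^sup>2 / e) / 2 * M"
        unfolding norm_mult norm_fourier_exp mult_1_right
        by (rule mult_mono) (use M x e in auto)
    qed
    also have "\<dots> = (e + integral {0..1} (\<lambda>x. (norm (f x - S x))\<^sup>2) / e) / 2 * M"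
      by (simp add: Henstock_Kurzweil_Integration.integral_add integrable_continuous_interval c2
          continuous_on_divide e[THEN less_imp_neq, symmetric])
    also have "\<dots> \<le> (e + e\<^sup>2 / e) / 2 * M"
      using le e M by (intro mult_right_mono divide_right_mono add_left_mono) auto
    also have "\<dots> < \<epsilon>" using M \<epsilon> by (simp add: e_def power2_eq_square)
    finally show ?thesis by (simp add: dist_norm norm_minus_commute)
  qed
  then show "\<forall>\<^sub>F G in finite_subsets_at_top UNIV.
      dist (\<Sum>k\<in>G. fourier_coeff f k * fourier_coeff f (n - k)) (fourier_coeff (\<lambda>x. f x * f x) n) < \<epsilon>"
    unfolding eventually_finite_subsets_at_top using F(1) by blast
qed

section \<open>Fourier coefficients of derivatives, primitives and absolutely continuous
  functions\<close>

lemma fourier_coeff_derivative: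
  assumes "\<And>x. x \<in> {0..1} \<Longrightarrow> (u has_vector_derivative u' x) (at x within {0..1})"
    and "continuous_on {0..1} u'" "u 0 = u 1"
  shows "fourier_coeff u' k = 2 * of_real pi * \<i> * of_int k * fourier_coeff u k"
proof -
  have "integral {0..1} (\<lambda>x. u x * ((2 * of_real pi * \<i> * of_int (-k)) * fourier_exp (- k) x)) =
     u 1 * fourier_exp (-k) 1 - u 0 * fourier_exp (-k) 0 - integral {0..1} (\<lambda>x. u' x * fourier_exp (-k) x)"
  proof (rule integral_by_parts_primitive)
    show "u' absolutely_integrable_on {0..1}" by (rule absolutely_integrable_continuous_real[OF assms(2)])
    show "u x = u 0 + integral {0..x} u'" if "x \<in> {0..1}" for x
    proof -
      have "(u' has_integral u x - u 0) {0..x}"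
      proof (rule fundamental_theorem_of_calculus)
        show "(u has_vector_derivative u' y) (at y within {0..x})" if "y \<in> {0..x}" for y
          by (rule has_vector_derivative_within_subset[OF assms(1)]) (use that \<open>x \<in> {0..1}\<close> in auto)
      qed (use that in auto)
      then show ?thesis by (simp add: integral_unique)
    qed
    show "(fourier_exp (- k) has_vector_derivative (2 * of_real pi * \<i> * of_int (-k)) * fourier_exp (- k) x) (at x within {0..1})" for x
      by (rule fourier_exp_has_vector_derivative)
  qed (auto intro!: continuous_intros)
  then show ?thesis using assms(3) unfolding fourier_coeff_def
    by (simp add: mult.left_commute[of "u _"])
qed

lemma fourier_coeff_primitive:
  assumes w: "w absolutely_integrable_on {0..1}" "integral {0..1} w = 0"
    and u: "\<And>x. x \<in> {0..1} \<Longrightarrow> u x = c + integral {0..x} w"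
  shows "fourier_coeff w k = 2 * of_real pi * \<i> * of_int k * fourier_coeff u k"
proof -
  have "integral {0..1} (\<lambda>x. u x * ((2 * of_real pi * \<i> * of_int (-k)) * fourier_exp (- k) x)) =
     u 1 * fourier_exp (-k) 1 - u 0 * fourier_exp (-k) 0 - integral {0..1} (\<lambda>x. w x * fourier_exp (-k) x)"
    by (rule integral_by_parts_primitive[OF w(1) _ _ fourier_exp_has_vector_derivative u])
       (auto intro!: continuous_intros)
  then show ?thesis using w(2) u[of 0] u[of 1] unfolding fourier_coeff_def
    by (simp add: mult.left_commute[of "u _"])
qed

text \<open>If infinitely many of the numbers \<open>k * fourier_coeff u k\<close> stayed away from 0, the average of many of
  the corresponding exponentials, with phases aligned, would be bounded by 1 and small in \<open>L\<^sub>2\<close>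
  but not small under \<open>\<phi> \<mapsto> \<integral> \<phi>' u\<close>.\<close>

theorem fourier_coeff_absolutely_continuous_decay:
  assumes ac: "absolutely_continuous_on_interval 0 1 u" and cu: "continuous_on {0..1} u"
    and u01: "u 0 = u 1" and e: "e > 0"
  obtains K where "\<And>k. \<bar>k\<bar> \<ge> K \<Longrightarrow> \<bar>of_int k\<bar> * norm (fourier_coeff u k) \<le> e"
proof -
  obtain \<eta> where \<eta>: "\<eta> > 0" "\<And>\<phi> \<phi>'. \<lbrakk>continuous_on {0..1} \<phi>';
      \<And>x. x \<in> {0..1} \<Longrightarrow> (\<phi> has_vector_derivative \<phi>' x) (at x within {0..1}); \<phi> 0 = \<phi> 1;
      \<And>x. x \<in> {0..1} \<Longrightarrow> norm (\<phi> x) \<le> 1; integral {0..1} (\<lambda>x. (norm (\<phi> x))\<^sup>2) < \<eta>\<rbrakk>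
      \<Longrightarrow> norm (integral {0..1} (\<lambda>x. \<phi>' x * u x)) \<le> e"
    by (rule absolutely_continuous_functional_small[OF ac cu u01 e]) blast
  \<comment> \<open>The value of the functional
    \<open>\<phi> \<mapsto> integral of \<phi>' u\<close> at \<open>fourier_exp k\<close>.\<close>
  define z where "z = (\<lambda>k. (2 * of_real pi * \<i> * of_int k) * fourier_coeff u (-k))"
  define B where "B = {k. norm (z k) > e}"
  have "finite B"
  proof (rule ccontr)
    assume inf: "infinite B"
    obtain J :: nat where J: "inverse (real (Suc J)) < \<eta>" using \<eta>(1) reals_Archimedean by blast
    obtain F where F: "finite F" "card F = Suc J" "F \<subseteq> B" using inf infinite_arbitrarily_large by blast
    \<comment> \<open>Phases that make every \<open>\<theta> k * z k\<close> positive, divided by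
      the number of terms: the sum \<open>\<phi>\<close> is bounded by 1, its mean square is
      \<open>1 / Suc J < \<eta>\<close>, and the functional takes on it the average of the
      \<open>norm (z k)\<close>, which exceeds \<open>e\<close>.\<close>
    define \<theta> where "\<theta> = (\<lambda>k. cnj (z k) / (norm (z k) * real (Suc J)))"
    have zpos: "norm (z k) > 0" if "k \<in> F" for k using that F(3) e by (auto simp: B_def)
    have n\<theta>: "norm (\<theta> k) = inverse (real (Suc J))" if "k \<in> F" for k
      using zpos[OF that] unfolding \<theta>_def by (simp add: norm_divide norm_mult inverse_eq_divide del: of_nat_Suc)
    define \<phi> where "\<phi> = (\<lambda>x. \<Sum>k\<in>F. \<theta> k * fourier_exp k x)"
    define \<phi>' where "\<phi>' = (\<lambda>x. \<Sum>k\<in>F. \<theta> k * ((2 * of_real pi * \<i> * of_int k) * fourier_exp k x))"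
    have "norm (integral {0..1} (\<lambda>x. \<phi>' x * u x)) \<le> e"
    proof (rule \<eta>(2))
      show "continuous_on {0..1} \<phi>'" unfolding \<phi>'_def by (intro continuous_intros)
      show "(\<phi> has_vector_derivative \<phi>' x) (at x within {0..1})" for x
        unfolding \<phi>_def \<phi>'_def
        by (intro has_vector_derivative_sum has_vector_derivative_mult_right fourier_exp_has_vector_derivative)
      show "\<phi> 0 = \<phi> 1" by (simp add: \<phi>_def)
      show "norm (\<phi> x) \<le> 1" for x
      proof -
        have "norm (\<phi> x) \<le> (\<Sum>k\<in>F. inverse (real (Suc J)))"
          unfolding \<phi>_def by (rule sum_norm_le) (simp add: norm_mult n\<theta> del: of_nat_Suc)
        also have "\<dots> = 1" using F(2) by (simp del: of_nat_Suc)
        finally show ?thesis .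
      qed
      have "integral {0..1} (\<lambda>x. (norm (\<phi> x))\<^sup>2) = (\<Sum>k\<in>F. (norm (\<theta> k))\<^sup>2)"
        unfolding \<phi>_def by (rule integral_norm_trig_poly[OF F(1)])
      also have "\<dots> = inverse (real (Suc J))"
        using F(2) by (simp add: n\<theta> power2_eq_square del: of_nat_Suc)
      finally show "integral {0..1} (\<lambda>x. (norm (\<phi> x))\<^sup>2) < \<eta>" using J by simp
    qed
    moreover have "integral {0..1} (\<lambda>x. \<phi>' x * u x) = (\<Sum>k\<in>F. \<theta> k * z k)"
    proof -
      have "integral {0..1} (\<lambda>x. \<phi>' x * u x) =
         integral {0..1} (\<lambda>x. \<Sum>k\<in>F. (\<theta> k * (2 * of_real pi * \<i> * of_int k)) * (u x * fourier_exp (- (- k)) x))"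
        by (simp add: \<phi>'_def sum_distrib_left sum_distrib_right mult_ac)
      also have "\<dots> = (\<Sum>k\<in>F. (\<theta> k * (2 * of_real pi * \<i> * of_int k)) * fourier_coeff u (-k))"
        unfolding fourier_coeff_def
        by (subst integral_sum) (use F in \<open>auto intro!: integrable_continuous_interval continuous_intros cu\<close>)
      finally show ?thesis by (simp add: z_def mult_ac)
    qed
    moreover have "(\<Sum>k\<in>F. \<theta> k * z k) = complex_of_real (\<Sum>k\<in>F. norm (z k) * inverse (real (Suc J)))"
      unfolding of_real_sum
    proof (rule sum.cong[OF refl])
      fix k assume "k \<in> F"
      then have "norm (z k) > 0" by (rule zpos)
      moreover have "cnj (z k) * z k = complex_of_real (norm (z k)) * complex_of_real (norm (z k))"
        by (metis complex_norm_square mult.commute of_real_mult power2_eq_square)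
      ultimately show "\<theta> k * z k = complex_of_real (norm (z k) * inverse (real (Suc J)))"
        by (simp add: \<theta>_def inverse_eq_divide del: of_nat_Suc)
    qed
    ultimately have "(\<Sum>k\<in>F. norm (z k) * inverse (real (Suc J))) \<le> e"
      by (simp add: sum_nonneg del: of_nat_Suc of_real_sum)
    moreover have "(\<Sum>k\<in>F. e * inverse (real (Suc J))) < (\<Sum>k\<in>F. norm (z k) * inverse (real (Suc J)))"
    proof (rule sum_strict_mono)
      show "F \<noteq> {}" using F(2) by auto
      show "e * inverse (real (Suc J)) < norm (z k) * inverse (real (Suc J))" if "k \<in> F" for k
        using that F(3) by (intro mult_strict_right_mono) (auto simp: B_def)
    qed (use F in auto)
    moreover have "(\<Sum>k\<in>F. e * inverse (real (Suc J))) = e" using F(2) by (simp del: of_nat_Suc)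
    ultimately show False by linarith
  qed
  then obtain K0 where K0: "\<And>k. k \<in> B \<Longrightarrow> \<bar>k\<bar> \<le> K0"
    by (metis finite_imageI finite_nat_set_iff_bounded_le bdd_above.unfold bdd_above_finite imageI)
  show ?thesis
  proof (rule that[of "K0 + 1"])
    fix k :: int assume "\<bar>k\<bar> \<ge> K0 + 1"
    then have "- k \<notin> B" using K0[of "-k"] by auto
    then have "norm (z (-k)) \<le> e" by (simp add: B_def)
    then have "2 * pi * (\<bar>of_int k\<bar> * norm (fourier_coeff u k)) \<le> e" by (simp add: z_def norm_mult)
    moreover have "1 * (\<bar>of_int k\<bar> * norm (fourier_coeff u k)) \<le> 2 * pi * (\<bar>of_int k\<bar> * norm (fourier_coeff u k))"
      using pi_gt3 by (intro mult_right_mono) auto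
    ultimately show "\<bar>of_int k\<bar> * norm (fourier_coeff u k) \<le> e" by simp
  qed
qed

subsection \<open>Dressed kernels\<close>

lemma
  fixes h H :: "'a \<Rightarrow> real"
  assumes H: "H summable_on A" and le: "\<And>j. j \<in> A \<Longrightarrow> \<bar>h j\<bar> \<le> C * H j"
  shows summable_on_dominated: "h summable_on A"
    and abs_infsum_dominated: "\<bar>infsum h A\<bar> \<le> C * infsum H A"
proof -
  have CH: "(\<lambda>j. C * H j) summable_on A" by (rule summable_on_cmult_right[OF H])
  have "(\<lambda>j. norm (h j)) summable_on A"
    by (rule Infinite_Sum.abs_summable_on_comparison_test'[OF CH]) (use le in auto)
  then show s: "h summable_on A" by (rule Infinite_Sum.abs_summable_summable)
  have "norm (infsum h A) \<le> infsum (\<lambda>j. C * H j) A"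
    by (rule norm_infsum_le[OF has_sum_infsum[OF s] has_sum_infsum[OF CH]]) (use le in auto)
  then show "\<bar>infsum h A\<bar> \<le> C * infsum H A" by (simp add: infsum_cmult_right')
qed

lemma infsum_diff_real:
  fixes f g :: "'a \<Rightarrow> real"
  assumes "f summable_on A" "g summable_on A"
  shows "infsum (\<lambda>x. f x - g x) A = infsum f A - infsum g A"
  using infsum_add[OF assms(1), of "\<lambda>x. - g x"] assms(2)
  by (simp add: infsum_uminus summable_on_uminus)

text \<open>Kernel of \<open>P (G P)^i\<close> from mode \<open>\<sigma>\<close> to mode
  \<open>m\<close>; the recursion peels off the leftmost \<open>P G\<close>.\<close>

primrec dressed_term :: "(int \<Rightarrow> real) \<Rightarrow> (int \<Rightarrow> real) \<Rightarrow> nat \<Rightarrow> int \<Rightarrow> int \<Rightarrow> real" where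
  "dressed_term p G 0 m \<sigma> = p (m - \<sigma>)"
| "dressed_term p G (Suc i) m \<sigma> = (\<Sum>\<^sub>\<infinity>j. p (m - j) * G j * dressed_term p G i j \<sigma>)"

text \<open>In operator notation, with \<open>P\<close> the convolution by \<open>p\<close>, this is the kernel of
  \<open>P + P G P + P G P G P + \<dots>\<close>.\<close>

definition dressed :: "(int \<Rightarrow> real) \<Rightarrow> (int \<Rightarrow> real) \<Rightarrow> int \<Rightarrow> int \<Rightarrow> real" where
  "dressed p G m \<sigma> = (\<Sum>i. dressed_term p G i m \<sigma>)"

text \<open>Submultiplicativity of \<open>w\<close> lets the decay of \<open>p\<close> pass to every
  product of convolutions, since \<open>m - \<sigma>\<close> is the sum of the steps in between.
  \<open>H\<close> dominates all Green functions in use at once, so that the estimates are uniform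
  in energy and quasi-momentum.\<close>

locale weighted_kernel =
  fixes p H w :: "int \<Rightarrow> real" and M :: real
  assumes w_ge_1: "w k \<ge> 1" and w_submult: "w (j + k) \<le> w j * w k"
    and p_bound: "\<bar>p k\<bar> * w k \<le> M"
    and H_summable: "H summable_on UNIV"
    and small: "M * infsum H UNIV \<le> 1/2"
begin

abbreviation "S \<equiv> infsum H UNIV"

lemma w_pos: "w k > 0" using w_ge_1[of k] by simp

lemma M_nonneg: "M \<ge> 0"
  using p_bound[of 0] w_pos[of 0] by (meson abs_ge_zero mult_nonneg_nonneg less_imp_le order_trans)

lemma weight_split:
  assumes "\<bar>a\<bar> * w (m - j) \<le> A" "\<bar>b\<bar> * w (j - \<sigma>) \<le> B"
  shows "\<bar>a\<bar> * \<bar>b\<bar> * w (m - \<sigma>) \<le> A * B"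
proof -
  have "w (m - \<sigma>) \<le> w (m - j) * w (j - \<sigma>)" using w_submult[of "m - j" "j - \<sigma>"] by simp
  then have "\<bar>a\<bar> * \<bar>b\<bar> * w (m - \<sigma>) \<le> \<bar>a\<bar> * \<bar>b\<bar> * (w (m - j) * w (j - \<sigma>))"
    by (intro mult_left_mono) auto
  also have "\<dots> = (\<bar>a\<bar> * w (m - j)) * (\<bar>b\<bar> * w (j - \<sigma>))" by simp
  also have "\<dots> \<le> A * B"
  proof (rule mult_mono[OF assms])
    show "0 \<le> \<bar>b\<bar> * w (j - \<sigma>)" using w_pos[of "j - \<sigma>"] by simp
    have "0 \<le> \<bar>a\<bar> * w (m - j)" using w_pos[of "m - j"] by simp
    then show "0 \<le> A" using assms(1) by linarith
  qed
  finally show ?thesis .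
qed

lemma convolution_dominated:
  assumes G: "\<And>j. \<bar>G j\<bar> \<le> H j" and b: "\<And>j. \<bar>b j\<bar> * w (j - \<sigma>) \<le> B"
  shows "\<bar>p (m - j) * G j * b j\<bar> \<le> (M * B / w (m - \<sigma>)) * H j"
proof -
  have "\<bar>p (m - j)\<bar> * \<bar>b j\<bar> * w (m - \<sigma>) \<le> M * B" by (rule weight_split[OF p_bound b])
  then have "\<bar>p (m - j)\<bar> * \<bar>b j\<bar> \<le> M * B / w (m - \<sigma>)" using w_pos by (simp add: pos_le_divide_eq)
  then have "\<bar>p (m - j)\<bar> * \<bar>b j\<bar> * \<bar>G j\<bar> \<le> M * B / w (m - \<sigma>) * H j"
    using G[of j] by (intro mult_mono) (auto intro: order_trans[OF abs_ge_zero] mult_nonneg_nonneg order_trans[rotated])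
  then show ?thesis by (simp add: abs_mult mult_ac)
qed

text \<open>One passage through \<open>p\<close> and \<open>G\<close> costs the factor
  \<open>M * S\<close> and keeps the weight measured from \<open>\<sigma>\<close>.\<close>

lemma
  assumes G: "\<And>j. \<bar>G j\<bar> \<le> H j" and b: "\<And>j. \<bar>b j\<bar> * w (j - \<sigma>) \<le> B"
  shows convolution_summable: "(\<lambda>j. p (m - j) * G j * b j) summable_on UNIV"
    and convolution_bound: "\<bar>\<Sum>\<^sub>\<infinity>j. p (m - j) * G j * b j\<bar> * w (m - \<sigma>) \<le> M * S * B"
proof -
  show "(\<lambda>j. p (m - j) * G j * b j) summable_on UNIV"
    by (rule summable_on_dominated[OF H_summable convolution_dominated[OF G b]])
  have "\<bar>\<Sum>\<^sub>\<infinity>j. p (m - j) * G j * b j\<bar> \<le> (M * B / w (m - \<sigma>)) * S"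
    by (rule abs_infsum_dominated[OF H_summable convolution_dominated[OF G b]])
  then show "\<bar>\<Sum>\<^sub>\<infinity>j. p (m - j) * G j * b j\<bar> * w (m - \<sigma>) \<le> M * S * B"
    using w_pos[of "m - \<sigma>"] by (simp add: field_simps)
qed

lemma S_nonneg: assumes "\<And>j. \<bar>G j\<bar> \<le> H j" shows "S \<ge> 0"
  by (rule infsum_nonneg) (meson abs_ge_zero assms order_trans)

context
  fixes G :: "int \<Rightarrow> real"
  assumes G: "\<And>j. \<bar>G j\<bar> \<le> H j"
begin

lemma dressed_term_bound: "\<bar>dressed_term p G i m \<sigma>\<bar> * w (m - \<sigma>) \<le> M * (M * S) ^ i"
proof (induction i arbitrary: m)
  case 0
  then show ?case using p_bound by simp
next
  case (Suc i)
  show ?case using convolution_bound[OF G Suc.IH] by (simp add: mult_ac)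
qed

lemma MS: "0 \<le> M * S" "M * S \<le> 1/2"
  using M_nonneg S_nonneg[OF G] small by auto

lemma dressed_term_geometric: "\<bar>dressed_term p G i m \<sigma>\<bar> * w (m - \<sigma>) \<le> M * (1/2) ^ i"
  using dressed_term_bound[of i m \<sigma>] mult_left_mono[OF power_mono[OF MS(2,1)] M_nonneg, of i] by linarith

lemma dressed_term_abs: "\<bar>dressed_term p G i m \<sigma>\<bar> \<le> M * (1/2) ^ i"
proof -
  have "\<bar>dressed_term p G i m \<sigma>\<bar> * 1 \<le> \<bar>dressed_term p G i m \<sigma>\<bar> * w (m - \<sigma>)"
    using w_ge_1 by (intro mult_left_mono) auto
  then show ?thesis using dressed_term_geometric[of i m \<sigma>] by linarith
qed

lemma geometric_summable: "summable (\<lambda>i. M * (1/2::real) ^ i)"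
  by (intro summable_mult summable_geometric) auto

lemma dressed_summable: "summable (\<lambda>i. dressed_term p G i m \<sigma>)"
  by (rule summable_comparison_test[OF _ geometric_summable]) (use dressed_term_abs in auto)

text \<open>Only \<open>n\<close> factors \<open>M * S\<close> are kept; the remaining ones are
  replaced by powers of 1/2, whose sum gives the 2. The instance \<open>n = 0\<close> bounds the
  whole kernel, and \<open>n = 2\<close> isolates what lies beyond the second order in
  \<open>p\<close>.\<close>

lemma dressed_tail_bound:
  "\<bar>dressed p G m \<sigma> - (\<Sum>i<n. dressed_term p G i m \<sigma>)\<bar> * w (m - \<sigma>) \<le> 2 * M * (M * S) ^ n"
proof -
  have sm: "summable (\<lambda>i. M * (M * S) ^ n * (1/2::real) ^ i)"
    by (intro summable_mult summable_geometric) auto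
  have le: "\<bar>dressed_term p G (i + n) m \<sigma> * w (m - \<sigma>)\<bar> \<le> M * (M * S) ^ n * (1/2) ^ i" for i
  proof -
    have "\<bar>dressed_term p G (i + n) m \<sigma>\<bar> * w (m - \<sigma>) \<le> M * (M * S) ^ (i + n)" by (rule dressed_term_bound)
    also have "\<dots> = M * (M * S) ^ n * (M * S) ^ i" by (simp add: power_add)
    also have "\<dots> \<le> M * (M * S) ^ n * (1/2) ^ i"
      using MS M_nonneg by (intro mult_left_mono power_mono) auto
    finally show ?thesis using w_pos[of "m - \<sigma>"] by (simp add: abs_mult)
  qed
  have sd: "summable (\<lambda>i. dressed_term p G (i + n) m \<sigma> * w (m - \<sigma>))"
    by (rule summable_comparison_test[OF _ sm]) (use le in auto)
  have "dressed p G m \<sigma> - (\<Sum>i<n. dressed_term p G i m \<sigma>) = (\<Sum>i. dressed_term p G (i + n) m \<sigma>)"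
    unfolding dressed_def by (subst suminf_split_initial_segment[OF dressed_summable, of m \<sigma> n]) simp
  then have "(dressed p G m \<sigma> - (\<Sum>i<n. dressed_term p G i m \<sigma>)) * w (m - \<sigma>) = (\<Sum>i. dressed_term p G (i + n) m \<sigma> * w (m - \<sigma>))"
    using suminf_mult2[OF summable_ignore_initial_segment[OF dressed_summable[of m \<sigma>], of n], of "w (m - \<sigma>)"] by simp
  moreover have "\<bar>\<Sum>i. dressed_term p G (i + n) m \<sigma> * w (m - \<sigma>)\<bar> \<le> (\<Sum>i. M * (M * S) ^ n * (1/2::real) ^ i)"
    using norm_suminf_le[OF _ sm, of "\<lambda>i. dressed_term p G (i + n) m \<sigma> * w (m - \<sigma>)"] le by simp
  moreover have "(\<Sum>i. M * (M * S) ^ n * (1/2::real) ^ i) = 2 * M * (M * S) ^ n"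
    by (subst suminf_mult) (auto simp: suminf_geometric summable_geometric)
  ultimately show ?thesis using w_pos[of "m - \<sigma>"] by (simp add: abs_mult flip: abs_of_pos)
qed

lemma dressed_bound: "\<bar>dressed p G m \<sigma>\<bar> * w (m - \<sigma>) \<le> 2 * M"
  using dressed_tail_bound[of m \<sigma> 0] by simp

lemma dressed_abs: "\<bar>dressed p G m \<sigma>\<bar> \<le> 2 * M"
proof -
  have "\<bar>dressed p G m \<sigma>\<bar> * 1 \<le> \<bar>dressed p G m \<sigma>\<bar> * w (m - \<sigma>)"
    using w_ge_1 by (intro mult_left_mono) auto
  then show ?thesis using dressed_bound[of m \<sigma>] by linarith
qed

text \<open>The resolvent identity \<open>R = P + P G R\<close>. Applying \<open>P G\<close> to a
  partial sum of the series shifts it by one index, and the weighted tail bound justifies passing to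
  the limit inside the infinite sum.\<close>

lemma dressed_fixpoint:
  "dressed p G m \<sigma> = p (m - \<sigma>) + (\<Sum>\<^sub>\<infinity>j. p (m - j) * G j * dressed p G j \<sigma>)"
proof -
  define T where "T = (\<lambda>n j. \<Sum>i<n. dressed_term p G i j \<sigma>)"
  have bT: "\<bar>dressed p G j \<sigma> - T n j\<bar> * w (j - \<sigma>) \<le> 2 * M * (1/2) ^ n" for n j
  proof -
    have "2 * M * (M * S) ^ n \<le> 2 * M * (1/2) ^ n"
      using MS M_nonneg by (intro mult_left_mono power_mono) auto
    then show ?thesis using dressed_tail_bound[of j \<sigma> n] unfolding T_def by linarith
  qed
  have sumT: "(\<lambda>j. p (m - j) * G j * T n j) summable_on UNIV \<and>
      (\<Sum>\<^sub>\<infinity>j. p (m - j) * G j * T n j) = (\<Sum>i<n. dressed_term p G (Suc i) m \<sigma>)" for n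
  proof (induction n)
    case (Suc n)
    have 1: "(\<lambda>j. p (m - j) * G j * dressed_term p G n j \<sigma>) summable_on UNIV"
      by (rule convolution_summable[OF G dressed_term_bound])
    have 2: "(\<lambda>j. p (m - j) * G j * T (Suc n) j) = (\<lambda>j. p (m - j) * G j * T n j + p (m - j) * G j * dressed_term p G n j \<sigma>)"
      by (simp add: T_def algebra_simps)
    show ?case unfolding 2 using Suc 1 by (simp add: infsum_add summable_on_add)
  qed (simp add: T_def)
  have sd: "(\<lambda>j. p (m - j) * G j * dressed p G j \<sigma>) summable_on UNIV"
    by (rule convolution_summable[OF G dressed_bound])
  have "(\<lambda>n. (\<Sum>i<n. dressed_term p G (Suc i) m \<sigma>)) \<longlonglongrightarrow> (\<Sum>\<^sub>\<infinity>j. p (m - j) * G j * dressed p G j \<sigma>)"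
  proof (rule Lim_null[THEN iffD2], rule Lim_null_comparison)
    show "\<forall>\<^sub>F n in sequentially. norm ((\<Sum>i<n. dressed_term p G (Suc i) m \<sigma>) - (\<Sum>\<^sub>\<infinity>j. p (m - j) * G j * dressed p G j \<sigma>))
        \<le> M * S * (2 * M) / w (m - \<sigma>) * (1/2) ^ n"
    proof (intro always_eventually allI)
      fix n
      have "(\<Sum>\<^sub>\<infinity>j. p (m - j) * G j * dressed p G j \<sigma>) - (\<Sum>i<n. dressed_term p G (Suc i) m \<sigma>) =
          (\<Sum>\<^sub>\<infinity>j. p (m - j) * G j * (dressed p G j \<sigma> - T n j))"
        unfolding right_diff_distrib using sumT[of n] sd
        by (simp add: infsum_diff_real)
      then have "\<bar>(\<Sum>\<^sub>\<infinity>j. p (m - j) * G j * dressed p G j \<sigma>) - (\<Sum>i<n. dressed_term p G (Suc i) m \<sigma>)\<bar> * w (m - \<sigma>)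
          \<le> M * S * (2 * M * (1/2) ^ n)"
        using convolution_bound[OF G bT, of m n] by simp
      then show "norm ((\<Sum>i<n. dressed_term p G (Suc i) m \<sigma>) - (\<Sum>\<^sub>\<infinity>j. p (m - j) * G j * dressed p G j \<sigma>))
        \<le> M * S * (2 * M) / w (m - \<sigma>) * (1/2) ^ n"
        using w_pos[of "m - \<sigma>"] by (simp add: field_simps abs_minus_commute)
    qed
    show "(\<lambda>n. M * S * (2 * M) / w (m - \<sigma>) * (1/2) ^ n) \<longlonglongrightarrow> 0"
      by (intro tendsto_mult_right_zero LIMSEQ_power_zero) auto
  qed
  moreover have "(\<lambda>n. (\<Sum>i<n. dressed_term p G (Suc i) m \<sigma>)) \<longlonglongrightarrow> (\<Sum>i. dressed_term p G (Suc i) m \<sigma>)"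
    using dressed_summable[of m \<sigma>] by (intro summable_LIMSEQ) (subst summable_Suc_iff)
  ultimately have "(\<Sum>i. dressed_term p G (Suc i) m \<sigma>) = (\<Sum>\<^sub>\<infinity>j. p (m - j) * G j * dressed p G j \<sigma>)"
    using LIMSEQ_unique by blast
  then show ?thesis
    unfolding dressed_def[of p G m \<sigma>] using suminf_split_head[OF dressed_summable, of m \<sigma>] by simp
qed

text \<open>Associativity: the rightmost factor can be peeled off instead of the leftmost. The
  exchange of the two infinite sums rests on domination by a multiple of
  \<open>H j * H l\<close>.\<close>

lemma dressed_term_Suc_right:
  "dressed_term p G (Suc i) m \<sigma> = (\<Sum>\<^sub>\<infinity>l. dressed_term p G i m l * G l * p (l - \<sigma>))"
proof (induction i arbitrary: m)
  case (Suc i)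
  have H0: "0 \<le> H j" for j using G[of j] by linarith
  have M1: "\<bar>dressed_term p G i j l\<bar> \<le> M" for j l
    using dressed_term_abs[of i j l] mult_left_mono[OF power_le_one[of "1/2::real" i] M_nonneg] by simp
  have pM: "\<bar>p k\<bar> \<le> M" for k
    using p_bound[of k] w_ge_1[of k] mult_left_mono[of 1 "w k" "\<bar>p k\<bar>"] by simp
  have le: "norm (p (m - j) * G j * (dressed_term p G i j l * G l * p (l - \<sigma>))) \<le> M * M * M * (H j * H l)" for j l
  proof -
    have "\<bar>p (m - j)\<bar> * \<bar>G j\<bar> * (\<bar>dressed_term p G i j l\<bar> * \<bar>G l\<bar> * \<bar>p (l - \<sigma>)\<bar>) \<le> M * H j * (M * H l * M)"
      by (intro mult_mono M1 pM G mult_nonneg_nonneg M_nonneg H0 abs_ge_zero)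
    then show ?thesis by (simp add: abs_mult mult_ac)
  qed
  have "(\<lambda>(j, l). H j * H l) summable_on UNIV \<times> UNIV"
  proof -
    have "(\<lambda>x. norm (case x of (j, l) \<Rightarrow> H j * H l)) summable_on UNIV \<times> UNIV"
      unfolding Infinite_Sum.abs_summable_on_Sigma_iff
      using H_summable H0 by (auto simp: abs_mult infsum_cmult_right' intro!: summable_on_cmult_right summable_on_cmult_left)
    then show ?thesis by (rule Infinite_Sum.abs_summable_summable)
  qed
  then have "(\<lambda>(j, l). M * M * M * (H j * H l)) summable_on UNIV \<times> UNIV"
    using summable_on_cmult_right[of "\<lambda>(j, l). H j * H l" "UNIV \<times> UNIV" "M * M * M"] by (simp add: case_prod_unfold)
  then have "(\<lambda>x. norm ((\<lambda>(j, l). p (m - j) * G j * (dressed_term p G i j l * G l * p (l - \<sigma>))) x)) summable_on UNIV \<times> UNIV"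
    by (rule Infinite_Sum.abs_summable_on_comparison_test') (use le in auto)
  then have sw: "(\<lambda>(j, l). p (m - j) * G j * (dressed_term p G i j l * G l * p (l - \<sigma>))) summable_on UNIV \<times> UNIV"
    by (rule Infinite_Sum.abs_summable_summable)
  have "dressed_term p G (Suc (Suc i)) m \<sigma> = (\<Sum>\<^sub>\<infinity>j. p (m - j) * G j * dressed_term p G (Suc i) j \<sigma>)" by simp
  also have "\<dots> = (\<Sum>\<^sub>\<infinity>j. \<Sum>\<^sub>\<infinity>l. p (m - j) * G j * (dressed_term p G i j l * G l * p (l - \<sigma>)))"
    unfolding Suc.IH by (simp only: infsum_cmult_right')
  also have "\<dots> = (\<Sum>\<^sub>\<infinity>l. \<Sum>\<^sub>\<infinity>j. p (m - j) * G j * (dressed_term p G i j l * G l * p (l - \<sigma>)))"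
    by (rule infsum_swap_banach[OF sw])
  also have "\<dots> = (\<Sum>\<^sub>\<infinity>l. (\<Sum>\<^sub>\<infinity>j. p (m - j) * G j * dressed_term p G i j l) * (G l * p (l - \<sigma>)))"
    by (simp only: infsum_cmult_left'[symmetric] mult.assoc)
  also have "\<dots> = (\<Sum>\<^sub>\<infinity>l. dressed_term p G (Suc i) m l * G l * p (l - \<sigma>))"
    by (simp add: mult.assoc)
  finally show ?case .
qed simp

text \<open>Substituting \<open>n - j\<close> for the summation index transposes each convolution,
  because \<open>p\<close> depends on differences only. \<open>G\<close> is invariant, so the
  product reappears in reversed order, which the right-hand recursion recognises.\<close>

lemma dressed_term_reflect:
  assumes sym: "\<And>j. G (n - j) = G j"
  shows "dressed_term p G i (n - m) (n - \<sigma>) = dressed_term p G i \<sigma> m"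
proof (induction i arbitrary: m)
  case (Suc i)
  have "dressed_term p G (Suc i) (n - m) (n - \<sigma>) = (\<Sum>\<^sub>\<infinity>j. p (n - m - j) * G j * dressed_term p G i j (n - \<sigma>))" by simp
  also have "\<dots> = (\<Sum>\<^sub>\<infinity>j. p (n - m - (n - j)) * G (n - j) * dressed_term p G i (n - j) (n - \<sigma>))"
    by (rule infsum_reindex_bij_betw[symmetric, of "\<lambda>j. n - j"], rule bij_betwI[of _ _ _ "\<lambda>j. n - j"]) auto
  also have "\<dots> = (\<Sum>\<^sub>\<infinity>j. dressed_term p G i \<sigma> j * G j * p (j - m))"
    unfolding Suc.IH sym by (simp add: mult_ac)
  also have "\<dots> = dressed_term p G (Suc i) \<sigma> m" by (rule dressed_term_Suc_right[symmetric])
  finally show ?case .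
qed simp

lemma dressed_reflect:
  assumes sym: "\<And>j. G (n - j) = G j"
  shows "dressed p G (n - m) (n - \<sigma>) = dressed p G \<sigma> m"
  unfolding dressed_def dressed_term_reflect[OF sym] ..

end

text \<open>Two Weierstrass tests, one for the sum over modes in each term and one for the Neumann
  series; both majorants come from \<open>H\<close> and are free of \<open>t\<close>.\<close>

lemma continuous_on_dressed:
  fixes G :: "real \<Rightarrow> int \<Rightarrow> real"
  assumes G: "\<And>t j. t \<in> T \<Longrightarrow> \<bar>G t j\<bar> \<le> H j" and cont: "\<And>j. continuous_on T (\<lambda>t. G t j)"
  shows "continuous_on T (\<lambda>t. dressed p (G t) m \<sigma>)"
proof -
  have ct: "continuous_on T (\<lambda>t. dressed_term p (G t) i m \<sigma>)" for i
  proof (induction i arbitrary: m)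
    case (Suc i)
    have "uniform_limit T (\<lambda>X t. \<Sum>j\<in>X. p (m - j) * G t j * dressed_term p (G t) i j \<sigma>)
        (\<lambda>t. \<Sum>\<^sub>\<infinity>j. p (m - j) * G t j * dressed_term p (G t) i j \<sigma>) (finite_subsets_at_top UNIV)"
    proof (rule Weierstrass_m_test_general)
      show "(\<lambda>j. (M * (M * (M * S) ^ i) / w (m - \<sigma>)) * H j) summable_on UNIV"
        by (rule summable_on_cmult_right[OF H_summable])
      show "norm (p (m - j) * G t j * dressed_term p (G t) i j \<sigma>) \<le> (M * (M * (M * S) ^ i) / w (m - \<sigma>)) * H j"
        if "t \<in> T" for j t
        using convolution_dominated[OF G dressed_term_bound[OF G], OF that that] by simp
    qed
    then show ?case unfolding dressed_term.simps
      by (rule uniform_limit_theorem[rotated]) (auto intro!: always_eventually continuous_intros cont Suc.IH)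
  qed simp
  have "uniform_limit T (\<lambda>n t. \<Sum>i<n. dressed_term p (G t) i m \<sigma>) (\<lambda>t. \<Sum>i. dressed_term p (G t) i m \<sigma>) sequentially"
  proof (rule Weierstrass_m_test)
    show "norm (dressed_term p (G t) i m \<sigma>) \<le> M * (1/2) ^ i" if "t \<in> T" for i t
      using dressed_term_abs[OF G, OF that] by simp
    show "summable (\<lambda>i. M * (1/2::real) ^ i)" by (intro summable_mult summable_geometric) auto
  qed
  then show ?thesis unfolding dressed_def
    by (rule uniform_limit_theorem[rotated]) (auto intro!: always_eventually continuous_intros ct)
qed

end

subsection \<open>The resonance equation\<close>

lemma has_sum_single: "((\<lambda>j. if j = k then c j else 0) has_sum c k) UNIV"
  by (rule has_sum_finite_neutralI[of "{k}"]) auto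

text \<open>The exponent is a compromise. It must be below -1 for summability, while its complement
  to -2, here -3/4, is the power of \<open>n\<close> gained and must be below -1/2 so that
  \<open>n\<close> times its square tends to 0. At \<open>j = 0\<close> the value is 0, as
  \<open>0 powr x = 0\<close>.\<close>

definition decay_weight :: "int \<Rightarrow> real" where
  "decay_weight j = \<bar>of_int j\<bar> powr (-5/4)"

lemma decay_weight_nonneg [simp]: "decay_weight j \<ge> 0"
  by (simp add: decay_weight_def)

lemma decay_weight_summable: "decay_weight summable_on UNIV"
proof (rule nonneg_bdd_above_summable_on)
  have s: "summable (\<lambda>k. real k powr (-5/4))" by (simp add: summable_real_powr_iff)
  show "bdd_above (sum decay_weight ` {F. F \<subseteq> UNIV \<and> finite F})"
  proof (rule bdd_aboveI2)
    fix F :: "int set" assume "F \<in> {F. F \<subseteq> UNIV \<and> finite F}"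
    then have F: "finite F" by simp
    have le: "(\<Sum>j\<in>A. decay_weight j) \<le> (\<Sum>k. real k powr (-5/4))"
      if A: "finite A" "inj_on (\<lambda>j. nat \<bar>j\<bar>) A" for A
    proof -
      have "(\<Sum>j\<in>A. decay_weight j) = (\<Sum>k\<in>(\<lambda>j. nat \<bar>j\<bar>) ` A. real k powr (-5/4))"
        by (subst sum.reindex[OF A(2)]) (simp add: decay_weight_def)
      also have "\<dots> \<le> (\<Sum>k. real k powr (-5/4))"
        by (rule sum_le_suminf[OF s]) (use A in auto)
      finally show ?thesis .
    qed
    have "sum decay_weight F = sum decay_weight (F \<inter> {0..}) + sum decay_weight (F \<inter> {..<0})"
      by (subst sum.union_disjoint[symmetric]) (use F in \<open>auto intro!: sum.cong\<close>)
    also have "\<dots> \<le> (\<Sum>k. real k powr (-5/4)) + (\<Sum>k. real k powr (-5/4))"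
      by (intro add_mono le) (use F in \<open>auto simp: inj_on_def\<close>)
    also have "\<dots> = 2 * (\<Sum>k. real k powr (-5/4))" by simp
    finally show "sum decay_weight F \<le> 2 * (\<Sum>k. real k powr (-5/4))" .
  qed
qed simp

definition decay_total :: real where "decay_total = infsum decay_weight UNIV"

lemma decay_total_nonneg: "decay_total \<ge> 0"
  unfolding decay_total_def by (rule infsum_nonneg) simp

lemma
  shows decay_weight_pair_summable: "(\<lambda>j. decay_weight j + decay_weight (k - j)) summable_on UNIV"
    and infsum_decay_weight_pair: "infsum (\<lambda>j. decay_weight j + decay_weight (k - j)) UNIV = 2 * decay_total"
proof -
  have b: "bij_betw (\<lambda>j. k - j) (UNIV :: int set) UNIV"
    by (rule bij_betwI[of _ _ _ "\<lambda>j. k - j"]) auto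
  have s: "(\<lambda>j. decay_weight (k - j)) summable_on UNIV"
    using decay_weight_summable by (subst summable_on_reindex_bij_betw[OF b])
  show "(\<lambda>j. decay_weight j + decay_weight (k - j)) summable_on UNIV"
    by (rule summable_on_add[OF decay_weight_summable s])
  have "infsum (\<lambda>j. decay_weight (k - j)) UNIV = decay_total"
    unfolding decay_total_def by (rule infsum_reindex_bij_betw[OF b])
  then show "infsum (\<lambda>j. decay_weight j + decay_weight (k - j)) UNIV = 2 * decay_total"
    by (simp add: infsum_add[OF decay_weight_summable s] decay_total_def)
qed

text \<open>Majorant of the Green function off resonance, free of energy and quasi-momentum.\<close>

definition green_bound :: "nat \<Rightarrow> int \<Rightarrow> real" where
  "green_bound n j = (if j = 0 \<or> j = int n then 0 else 1 / (\<bar>of_int j\<bar> * \<bar>of_int (int n - j)\<bar>))"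

lemma green_bound_nonneg: "green_bound n j \<ge> 0"
  by (simp add: green_bound_def)

text \<open>Of the larger factor \<open>b\<close>, the power -3/4 is spent on \<open>N\<close> and
  the power -1/4 on \<open>a\<close>, which improves \<open>1 / a\<close> to something
  summable.\<close>

lemma inverse_product_le:
  fixes a b N :: real
  assumes "1 \<le> a" "a \<le> b" "N > 0" "N \<le> b"
  shows "1 / (a * b) \<le> N powr (-3/4) * a powr (-5/4)"
proof -
  have "1 / (a * b) = a powr (-1) * b powr (-1)"
    using assms by (simp add: powr_minus_divide)
  also have "b powr (-1) = b powr (-3/4) * b powr (-1/4)"
    by (simp flip: powr_add)
  also have "a powr (-1) * (b powr (-3/4) * b powr (-1/4)) \<le> a powr (-1) * (N powr (-3/4) * a powr (-1/4))"
    using assms by (intro mult_left_mono mult_mono powr_mono2') auto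
  also have "\<dots> = N powr (-3/4) * (a powr (-1) * a powr (-1/4))" by (simp add: mult_ac)
  also have "a powr (-1) * a powr (-1/4) = a powr (-5/4)" by (subst powr_add[symmetric]) simp
  finally show ?thesis .
qed

lemma abs_int_sum_ge: "real n \<le> \<bar>real_of_int j\<bar> + \<bar>real_of_int (int n - j)\<bar>"
  by linarith

text \<open>The larger of the distances from \<open>j\<close> to the two resonant modes is at least
  \<open>n / 2\<close>; the smaller one supplies the summable weight, hence one weight for each
  mode.\<close>

lemma green_bound_le:
  assumes n: "n > 0"
  shows "green_bound n j \<le> (real n / 2) powr (-3/4) * (decay_weight j + decay_weight (int n - j))"
proof (cases "j = 0 \<or> j = int n")
  case True
  then show ?thesis by (simp add: green_bound_def)
next
  case False
  define a b where "a = \<bar>real_of_int j\<bar>" and "b = \<bar>real_of_int (int n - j)\<bar>"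
  have ab: "1 \<le> a" "1 \<le> b" "real n \<le> a + b"
    using False abs_int_sum_ge[of n j] unfolding a_def b_def by linarith+
  have "1 / (a * b) \<le> (real n / 2) powr (-3/4) * (a powr (-5/4) + b powr (-5/4))"
  proof (cases "a \<le> b")
    case True
    then have "1 / (a * b) \<le> (real n / 2) powr (-3/4) * a powr (-5/4)"
      using ab n by (intro inverse_product_le) auto
    then show ?thesis by (simp add: distrib_left add_increasing2)
  next
    case False
    then have "1 / (b * a) \<le> (real n / 2) powr (-3/4) * b powr (-5/4)"
      using ab n by (intro inverse_product_le) auto
    then show ?thesis by (simp add: distrib_left add_increasing mult.commute)
  qed
  then show ?thesis using False by (simp add: green_bound_def decay_weight_def a_def b_def)
qed

lemma
  assumes n: "n > 0"
  shows green_bound_summable: "green_bound n summable_on UNIV"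
    and infsum_green_bound_le: "infsum (green_bound n) UNIV \<le> 2 * decay_total * (real n / 2) powr (-3/4)"
proof -
  have le: "\<bar>green_bound n j\<bar> \<le> (real n / 2) powr (-3/4) * (decay_weight j + decay_weight (int n - j))" for j
    using green_bound_le[OF n, of j] green_bound_nonneg[of n j] by simp
  show "green_bound n summable_on UNIV"
    by (rule summable_on_dominated[OF decay_weight_pair_summable[of "int n"] le])
  have "\<bar>infsum (green_bound n) UNIV\<bar> \<le> (real n / 2) powr (-3/4) * (2 * decay_total)"
    using abs_infsum_dominated[OF decay_weight_pair_summable[of "int n"] le] infsum_decay_weight_pair by simp
  then show "infsum (green_bound n) UNIV \<le> 2 * decay_total * (real n / 2) powr (-3/4)"
    by (simp add: mult_ac)
qed

lemma green_bound_le_infsum: "n > 0 \<Longrightarrow> green_bound n j \<le> infsum (green_bound n) UNIV"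
  using infsum_mono2[of "green_bound n" "{j}" UNIV] green_bound_summable[of n] green_bound_nonneg
  by auto

lemma infsum_green_bound_nonneg: "infsum (green_bound n) UNIV \<ge> 0"
  by (rule infsum_nonneg) (rule green_bound_nonneg)

text \<open>Two Green factors are thus worth o(1/n). This makes the Neumann series beyond second
  order, and the effect of a bounded energy shift on second order, negligible.\<close>

lemma green_bound_square_tendsto: "(\<lambda>n. real n * (infsum (green_bound n) UNIV)\<^sup>2) \<longlonglongrightarrow> 0"
proof (rule Lim_null_comparison)
  show "\<forall>\<^sub>F n in sequentially. norm (real n * (infsum (green_bound n) UNIV)\<^sup>2)
      \<le> 8 * decay_total\<^sup>2 * (real n / 2) powr (-1/2)"
  proof (intro eventually_sequentiallyI[of 1])
    fix n :: nat assume "n \<ge> 1"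
    then have n: "n > 0" by simp
    have "(infsum (green_bound n) UNIV)\<^sup>2 \<le> (2 * decay_total * (real n / 2) powr (-3/4))\<^sup>2"
      by (intro power_mono infsum_green_bound_le n infsum_green_bound_nonneg)
    also have "\<dots> = 4 * decay_total\<^sup>2 * (real n / 2) powr (-3/2)"
      by (simp add: power_mult_distrib power2_eq_square flip: powr_add)
    finally have "real n * (infsum (green_bound n) UNIV)\<^sup>2 \<le> real n * (4 * decay_total\<^sup>2 * (real n / 2) powr (-3/2))"
      by (intro mult_left_mono) auto
    also have "\<dots> = 8 * decay_total\<^sup>2 * ((real n / 2) powr 1 * (real n / 2) powr (-3/2))"
      using n by simp
    also have "(real n / 2) powr 1 * (real n / 2) powr (-3/2) = (real n / 2) powr (-1/2)"
      by (subst powr_add[symmetric]) simp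
    finally show "norm (real n * (infsum (green_bound n) UNIV)\<^sup>2) \<le> 8 * decay_total\<^sup>2 * (real n / 2) powr (-1/2)"
      by simp
  qed
  have "filterlim (\<lambda>n. (1/2) * real n) at_top sequentially"
    by (intro filterlim_tendsto_pos_mult_at_top[OF tendsto_const] filterlim_real_sequentially) auto
  then have "(\<lambda>n. (real n / 2) powr (-1/2)) \<longlonglongrightarrow> 0"
    by (intro tendsto_neg_powr) auto
  then show "(\<lambda>n. 8 * decay_total\<^sup>2 * (real n / 2) powr (-1/2)) \<longlonglongrightarrow> 0"
    by (rule tendsto_mult_right_zero)
qed

lemma green_bound_tendsto: "(\<lambda>n. infsum (green_bound n) UNIV) \<longlonglongrightarrow> 0"
proof -
  have "(\<lambda>n. (infsum (green_bound n) UNIV)\<^sup>2) \<longlonglongrightarrow> 0"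
  proof (rule Lim_null_comparison[OF _ green_bound_square_tendsto])
    show "\<forall>\<^sub>F n in sequentially. norm ((infsum (green_bound n) UNIV)\<^sup>2) \<le> real n * (infsum (green_bound n) UNIV)\<^sup>2"
    proof (intro eventually_sequentiallyI[of 1])
      fix n :: nat assume "1 \<le> n"
      then show "norm ((infsum (green_bound n) UNIV)\<^sup>2) \<le> real n * (infsum (green_bound n) UNIV)\<^sup>2"
        using mult_right_mono[of 1 "real n" "(infsum (green_bound n) UNIV)\<^sup>2"] by simp
    qed
  qed
  then show ?thesis by simp
qed

text \<open>Diagonal inverse of the free operator on Bloch waves of quasi-momentum
  \<open>pi * n + t\<close>, set to 0 at the two resonant modes; this projects them out of the
  Neumann series.\<close>

definition green :: "nat \<Rightarrow> real \<Rightarrow> real \<Rightarrow> int \<Rightarrow> real" where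
  "green n E t j = (if j = 0 \<or> j = int n then 0 else 1 / (E - (pi * real n + t - 2 * pi * of_int j)\<^sup>2))"

text \<open>The difference of squares factors into \<open>(\<tau> - t) + 2 * pi * j\<close> and
  \<open>(\<tau> + t) + 2 * pi * (n - j)\<close>. In each factor the offset is too small to cancel
  the multiple of \<open>2 * pi\<close>.\<close>

lemma nonresonant_lower_bound:
  assumes \<tau>: "\<bar>\<tau>\<bar> \<le> pi / 2" and t: "0 \<le> t" "t \<le> 3"
    and j: "j \<noteq> 0" "j \<noteq> int n"
  shows "\<bar>of_int j\<bar> * \<bar>of_int (int n - j)\<bar> \<le> \<bar>(pi * real n + \<tau>)\<^sup>2 - (pi * real n + t - 2 * pi * of_int j)\<^sup>2\<bar>"
proof -
  have aux: "\<bar>real_of_int k\<bar> \<le> \<bar>\<theta> + 2 * pi * of_int k\<bar>" if "k \<noteq> 0" "\<bar>\<theta>\<bar> \<le> pi / 2 + 3" for k \<theta>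
  proof -
    have k: "1 \<le> \<bar>real_of_int k\<bar>" using that(1) by linarith
    \<comment> \<open>The largest possible offset \<open>pi / 2 + 3\<close> fits into
      \<open>2 * pi - 1\<close>, so one unit per step of \<open>k\<close> survives.\<close>
    have "pi / 2 + 3 \<le> (2 * pi - 1) * 1" using pi_gt3 by simp
    also have "\<dots> \<le> (2 * pi - 1) * \<bar>real_of_int k\<bar>" using k pi_gt3 by (intro mult_left_mono) auto
    finally have "\<bar>real_of_int k\<bar> \<le> 2 * pi * \<bar>real_of_int k\<bar> - \<bar>\<theta>\<bar>" using that(2) by (simp add: algebra_simps)
    also have "2 * pi * \<bar>real_of_int k\<bar> = \<bar>2 * pi * real_of_int k\<bar>" by (simp add: abs_mult)
    finally show ?thesis by linarith
  qed
  have "(pi * real n + \<tau>)\<^sup>2 - (pi * real n + t - 2 * pi * of_int j)\<^sup>2 =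
      ((\<tau> - t) + 2 * pi * of_int j) * ((\<tau> + t) + 2 * pi * of_int (int n - j))"
    by (simp add: power2_eq_square algebra_simps)
  moreover have "\<bar>of_int j\<bar> * \<bar>of_int (int n - j)\<bar> \<le> \<bar>(\<tau> - t) + 2 * pi * of_int j\<bar> * \<bar>(\<tau> + t) + 2 * pi * of_int (int n - j)\<bar>"
    by (intro mult_mono aux) (use assms in auto)
  ultimately show ?thesis by (simp add: abs_mult)
qed

lemma green_le:
  assumes "\<bar>\<tau>\<bar> \<le> pi / 2" "0 \<le> t" "t \<le> 3" and E: "E = (pi * real n + \<tau>)\<^sup>2"
  shows "\<bar>green n E t j\<bar> \<le> green_bound n j"
proof (cases "j = 0 \<or> j = int n")
  case False
  then have "0 < \<bar>real_of_int j\<bar> * \<bar>real_of_int (int n - j)\<bar>" by simp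
  then show ?thesis using False nonresonant_lower_bound[OF assms(1-3), of j n]
    by (simp add: green_def green_bound_def E abs_divide frac_le)
qed (simp add: green_def green_bound_def)

text \<open>The summand 1 makes the weight at least 1 and submultiplicative.\<close>

definition sobolev_weight :: "nat \<Rightarrow> int \<Rightarrow> real" where
  "sobolev_weight s k = (1 + \<bar>of_int k\<bar>) ^ s"

text \<open>The part of second order in \<open>p\<close> of the coupling between the two resonant modes \<open>0\<close> and \<open>n\<close>,
  evaluated at \<open>E = (\<pi> n)\<^sup>2\<close> and \<open>t = 0\<close>.\<close>

definition second_order :: "(int \<Rightarrow> real) \<Rightarrow> nat \<Rightarrow> real" where
  "second_order p n = (\<Sum>\<^sub>\<infinity>j. p (- j) * p (j - int n) *
     (if j = 0 \<or> j = int n then 0 else 1 / (4 * pi\<^sup>2 * of_int j * of_int (int n - j))))"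

lemma four_pi_sq: "1 \<le> 4 * pi\<^sup>2"
proof -
  have "1\<^sup>2 \<le> pi\<^sup>2" using pi_gt3 by (intro power_mono) auto
  then show ?thesis by simp
qed

lemma free_green_le:
  "\<bar>if j = 0 \<or> j = int n then 0 else 1 / (4 * pi\<^sup>2 * of_int j * of_int (int n - j))\<bar> \<le> green_bound n j"
proof (cases "j = 0 \<or> j = int n")
  case False
  then have "0 < \<bar>real_of_int j\<bar> * \<bar>real_of_int (int n - j)\<bar>" by simp
  moreover have "1 * (\<bar>real_of_int j\<bar> * \<bar>real_of_int (int n - j)\<bar>) \<le> 4 * pi\<^sup>2 * (\<bar>real_of_int j\<bar> * \<bar>real_of_int (int n - j)\<bar>)"
    by (intro mult_right_mono four_pi_sq) auto
  ultimately show ?thesis using False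
    by (simp add: green_bound_def abs_divide abs_mult frac_le mult.assoc)
qed (simp add: green_bound_def)

section \<open>Estimates for the coupling of the two resonant modes\<close>

locale potential_coeffs =
  fixes p :: "int \<Rightarrow> real" and s :: nat and M :: real
  assumes M_pos: "M > 0" and p_weight: "\<bar>p k\<bar> * sobolev_weight s k \<le> M"
begin

lemma kernel:
  assumes "n > 0" "M * infsum (green_bound n) UNIV \<le> 1/2"
  shows "weighted_kernel p (green_bound n) (sobolev_weight s) M"
proof
  show "1 \<le> sobolev_weight s k" for k by (simp add: sobolev_weight_def)
  show "sobolev_weight s (j + k) \<le> sobolev_weight s j * sobolev_weight s k" for j k
  proof -
    have "1 + \<bar>real_of_int (j + k)\<bar> \<le> 1 + \<bar>real_of_int j\<bar> + \<bar>real_of_int k\<bar>" by simp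
    also have "\<dots> \<le> (1 + \<bar>real_of_int j\<bar>) * (1 + \<bar>real_of_int k\<bar>)" by (simp add: algebra_simps)
    finally show ?thesis unfolding sobolev_weight_def power_mult_distrib[symmetric]
      by (intro power_mono) auto
  qed
qed (use assms p_weight green_bound_summable in auto)

text \<open>Reflecting \<open>p\<close> exchanges the couplings 0 to \<open>n\<close> and
  \<open>n\<close> to 0, so one estimate serves both.\<close>

lemma potential_coeffs_reflect: "potential_coeffs (\<lambda>k. p (- k)) s M"
proof
  show "\<bar>p (- k)\<bar> * sobolev_weight s k \<le> M" for k
    using p_weight[of "- k"] by (simp add: sobolev_weight_def)
qed (rule M_pos)

text \<open>Moves the energy to \<open>(pi * n)\<^sup>2\<close>. With denominators \<open>d\<close>
  and \<open>x\<close> one has \<open>1 / d - 1 / x = (x - d) / (d * x)\<close> and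
  \<open>d - x = E - (pi * n)\<^sup>2\<close>, so the shift costs \<open>K\<close> and a second
  Green factor, which is estimated by the total sum.\<close>

lemma coupling_first_order:
  assumes n: "n > 0" and \<tau>: "\<bar>\<tau>\<bar> \<le> pi / 2" and E: "E = (pi * real n + \<tau>)\<^sup>2"
    and K: "\<bar>E - (pi * real n)\<^sup>2\<bar> \<le> K"
  shows "\<bar>(\<Sum>\<^sub>\<infinity>j. p (- j) * green n E 0 j * p (j - int n)) - second_order p n\<bar> * sobolev_weight s (int n)
     \<le> K * M\<^sup>2 * (infsum (green_bound n) UNIV)\<^sup>2"
proof -
  let ?S = "infsum (green_bound n) UNIV" and ?w = "sobolev_weight s (int n)"
  define G0 :: "int \<Rightarrow> real" where "G0 = (\<lambda>j. if j = 0 \<or> j = int n then 0 else 1 / (4 * pi\<^sup>2 * of_int j * of_int (int n - j)))"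
  have wpos: "?w > 0" by (simp add: sobolev_weight_def)
  have K0: "K \<ge> 0" using K by linarith
  have pp: "\<bar>p (- j)\<bar> * \<bar>p (j - int n)\<bar> \<le> M\<^sup>2 / ?w" for j
  proof -
    have "?w \<le> sobolev_weight s (- j) * sobolev_weight s (j - int n)"
    proof -
      have "1 + \<bar>real_of_int (int n)\<bar> \<le> 1 + \<bar>real_of_int (-j)\<bar> + \<bar>real_of_int (j - int n)\<bar>" by simp
      also have "\<dots> \<le> (1 + \<bar>real_of_int (-j)\<bar>) * (1 + \<bar>real_of_int (j - int n)\<bar>)" by (simp add: algebra_simps)
      finally show ?thesis unfolding sobolev_weight_def power_mult_distrib[symmetric]
        by (intro power_mono) auto
    qed
    then have "\<bar>p (- j)\<bar> * \<bar>p (j - int n)\<bar> * ?w \<le> \<bar>p (- j)\<bar> * \<bar>p (j - int n)\<bar> * (sobolev_weight s (- j) * sobolev_weight s (j - int n))"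
      by (intro mult_left_mono) auto
    also have "\<dots> = (\<bar>p (- j)\<bar> * sobolev_weight s (- j)) * (\<bar>p (j - int n)\<bar> * sobolev_weight s (j - int n))" by simp
    also have "\<dots> \<le> M * M"
      using M_pos by (intro mult_mono p_weight) (auto simp: sobolev_weight_def)
    finally show ?thesis using wpos by (simp add: pos_le_divide_eq power2_eq_square)
  qed
  have diff: "\<bar>green n E 0 j - G0 j\<bar> \<le> K * ?S * green_bound n j" for j
  proof (cases "j = 0 \<or> j = int n")
    case False
    define x where "x = 4 * pi\<^sup>2 * of_int j * of_int (int n - j)"
    define d where "d = E - (pi * real n + 0 - 2 * pi * of_int j)\<^sup>2"
    have dx: "d - x = E - (pi * real n)\<^sup>2"
      unfolding d_def x_def by (simp add: power2_eq_square algebra_simps)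
    have pos: "0 < \<bar>real_of_int j\<bar> * \<bar>real_of_int (int n - j)\<bar>" using False by simp
    have "\<bar>real_of_int j\<bar> * \<bar>real_of_int (int n - j)\<bar> \<le> \<bar>d\<bar>"
      unfolding d_def E by (rule nonresonant_lower_bound[OF \<tau>]) (use False in auto)
    with pos have "0 < \<bar>d\<bar>" by linarith
    then have "d \<noteq> 0" by simp
    moreover have "x \<noteq> 0" using False unfolding x_def by simp
    ultimately have "1 / d - 1 / x = (x - d) * (1 / d) * (1 / x)" by (simp add: field_simps)
    then have "\<bar>1 / d - 1 / x\<bar> = \<bar>d - x\<bar> * \<bar>1 / d\<bar> * \<bar>1 / x\<bar>"
      by (simp only: abs_mult abs_minus_commute)
    moreover have "green n E 0 j = 1 / d" "G0 j = 1 / x"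
      using False by (simp_all add: green_def G0_def d_def x_def)
    ultimately have "\<bar>green n E 0 j - G0 j\<bar> = \<bar>E - (pi * real n)\<^sup>2\<bar> * \<bar>green n E 0 j\<bar> * \<bar>G0 j\<bar>"
      unfolding dx by simp
    also have "\<dots> \<le> K * ?S * green_bound n j"
      using green_le[OF \<tau> _ _ E, of 0 j] green_bound_le_infsum[OF n, of j] free_green_le[of j n] K K0
        infsum_green_bound_nonneg
      unfolding G0_def by (intro mult_mono) auto
    finally show ?thesis .
  next
    case True
    then show ?thesis using K0 infsum_green_bound_nonneg[of n] green_bound_nonneg[of n j] by (simp add: green_def G0_def)
  qed
  have s: "(\<lambda>j. p (- j) * G j * p (j - int n)) summable_on UNIV" if "\<And>j. \<bar>G j\<bar> \<le> green_bound n j" for G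
  proof (rule summable_on_dominated[OF green_bound_summable[OF n]])
    show "\<bar>p (- j) * G j * p (j - int n)\<bar> \<le> M\<^sup>2 / ?w * green_bound n j" for j
      using mult_mono[OF pp that, of j j] wpos by (simp add: abs_mult mult_ac)
  qed
  have e0: "second_order p n = (\<Sum>\<^sub>\<infinity>j. p (- j) * G0 j * p (j - int n))"
    unfolding second_order_def G0_def by (simp add: mult_ac)
  have "(\<Sum>\<^sub>\<infinity>j. p (- j) * green n E 0 j * p (j - int n)) - second_order p n =
      (\<Sum>\<^sub>\<infinity>j. p (- j) * (green n E 0 j - G0 j) * p (j - int n))"
  proof -
    have "(\<lambda>j. p (- j) * green n E 0 j * p (j - int n)) summable_on UNIV"
      by (rule s) (rule green_le[OF \<tau> _ _ E], auto)
    moreover have "(\<lambda>j. p (- j) * G0 j * p (j - int n)) summable_on UNIV"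
      by (rule s) (unfold G0_def, rule free_green_le)
    ultimately show ?thesis unfolding e0 right_diff_distrib left_diff_distrib by (rule infsum_diff_real[symmetric])
  qed
  also have "\<bar>\<dots>\<bar> \<le> (M\<^sup>2 / ?w * (K * ?S)) * ?S"
  proof (rule abs_infsum_dominated[OF green_bound_summable[OF n]])
    show "\<bar>p (- j) * (green n E 0 j - G0 j) * p (j - int n)\<bar> \<le> M\<^sup>2 / ?w * (K * ?S) * green_bound n j" for j
      using mult_mono[OF pp diff, of j j] wpos by (simp add: abs_mult mult_ac)
  qed
  finally show ?thesis using wpos by (simp add: field_simps power2_eq_square)
qed

text \<open>Of the power \<open>n ^ (s + 1)\<close>, the part \<open>n ^ s\<close> is absorbed by
  the weight and one \<open>n\<close> joins the square of the Green sum. In the constant,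
  \<open>K * M\<^sup>2\<close> comes from the energy shift and \<open>2 * M ^ 3\<close> from the
  Neumann tail.\<close>

lemma coupling_close:
  assumes n: "n > 0" and sm: "M * infsum (green_bound n) UNIV \<le> 1/2"
    and \<tau>: "\<bar>\<tau>\<bar> \<le> pi / 2" and E: "E = (pi * real n + \<tau>)\<^sup>2"
    and K: "\<bar>E - (pi * real n)\<^sup>2\<bar> \<le> K"
  shows "\<bar>dressed p (green n E 0) 0 (int n) - p (- int n)\<bar> * real n ^ (s + 1)
     \<le> real n ^ (s + 1) * \<bar>second_order p n\<bar> + (K * M\<^sup>2 + 2 * M ^ 3) * (real n * (infsum (green_bound n) UNIV)\<^sup>2)" (is ?A)
    and "\<bar>dressed p (green n E 0) (int n) 0 - p (int n)\<bar> * real n ^ (s + 1)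
     \<le> real n ^ (s + 1) * \<bar>second_order (\<lambda>k. p (- k)) n\<bar> + (K * M\<^sup>2 + 2 * M ^ 3) * (real n * (infsum (green_bound n) UNIV)\<^sup>2)" (is ?B)
proof -
  interpret wk: weighted_kernel p "green_bound n" "sobolev_weight s" M by (rule kernel[OF n sm])
  let ?S = "infsum (green_bound n) UNIV" and ?w = "sobolev_weight s (int n)" and ?G = "green n E 0"
  have G: "\<bar>?G j\<bar> \<le> green_bound n j" for j using green_le[OF \<tau> _ _ E, of 0] by simp
  have wn: "real n ^ s \<le> ?w" unfolding sobolev_weight_def by (intro power_mono) auto
  have main: "\<bar>R - a\<bar> * real n ^ (s + 1) \<le> real n ^ (s + 1) * \<bar>e\<bar> + (K * M\<^sup>2 + 2 * M ^ 3) * (real n * ?S\<^sup>2)"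
    if 1: "\<bar>R - (a + b)\<bar> * ?w \<le> 2 * M * (M * ?S)\<^sup>2" and 2: "\<bar>b - e\<bar> * ?w \<le> K * M\<^sup>2 * ?S\<^sup>2" for R a b e
  proof -
    have "(\<bar>R - (a + b)\<bar> + \<bar>b - e\<bar>) * real n ^ s \<le> (\<bar>R - (a + b)\<bar> + \<bar>b - e\<bar>) * ?w"
      by (intro mult_left_mono wn) auto
    also have "\<dots> \<le> (K * M\<^sup>2 + 2 * M ^ 3) * ?S\<^sup>2"
      using 1 2 by (simp add: algebra_simps power2_eq_square power3_eq_cube)
    finally have "real n * ((\<bar>R - (a + b)\<bar> + \<bar>b - e\<bar>) * real n ^ s) \<le> real n * ((K * M\<^sup>2 + 2 * M ^ 3) * ?S\<^sup>2)"
      by (intro mult_left_mono) auto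
    moreover have "\<bar>R - a\<bar> * real n ^ (s + 1) \<le> (\<bar>e\<bar> + (\<bar>R - (a + b)\<bar> + \<bar>b - e\<bar>)) * real n ^ (s + 1)"
      by (intro mult_right_mono) auto
    ultimately show ?thesis by (simp add: algebra_simps)
  qed
  have two: "(\<Sum>i<2. dressed_term p ?G i m \<sigma>) = p (m - \<sigma>) + (\<Sum>\<^sub>\<infinity>j. p (m - j) * ?G j * p (j - \<sigma>))" for m \<sigma>
    by (simp add: eval_nat_numeral)
  have wm: "sobolev_weight s (- int n) = ?w" by (simp add: sobolev_weight_def)
  show ?A
  proof (rule main)
    show "\<bar>dressed p ?G 0 (int n) - (p (- int n) + (\<Sum>\<^sub>\<infinity>j. p (- j) * ?G j * p (j - int n)))\<bar> * ?w \<le> 2 * M * (M * ?S)\<^sup>2"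
      using wk.dressed_tail_bound[OF G, of 0 "int n" 2] two[of 0 "int n"] wm by simp
    show "\<bar>(\<Sum>\<^sub>\<infinity>j. p (- j) * ?G j * p (j - int n)) - second_order p n\<bar> * ?w \<le> K * M\<^sup>2 * ?S\<^sup>2"
      by (rule coupling_first_order[OF n \<tau> E K])
  qed
  interpret r: potential_coeffs "\<lambda>k. p (- k)" s M by (rule potential_coeffs_reflect)
  show ?B
  proof (rule main)
    show "\<bar>dressed p ?G (int n) 0 - (p (int n) + (\<Sum>\<^sub>\<infinity>j. p (- (- j)) * ?G j * p (- (j - int n))))\<bar> * ?w \<le> 2 * M * (M * ?S)\<^sup>2"
      using wk.dressed_tail_bound[OF G, of "int n" 0 2] two[of "int n" 0] by (simp add: mult_ac)
    show "\<bar>(\<Sum>\<^sub>\<infinity>j. p (- (- j)) * ?G j * p (- (j - int n))) - second_order (\<lambda>k. p (- k)) n\<bar> * ?w \<le> K * M\<^sup>2 * ?S\<^sup>2"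
      by (rule r.coupling_first_order[OF n \<tau> E K])
  qed
qed


text \<open>One of \<open>j\<close> and \<open>n - j\<close> is at least \<open>n / 2\<close> in
  modulus. There the coefficient is o(n^(-s)) and the denominator gives \<open>1 / n\<close>. The
  other coefficient is at most \<open>M / b\<close> because \<open>s \<ge> 1\<close>; with its
  denominator this is \<open>M / b\<^sup>2\<close>, hence summable. For \<open>s = 0\<close> only
  \<open>1 / b\<close> would remain.\<close>

lemma second_order_smooth_tendsto:
  assumes s: "s \<ge> 1"
    and decay: "\<And>e. e > 0 \<Longrightarrow> \<exists>K. \<forall>k. \<bar>k\<bar> \<ge> K \<longrightarrow> \<bar>p k\<bar> * \<bar>of_int k\<bar> ^ s \<le> e"
  shows "(\<lambda>n. real n ^ (s + 1) * second_order p n) \<longlonglongrightarrow> 0"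
proof (rule LIMSEQ_I)
  fix r :: real assume r: "r > 0"
  \<comment> \<open>Collects all factors other than \<open>e\<close>: \<open>2 ^ (s + 1)\<close>
    stems from \<open>n / 2\<close> in the denominator, \<open>2 * decay_total\<close> from one
    summable weight around each resonant mode.\<close>
  define C where "C = M * 2 ^ (s + 1) * (2 * decay_total)"
  have C: "C \<ge> 0" using M_pos decay_total_nonneg by (simp add: C_def)
  define e where "e = r / (2 * (C + 1))"
  have e: "e > 0" using r C by (simp add: e_def)
  obtain K where K: "\<And>k. \<bar>k\<bar> \<ge> K \<Longrightarrow> \<bar>p k\<bar> * \<bar>of_int k\<bar> ^ s \<le> e" using decay[OF e] by blast
  have "norm (real n ^ (s + 1) * second_order p n - 0) < r" if n: "n \<ge> nat (2 * \<bar>K\<bar>) + 1" for n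
  proof -
    have npos: "n > 0" using n by simp
    have aux: "x * y * (1 / (a * b)) \<le> e * M * (2 ^ (s + 1) / real n ^ (s + 1)) * b powr (-5/4)"
      if a: "real n / 2 \<le> a" and b: "1 \<le> b" and x: "0 \<le> x" "x * a ^ s \<le> e" and y: "0 \<le> y" "y * (1 + b) ^ s \<le> M"
      for x y a b :: real
    proof -
      have apos: "a > 0" using a npos by (meson half_gt_zero less_le_trans of_nat_0_less_iff)
      have "x / a = x * a ^ s * (1 / a ^ (s + 1))" using apos by simp
      also have "\<dots> \<le> e * (1 / (real n / 2) ^ (s + 1))"
        using a x apos npos e by (intro mult_mono divide_left_mono power_mono) auto
      finally have 1: "x / a \<le> e * (2 ^ (s + 1) / real n ^ (s + 1))" by (simp add: power_divide)
      have "b \<le> (1 + b) ^ 1" by simp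
      also have "\<dots> \<le> (1 + b) ^ s" using s b by (intro power_increasing) auto
      finally have "y * b \<le> M" using y by (meson mult_left_mono order_trans)
      then have "y / b \<le> M * b powr (-2)"
      proof -
        have "y / b = y * b * (1 / b\<^sup>2)" using b by (simp add: power2_eq_square)
        also have "\<dots> \<le> M * (1 / b\<^sup>2)" using \<open>y * b \<le> M\<close> by (intro mult_right_mono) auto
        also have "1 / b\<^sup>2 = b powr (-2)" using b by (simp add: powr_minus_divide)
        finally show ?thesis .
      qed
      also have "\<dots> \<le> M * b powr (-5/4)"
        using b M_pos by (intro mult_left_mono powr_mono) auto
      finally have 2: "y / b \<le> M * b powr (-5/4)" .
      have "x * y * (1 / (a * b)) = (x / a) * (y / b)" by simp
      also have "\<dots> \<le> (e * (2 ^ (s + 1) / real n ^ (s + 1))) * (M * b powr (-5/4))"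
        using x y b apos e by (intro mult_mono 1 2) auto
      finally show ?thesis by (simp add: mult_ac)
    qed
    have "\<bar>second_order p n\<bar> \<le> e * M * (2 ^ (s + 1) / real n ^ (s + 1)) * infsum (\<lambda>j. decay_weight j + decay_weight (int n - j)) UNIV"
      unfolding second_order_def
    proof (rule abs_infsum_dominated[OF decay_weight_pair_summable])
      fix j
      show "\<bar>p (- j) * p (j - int n) * (if j = 0 \<or> j = int n then 0 else 1 / (4 * pi\<^sup>2 * of_int j * of_int (int n - j)))\<bar>
        \<le> e * M * (2 ^ (s + 1) / real n ^ (s + 1)) * (decay_weight j + decay_weight (int n - j))"
      proof (cases "j = 0 \<or> j = int n")
        case True
        then show ?thesis using e M_pos by (simp add: add_nonneg_nonneg)
      next
        case False
        define a b where "a = \<bar>real_of_int j\<bar>" and "b = \<bar>real_of_int (int n - j)\<bar>"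
        have ab: "1 \<le> a" "1 \<le> b" "real n \<le> a + b"
          using False abs_int_sum_ge[of n j] unfolding a_def b_def by linarith+
        have q: "\<bar>p (- j)\<bar> * (1 + a) ^ s \<le> M" "\<bar>p (j - int n)\<bar> * (1 + b) ^ s \<le> M"
          using p_weight[of "-j"] p_weight[of "j - int n"]
          by (simp_all add: sobolev_weight_def a_def b_def abs_minus_commute)
        have c0: "0 \<le> e * M * (2 ^ (s + 1) / real n ^ (s + 1))" using e M_pos by simp
        have "\<bar>p (- j) * p (j - int n) * (if j = 0 \<or> j = int n then 0 else 1 / (4 * pi\<^sup>2 * of_int j * of_int (int n - j)))\<bar>
           \<le> \<bar>p (- j)\<bar> * \<bar>p (j - int n)\<bar> * green_bound n j"
          unfolding abs_mult by (intro mult_left_mono free_green_le[unfolded abs_mult]) auto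
        also have "\<dots> = \<bar>p (- j)\<bar> * \<bar>p (j - int n)\<bar> * (1 / (a * b))"
          using False by (simp add: green_bound_def a_def b_def)
        also have "\<dots> \<le> e * M * (2 ^ (s + 1) / real n ^ (s + 1)) * (a powr (-5/4) + b powr (-5/4))"
        proof (cases "a \<ge> real n / 2")
          case True
          then have "\<bar>- j\<bar> \<ge> K" using n unfolding a_def by linarith
          from K[OF this] have "\<bar>p (- j)\<bar> * a ^ s \<le> e" by (simp add: a_def)
          from aux[OF True ab(2) _ this _ q(2)]
          have "\<bar>p (- j)\<bar> * \<bar>p (j - int n)\<bar> * (1 / (a * b)) \<le> e * M * (2 ^ (s + 1) / real n ^ (s + 1)) * b powr (-5/4)"
            by simp
          also have "\<dots> \<le> e * M * (2 ^ (s + 1) / real n ^ (s + 1)) * (a powr (-5/4) + b powr (-5/4))"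
            using c0 by (intro mult_left_mono) auto
          finally show ?thesis .
        next
          case False
          then have b2: "real n / 2 \<le> b" using ab by linarith
          then have "\<bar>j - int n\<bar> \<ge> K" using n unfolding b_def by linarith
          from K[OF this] have "\<bar>p (j - int n)\<bar> * b ^ s \<le> e" by (simp add: b_def abs_minus_commute)
          from aux[OF b2 ab(1) _ this _ q(1)]
          have "\<bar>p (j - int n)\<bar> * \<bar>p (- j)\<bar> * (1 / (b * a)) \<le> e * M * (2 ^ (s + 1) / real n ^ (s + 1)) * a powr (-5/4)"
            by simp
          also have "\<dots> \<le> e * M * (2 ^ (s + 1) / real n ^ (s + 1)) * (a powr (-5/4) + b powr (-5/4))"
            using c0 by (intro mult_left_mono) auto
          finally show ?thesis by (simp only: mult_ac)
        qed
        finally show ?thesis by (simp add: decay_weight_def a_def b_def)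
      qed
    qed
    then have "\<bar>second_order p n\<bar> \<le> e * C / real n ^ (s + 1)"
      unfolding infsum_decay_weight_pair by (simp add: C_def mult_ac)
    then have "real n ^ (s + 1) * \<bar>second_order p n\<bar> \<le> e * C"
      using npos by (simp add: field_simps)
    also have "\<dots> \<le> e * (C + 1)" using e by simp
    also have "\<dots> = r / 2" using C by (simp add: e_def field_simps)
    finally show ?thesis using r by (simp add: abs_mult)
  qed
  then show "\<exists>no. \<forall>n\<ge>no. norm (real n ^ (s + 1) * second_order p n - 0) < r" by blast
qed

text \<open>Determinant of the Schur complement (Feshbach reduction) of the Bloch matrix on the
  modes 0 and \<open>n\<close>. Mode \<open>n\<close> has wave number \<open>- (pi * n - t)\<close>,
  whence the second square.\<close>

definition resonance_det :: "nat \<Rightarrow> real \<Rightarrow> real \<Rightarrow> real" where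
  "resonance_det n E t =
     (E - (pi * real n + t)\<^sup>2 - dressed p (green n E t) 0 0) *
     (E - (pi * real n - t)\<^sup>2 - dressed p (green n E t) (int n) (int n)) -
     dressed p (green n E t) 0 (int n) * dressed p (green n E t) (int n) 0"

text \<open>A null vector \<open>(x, y)\<close> of the reduced matrix extends to all modes: with
  \<open>R\<close> the dressed kernel, \<open>b\<close> is \<open>R\<close> applied to it and
  \<open>a = (x, y) + G b\<close>. The identity \<open>R = P + P G R\<close> gives
  \<open>P a = b\<close>; off resonance \<open>b = d a\<close> holds by the choice of
  \<open>G\<close>, at the resonant modes by the null vector equations.\<close>

lemma resonance_det_zero_solution:
  assumes n: "n > 0" and sm: "M * infsum (green_bound n) UNIV \<le> 1/2"
    and \<tau>: "\<bar>\<tau>\<bar> \<le> pi / 2" and E: "E = (pi * real n + \<tau>)\<^sup>2" and t: "0 \<le> t" "t \<le> 3"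
    and det: "resonance_det n E t = 0"
  obtains a :: "int \<Rightarrow> real" where "\<exists>m. a m \<noteq> 0" "(\<lambda>m. \<bar>a m\<bar>) summable_on UNIV"
    "\<And>m. ((\<lambda>j. p (m - j) * a j) has_sum (E - (pi * real n + t - 2 * pi * of_int m)\<^sup>2) * a m) UNIV"
proof -
  interpret wk: weighted_kernel p "green_bound n" "sobolev_weight s" M by (rule kernel[OF n sm])
  let ?G = "green n E t"
  let ?R = "dressed p ?G"
  have G: "\<bar>?G j\<bar> \<le> green_bound n j" for j by (rule green_le[OF \<tau> t E])
  define d where "d = (\<lambda>m. E - (pi * real n + t - 2 * pi * real_of_int m)\<^sup>2)"
  have d0: "d 0 = E - (pi * real n + t)\<^sup>2" by (simp add: d_def)
  have dn: "d (int n) = E - (pi * real n - t)\<^sup>2"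
    by (simp add: d_def power2_eq_square algebra_simps)
  have "(d 0 - ?R 0 0) * (d (int n) - ?R (int n) (int n)) = ?R 0 (int n) * ?R (int n) 0"
    using det unfolding resonance_det_def d0 dn by simp
  \<comment> \<open>If the first row is nonzero, \<open>x = ?R 0 (int n)\<close> and
    \<open>y = d 0 - ?R 0 0\<close> work, since the determinant vanishes; if it is zero, only the
    second row has to be solved.\<close>
  then have "\<exists>x y. (x \<noteq> 0 \<or> y \<noteq> 0) \<and> (d 0 - ?R 0 0) * x = ?R 0 (int n) * y \<and>
      (d (int n) - ?R (int n) (int n)) * y = ?R (int n) 0 * x"
    by (cases "?R 0 (int n) = 0 \<and> d 0 - ?R 0 0 = 0")
       (metis mult_zero_left mult_zero_right mult.commute zero_neq_one, metis mult.commute)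
  then obtain x y where xy: "x \<noteq> 0 \<or> y \<noteq> 0" "(d 0 - ?R 0 0) * x = ?R 0 (int n) * y"
      "(d (int n) - ?R (int n) (int n)) * y = ?R (int n) 0 * x" by blast
  define b where "b = (\<lambda>m. x * ?R m 0 + y * ?R m (int n))"
  define a where "a = (\<lambda>j. (if j = 0 then x else 0) + (if j = int n then y else 0) + ?G j * b j)"
  have a0: "a 0 = x" "a (int n) = y" using n by (auto simp: a_def green_def)
  show ?thesis
  proof (rule that)
    show "\<exists>m. a m \<noteq> 0" using xy(1) a0 by metis
    have "(\<lambda>j. norm (?G j * b j)) summable_on UNIV"
    proof (rule Infinite_Sum.abs_summable_on_comparison_test')
      show "(\<lambda>j. (\<bar>x\<bar> * (2 * M) + \<bar>y\<bar> * (2 * M)) * green_bound n j) summable_on UNIV"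
        by (rule summable_on_cmult_right[OF green_bound_summable[OF n]])
      fix j
      have "\<bar>b j\<bar> \<le> \<bar>x * ?R j 0\<bar> + \<bar>y * ?R j (int n)\<bar>" unfolding b_def by (rule abs_triangle_ineq)
      also have "\<dots> \<le> \<bar>x\<bar> * (2 * M) + \<bar>y\<bar> * (2 * M)"
        unfolding abs_mult by (intro add_mono mult_left_mono wk.dressed_abs[OF G]) auto
      finally have "\<bar>b j\<bar> * \<bar>?G j\<bar> \<le> (\<bar>x\<bar> * (2 * M) + \<bar>y\<bar> * (2 * M)) * green_bound n j"
        using M_pos by (intro mult_mono G) auto
      then show "norm (?G j * b j) \<le> (\<bar>x\<bar> * (2 * M) + \<bar>y\<bar> * (2 * M)) * green_bound n j"
        by (simp add: abs_mult mult.commute)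
    qed
    then have "(\<lambda>j. (if j = 0 then \<bar>x\<bar> else 0) + (if j = int n then \<bar>y\<bar> else 0) + norm (?G j * b j)) summable_on UNIV"
      using has_sum_single[of 0 "\<lambda>_. \<bar>x\<bar>"] has_sum_single[of "int n" "\<lambda>_. \<bar>y\<bar>"]
      by (intro summable_on_add) (auto simp: summable_on_def)
    then have "(\<lambda>j. norm (a j)) summable_on UNIV"
      by (rule Infinite_Sum.abs_summable_on_comparison_test') (auto simp: a_def)
    then show "(\<lambda>m. \<bar>a m\<bar>) summable_on UNIV" by simp
    fix m
    have hs: "((\<lambda>j. p (m - j) * ?G j * ?R j \<sigma>) has_sum ?R m \<sigma> - p (m - \<sigma>)) UNIV" for \<sigma>
      using has_sum_infsum[OF wk.convolution_summable[OF G wk.dressed_bound[OF G], of m \<sigma>]]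
        wk.dressed_fixpoint[OF G, of m \<sigma>] by simp
    have "((\<lambda>j. (if j = 0 then p (m - j) * x else 0) + (if j = int n then p (m - j) * y else 0)
        + (x * (p (m - j) * ?G j * ?R j 0) + y * (p (m - j) * ?G j * ?R j (int n)))) has_sum
        (p (m - 0) * x + p (m - int n) * y + (x * (?R m 0 - p (m - 0)) + y * (?R m (int n) - p (m - int n))))) UNIV"
      by (intro has_sum_add has_sum_single has_sum_cmult_right hs)
    then have "((\<lambda>j. p (m - j) * a j) has_sum b m) UNIV"
      by (rule back_subst[of "\<lambda>f. (f has_sum _) UNIV", THEN back_subst[of "\<lambda>c. (_ has_sum c) UNIV"]])
         (auto simp: a_def b_def algebra_simps)
    moreover have "b m = d m * a m"
    proof (cases "m = 0 \<or> m = int n")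
      case True
      then show ?thesis using xy a0 by (auto simp: b_def algebra_simps)
    next
      case False
      then have "0 < \<bar>real_of_int m\<bar> * \<bar>real_of_int (int n - m)\<bar>" by simp
      also have "\<dots> \<le> \<bar>d m\<bar>" unfolding d_def E by (rule nonresonant_lower_bound[OF \<tau> t]) (use False in auto)
      finally have "d m \<noteq> 0" by simp
      moreover have "a m = 1 / d m * b m" using False by (simp add: a_def green_def d_def)
      ultimately show ?thesis by simp
    qed
    ultimately show "((\<lambda>j. p (m - j) * a j) has_sum (E - (pi * real n + t - 2 * pi * of_int m)\<^sup>2) * a m) UNIV"
      by (simp add: d_def)
  qed
qed

lemma continuous_on_resonance_det:
  assumes n: "n > 0" and sm: "M * infsum (green_bound n) UNIV \<le> 1/2"
    and \<tau>: "\<bar>\<tau>\<bar> \<le> pi / 2" and E: "E = (pi * real n + \<tau>)\<^sup>2"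
  shows "continuous_on {0..3} (resonance_det n E)"
proof -
  interpret wk: weighted_kernel p "green_bound n" "sobolev_weight s" M by (rule kernel[OF n sm])
  have "continuous_on {0..3} (\<lambda>t. green n E t j)" for j
  proof (cases "j = 0 \<or> j = int n")
    case False
    have "E - (pi * real n + t - 2 * pi * of_int j)\<^sup>2 \<noteq> 0" if "t \<in> {0..3}" for t
    proof -
      have "0 < \<bar>real_of_int j\<bar> * \<bar>real_of_int (int n - j)\<bar>" using False by simp
      also have "\<dots> \<le> \<bar>E - (pi * real n + t - 2 * pi * of_int j)\<^sup>2\<bar>"
        unfolding E by (rule nonresonant_lower_bound[OF \<tau>]) (use False that in auto)
      finally show ?thesis by simp
    qed
    then have "continuous_on {0..3} (\<lambda>t. 1 / (E - (pi * real n + t - 2 * pi * of_int j)\<^sup>2))"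
      by (intro continuous_intros) auto
    then show ?thesis using False by (simp add: green_def)
  qed (auto simp: green_def)
  moreover have "\<bar>green n E t j\<bar> \<le> green_bound n j" if "t \<in> {0..3}" for t j
    using that by (intro green_le[OF \<tau> _ _ E]) auto
  ultimately have "continuous_on {0..3} (\<lambda>t. dressed p (green n E t) m \<sigma>)" for m \<sigma>
    by (intro wk.continuous_on_dressed) auto
  then show ?thesis unfolding resonance_det_def by (intro continuous_intros)
qed

lemma resonance_det_right_neg:
  assumes n: "n > 0" "real n > 4 * M" and sm: "M * infsum (green_bound n) UNIV \<le> 1/2"
    and \<tau>: "\<bar>\<tau>\<bar> \<le> pi / 2" and E: "E = (pi * real n + \<tau>)\<^sup>2"
  shows "resonance_det n E 3 < 0"
proof -
  interpret wk: weighted_kernel p "green_bound n" "sobolev_weight s" M by (rule kernel[OF n(1) sm])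
  let ?R = "dressed p (green n E 3)"
  have R: "\<bar>?R m \<sigma>\<bar> \<le> 2 * M" for m \<sigma>
    by (rule wk.dressed_abs) (rule green_le[OF \<tau> _ _ E], auto)
  \<comment> \<open>Hence \<open>3 - \<tau>\<close> and \<open>3 + \<tau>\<close> both exceed 1,
    while the other factor of each difference of squares is at least \<open>n\<close>.\<close>
  have \<tau>2: "-2 < \<tau>" "\<tau> < 2" using \<tau> pi_half_less_two by linarith+
  have n1: "1 \<le> real n" using n(1) by linarith
  have pn: "3 * real n \<le> pi * real n" using pi_gt3 by (intro mult_right_mono) auto
  define u v where "u = - (E - (pi * real n + 3)\<^sup>2 - ?R 0 0)"
    and "v = E - (pi * real n - 3)\<^sup>2 - ?R (int n) (int n)"
  have "real n * 1 \<le> (2 * (pi * real n) + \<tau> + 3) * (3 - \<tau>)"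
    by (intro mult_mono) (use pn \<tau>2 n1 in linarith)+
  also have "\<dots> = - (E - (pi * real n + 3)\<^sup>2)" unfolding E by (simp add: power2_eq_square algebra_simps)
  finally have u: "real n - 2 * M \<le> u" unfolding u_def using R[of 0 0] by linarith
  have "real n * 1 \<le> (2 * (pi * real n) + \<tau> - 3) * (\<tau> + 3)"
    by (intro mult_mono) (use pn \<tau>2 n1 in linarith)+
  also have "\<dots> = E - (pi * real n - 3)\<^sup>2" unfolding E by (simp add: power2_eq_square algebra_simps)
  finally have v: "real n - 2 * M \<le> v" unfolding v_def using R[of "int n" "int n"] by linarith
  \<comment> \<open>This is where \<open>n > 4 * M\<close> enters: it makes \<open>n - 2 * M\<close>
    larger than the bound \<open>2 * M\<close> for each coupling.\<close>
  have "(2 * M) * (2 * M) < (real n - 2 * M) * (real n - 2 * M)"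
    using n M_pos by (intro mult_strict_mono) auto
  also have "\<dots> \<le> u * v" using u v n M_pos by (intro mult_mono) auto
  finally have "(2 * M) * (2 * M) < u * v" .
  moreover have "\<bar>?R 0 (int n) * ?R (int n) 0\<bar> \<le> (2 * M) * (2 * M)"
    unfolding abs_mult using M_pos by (intro mult_mono R) auto
  ultimately show ?thesis unfolding resonance_det_def u_def v_def by (simp only: mult_minus_left)
qed

text \<open>The threshold \<open>5 * M\<close> separates two regimes. Beyond it the equal diagonal
  entries have modulus at least \<open>3 * M\<close> and their square beats the couplings, each at
  most \<open>2 * M\<close>. Within it \<open>5 * M\<close> serves as the bound \<open>K\<close> for
  the energy shift, and the sign of the product of couplings decides.\<close>

lemma resonance_det_left_pos:
  assumes n: "n > 0" and sm: "M * infsum (green_bound n) UNIV \<le> 1/2"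
    and \<tau>: "\<bar>\<tau>\<bar> \<le> pi / 2" and E: "E = (pi * real n + \<tau>)\<^sup>2"
    and sgn: "p (- int n) * p (int n) < 0"
    and low: "c \<le> \<bar>p (- int n)\<bar> * real n ^ (s + 1)" "c \<le> \<bar>p (int n)\<bar> * real n ^ (s + 1)"
    and so: "real n ^ (s + 1) * \<bar>second_order p n\<bar> + (5 * M * M\<^sup>2 + 2 * M ^ 3) * (real n * (infsum (green_bound n) UNIV)\<^sup>2) < c"
      "real n ^ (s + 1) * \<bar>second_order (\<lambda>k. p (- k)) n\<bar> + (5 * M * M\<^sup>2 + 2 * M ^ 3) * (real n * (infsum (green_bound n) UNIV)\<^sup>2) < c"
  shows "resonance_det n E 0 > 0"
proof -
  interpret wk: weighted_kernel p "green_bound n" "sobolev_weight s" M by (rule kernel[OF n sm])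
  let ?R = "dressed p (green n E 0)"
  have G: "\<bar>green n E 0 j\<bar> \<le> green_bound n j" for j by (rule green_le[OF \<tau> _ _ E]) auto
  have R: "\<bar>?R m \<sigma>\<bar> \<le> 2 * M" for m \<sigma> by (rule wk.dressed_abs[OF G])
  have "green n E 0 (int n - j) = green n E 0 j" for j
  proof -
    have "(pi * real n + 0 - 2 * pi * of_int (int n - j))\<^sup>2 = (pi * real n + 0 - 2 * pi * of_int j)\<^sup>2"
      by (simp add: power2_eq_square algebra_simps)
    then show ?thesis unfolding green_def by auto
  qed
  from wk.dressed_reflect[OF G this, of 0 0] have refl: "?R (int n) (int n) = ?R 0 0" by simp
  define \<nu> where "\<nu> = E - (pi * real n)\<^sup>2"
  have det: "resonance_det n E 0 = (\<nu> - ?R 0 0)\<^sup>2 - ?R 0 (int n) * ?R (int n) 0"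
    unfolding resonance_det_def refl \<nu>_def by (simp add: power2_eq_square)
  show ?thesis
  proof (cases "\<bar>\<nu>\<bar> \<le> 5 * M")
    case True
    have N: "real n ^ (s + 1) > 0" using n by simp
    have 1: "\<bar>?R 0 (int n) - p (- int n)\<bar> * real n ^ (s + 1) < \<bar>p (- int n)\<bar> * real n ^ (s + 1)"
      using coupling_close(1)[OF n sm \<tau> E True[unfolded \<nu>_def]] so(1) low(1) by linarith
    have 2: "\<bar>?R (int n) 0 - p (int n)\<bar> * real n ^ (s + 1) < \<bar>p (int n)\<bar> * real n ^ (s + 1)"
      using coupling_close(2)[OF n sm \<tau> E True[unfolded \<nu>_def]] so(2) low(2) by linarith
    have 1: "\<bar>?R 0 (int n) - p (- int n)\<bar> < \<bar>p (- int n)\<bar>" using 1 N by (simp only: mult_less_cancel_right_pos)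
    have 2: "\<bar>?R (int n) 0 - p (int n)\<bar> < \<bar>p (int n)\<bar>" using 2 N by (simp only: mult_less_cancel_right_pos)
    \<comment> \<open>Each dressed coupling lies closer to the bare coefficient than that
      coefficient lies to 0, so the signs agree.\<close>
    have "?R 0 (int n) * ?R (int n) 0 < 0"
      using sgn 1 2 unfolding mult_less_0_iff by linarith
    then show ?thesis unfolding det using zero_le_power2[of "\<nu> - ?R 0 0"] by linarith
  next
    case False
    then have "3 * M \<le> \<bar>\<nu> - ?R 0 0\<bar>" using R[of 0 0] by linarith
    then have "(3 * M)\<^sup>2 \<le> (\<nu> - ?R 0 0)\<^sup>2"
      using M_pos by (metis abs_of_pos power2_le_iff_abs_le abs_le_square_iff mult_pos_pos zero_less_numeral)
    moreover have "\<bar>?R 0 (int n) * ?R (int n) 0\<bar> \<le> (2 * M) * (2 * M)"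
      unfolding abs_mult using M_pos by (intro mult_mono R) auto
    moreover have "(2 * M) * (2 * M) < (3 * M)\<^sup>2" using M_pos by (simp add: power2_eq_square)
    ultimately show ?thesis unfolding det by linarith
  qed
qed

text \<open>No energy is skipped: every large \<open>E\<close> is within \<open>pi / 2\<close> of
  some \<open>pi * n\<close> on the scale of square roots, and that \<open>n\<close> serves as the
  resonance index.\<close>

theorem resonance_solution:
  assumes so: "(\<lambda>n. real n ^ (s + 1) * second_order p n) \<longlonglongrightarrow> 0"
      "(\<lambda>n. real n ^ (s + 1) * second_order (\<lambda>k. p (- k)) n) \<longlonglongrightarrow> 0"
    and c: "c > 0"
    and sgn: "\<And>n. n \<ge> N0 \<Longrightarrow> p (- int n) * p (int n) < 0"
    and low: "\<And>n. n \<ge> N0 \<Longrightarrow> c \<le> \<bar>p (- int n)\<bar> * real n ^ (s + 1)"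
      "\<And>n. n \<ge> N0 \<Longrightarrow> c \<le> \<bar>p (int n)\<bar> * real n ^ (s + 1)"
  obtains R where "\<And>E. E \<ge> R \<Longrightarrow> \<exists>(n::nat) t a. 0 < t \<and> t < 3 \<and> (\<exists>m. a m \<noteq> 0) \<and> (\<lambda>m. \<bar>a m\<bar>) summable_on UNIV \<and>
    (\<forall>m. ((\<lambda>j. p (m - j) * a j) has_sum (E - (pi * real n + t - 2 * pi * of_int m)\<^sup>2) * a m) UNIV)"
proof -
  let ?S = "\<lambda>n. infsum (green_bound n) UNIV"
  have "(\<lambda>n. M * ?S n) \<longlonglongrightarrow> 0" by (intro tendsto_mult_right_zero green_bound_tendsto)
  then have ev1: "\<forall>\<^sub>F n in sequentially. M * ?S n < 1/2" by (rule order_tendstoD) simp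
  have ev: "\<forall>\<^sub>F n in sequentially. real n ^ (s + 1) * \<bar>second_order p' n\<bar> + (5 * M * M\<^sup>2 + 2 * M ^ 3) * (real n * (?S n)\<^sup>2) < c"
    if "(\<lambda>n. real n ^ (s + 1) * second_order p' n) \<longlonglongrightarrow> 0" for p'
  proof -
    have "(\<lambda>n. \<bar>real n ^ (s + 1) * second_order p' n\<bar>) \<longlonglongrightarrow> 0"
      using that by (simp only: tendsto_rabs_zero_iff)
    then have "(\<lambda>n. real n ^ (s + 1) * \<bar>second_order p' n\<bar>) \<longlonglongrightarrow> 0" by (simp add: abs_mult)
    then have "(\<lambda>n. real n ^ (s + 1) * \<bar>second_order p' n\<bar> + (5 * M * M\<^sup>2 + 2 * M ^ 3) * (real n * (?S n)\<^sup>2)) \<longlonglongrightarrow> 0"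
      by (intro tendsto_add_zero tendsto_mult_right_zero green_bound_square_tendsto)
    then show ?thesis using c by (rule order_tendstoD(2))
  qed
  obtain k0 :: nat where k0: "4 * M < real k0" using reals_Archimedean2 by blast
  have "\<forall>\<^sub>F n in sequentially. n \<ge> N0 \<and> n \<ge> k0 \<and> n > 0 \<and> M * ?S n < 1/2 \<and>
      real n ^ (s + 1) * \<bar>second_order p n\<bar> + (5 * M * M\<^sup>2 + 2 * M ^ 3) * (real n * (?S n)\<^sup>2) < c \<and>
      real n ^ (s + 1) * \<bar>second_order (\<lambda>k. p (- k)) n\<bar> + (5 * M * M\<^sup>2 + 2 * M ^ 3) * (real n * (?S n)\<^sup>2) < c"
    by (intro eventually_conj eventually_ge_at_top eventually_gt_at_top ev1 ev so)
  then obtain N where N: "\<And>n. n \<ge> N \<Longrightarrow> n \<ge> N0 \<and> n \<ge> k0 \<and> n > 0 \<and> M * ?S n < 1/2 \<and>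
      real n ^ (s + 1) * \<bar>second_order p n\<bar> + (5 * M * M\<^sup>2 + 2 * M ^ 3) * (real n * (?S n)\<^sup>2) < c \<and>
      real n ^ (s + 1) * \<bar>second_order (\<lambda>k. p (- k)) n\<bar> + (5 * M * M\<^sup>2 + 2 * M ^ 3) * (real n * (?S n)\<^sup>2) < c"
    unfolding eventually_sequentially by blast
  show ?thesis
  proof (rule that)
    \<comment> \<open>The extra 1 absorbs the rounding error 1/2, so that the nearest index is still
      at least \<open>N\<close>.\<close>
    fix E :: real assume E0: "E \<ge> (pi * (real N + 1))\<^sup>2"
    define n where "n = nat (round (sqrt E / pi))"
    define \<tau> where "\<tau> = sqrt E - pi * real n"
    have Epos: "E \<ge> 0" using E0 by (meson order_trans zero_le_power2)
    have "pi * (real N + 1) \<le> sqrt E" using E0 by (intro real_le_rsqrt)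
    then have sq: "real N + 1 \<le> sqrt E / pi" by (simp add: pos_le_divide_eq mult.commute)
    have rnd: "\<bar>real_of_int (round (sqrt E / pi)) - sqrt E / pi\<bar> \<le> 1/2" by (rule of_int_round_abs_le)
    then have rge: "real_of_int (round (sqrt E / pi)) > real N" using sq by linarith
    then have rn: "real n = real_of_int (round (sqrt E / pi))" unfolding n_def by simp
    then have nN: "n \<ge> N" using rge by linarith
    have \<tau>: "\<bar>\<tau>\<bar> \<le> pi / 2"
    proof -
      have "\<bar>\<tau>\<bar> = pi * \<bar>real n - sqrt E / pi\<bar>"
      proof -
        have "\<tau> = - (pi * (real n - sqrt E / pi))" by (simp add: \<tau>_def field_simps)
        then show ?thesis by (simp only: abs_minus_cancel abs_mult) simp
      qed
      also have "\<dots> \<le> pi * (1/2)" using rnd unfolding rn by (intro mult_left_mono) auto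
      finally show ?thesis by simp
    qed
    have E: "E = (pi * real n + \<tau>)\<^sup>2" using Epos by (simp add: \<tau>_def)
    note Nn = N[OF nN]
    have n: "n > 0" and sm: "M * ?S n \<le> 1/2" and n4: "real n > 4 * M" and nN0: "n \<ge> N0"
      using Nn k0 by auto
    have D0: "resonance_det n E 0 > 0"
      by (rule resonance_det_left_pos[OF n sm \<tau> E sgn[OF nN0] low(1)[OF nN0] low(2)[OF nN0]]) (use Nn in auto)
    have D3: "resonance_det n E 3 < 0" by (rule resonance_det_right_neg[OF n n4 sm \<tau> E])
    obtain t where t: "0 \<le> t" "t \<le> 3" "resonance_det n E t = 0"
      using IVT2'[of "resonance_det n E" 3 0 0] D0 D3 continuous_on_resonance_det[OF n sm \<tau> E] by auto
    \<comment> \<open>The endpoints are excluded by the strict signs; \<open>t = 0\<close> would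
      give the multiplier 1 or -1, and 1 has to be avoided later.\<close>
    have t': "0 < t" "t < 3" using t D0 D3 by (auto simp: less_le)
    obtain a :: "int \<Rightarrow> real" where "\<exists>m. a m \<noteq> 0" "(\<lambda>m. \<bar>a m\<bar>) summable_on UNIV"
      "\<And>m. ((\<lambda>j. p (m - j) * a j) has_sum (E - (pi * real n + t - 2 * pi * of_int m)\<^sup>2) * a m) UNIV"
      by (rule resonance_det_zero_solution[OF n sm \<tau> E t]) blast
    then show "\<exists>(n::nat) t a. 0 < t \<and> t < 3 \<and> (\<exists>m. a m \<noteq> 0) \<and> (\<lambda>m. \<bar>a m\<bar>) summable_on UNIV \<and>
      (\<forall>m. ((\<lambda>j. p (m - j) * a j) has_sum (E - (pi * real n + t - 2 * pi * of_int m)\<^sup>2) * a m) UNIV)"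
      using t' by blast
  qed
qed

end

subsection \<open>Bounded solutions and the spectrum\<close>

lemma borel_measurable_lebesgue_AE:
  fixes f g :: "real \<Rightarrow> complex"
  assumes f: "f \<in> borel_measurable lebesgue" and N: "negligible N" and eq: "\<And>x. x \<notin> N \<Longrightarrow> g x = f x"
  shows "g \<in> borel_measurable lebesgue"
proof (rule borel_measurableI)
  fix U :: "complex set" assume "open U"
  then have "f -` U \<inter> space lebesgue \<in> sets lebesgue" by (intro measurable_sets[OF f]) simp
  then show "g -` U \<inter> space lebesgue \<in> sets lebesgue"
    by (rule sets_negligible_symdiff) (rule negligible_subset[OF N], use eq in auto)
qed

lemma
  fixes h :: "real \<Rightarrow> real"
  assumes c: "continuous_on {a..b} h" and z: "\<And>x. x \<notin> {a..b} \<Longrightarrow> h x = 0"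
  shows integrable_lebesgue_compact_support: "integrable lebesgue h"
    and integral_lebesgue_compact_support: "(\<integral>x. h x \<partial>lebesgue) = integral {a..b} h"
proof -
  have s: "set_integrable lebesgue {a..b} h" by (rule absolutely_integrable_continuous_real[OF c])
  have i: "(\<lambda>x. indicat_real {a..b} x *\<^sub>R h x) = h"
    by (rule ext) (metis indicator_simps scaleR_one scaleR_zero_left z)
  show "integrable lebesgue h" using s unfolding set_integrable_def i .
  show "(\<integral>x. h x \<partial>lebesgue) = integral {a..b} h"
    using set_lebesgue_integral_eq_integral(2)[OF s] unfolding set_lebesgue_integral_def i .
qed

lemma borel_measurable_compact_support:
  fixes h :: "real \<Rightarrow> complex"
  assumes c: "continuous_on {a..b} h" and z: "\<And>x. x \<notin> {a..b} \<Longrightarrow> h x = 0"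
  shows "h \<in> borel_measurable lebesgue"
proof -
  have s: "set_integrable lebesgue {a..b} h" by (rule absolutely_integrable_continuous_real[OF c])
  have i: "(\<lambda>x. indicat_real {a..b} x *\<^sub>R h x) = h"
    by (rule ext) (metis indicator_simps scaleR_one scaleR_zero_left z)
  show ?thesis using s unfolding set_integrable_def i by (rule borel_measurable_integrable)
qed

text \<open>Used at the ends of a cutoff, where the domain still demands differentiability.\<close>

lemma has_vector_derivative_zero_quadratic:
  fixes f :: "real \<Rightarrow> complex"
  assumes le: "\<And>y. norm (f y) \<le> K * (y - x)\<^sup>2"
  shows "(f has_vector_derivative 0) (at x)"
proof -
  have fx: "f x = 0" using le[of x] by simp
  show ?thesis unfolding has_vector_derivative_def has_derivative_at_alt
  proof (intro conjI allI impI)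
    show "bounded_linear (\<lambda>t. t *\<^sub>R (0::complex))" by simp
    fix e :: real assume e: "e > 0"
    show "\<exists>d>0. \<forall>y. norm (y - x) < d \<longrightarrow> norm (f y - f x - (y - x) *\<^sub>R 0) \<le> e * norm (y - x)"
    proof (intro exI[of _ "e / (\<bar>K\<bar> + 1)"] conjI allI impI)
      show "e / (\<bar>K\<bar> + 1) > 0" using e by simp
      fix y assume y: "norm (y - x) < e / (\<bar>K\<bar> + 1)"
      have "norm (f y) \<le> \<bar>K\<bar> * (y - x)\<^sup>2" using le[of y] by (smt (verit) mult_right_mono zero_le_power2)
      also have "\<dots> \<le> (\<bar>K\<bar> + 1) * (y - x)\<^sup>2" by (intro mult_right_mono) auto
      also have "\<dots> = (\<bar>K\<bar> + 1) * norm (y - x) * norm (y - x)"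
        by (simp add: power2_eq_square abs_mult[symmetric])
      also have "\<dots> \<le> e * norm (y - x)"
        using y by (intro mult_right_mono) (auto simp: pos_less_divide_eq mult.commute)
      finally show "norm (f y - f x - (y - x) *\<^sub>R 0) \<le> e * norm (y - x)" using fx by simp
    qed
  qed
qed

lemma has_vector_derivative_zero_locally:
  fixes f :: "real \<Rightarrow> complex"
  assumes "open S" "x \<in> S" "\<And>y. y \<in> S \<Longrightarrow> f y = 0"
  shows "(f has_vector_derivative 0) (at x)"
  by (rule has_vector_derivative_transform_within_open[of "\<lambda>_. 0" _ _ S]) (use assms in auto)

text \<open>The equation \<open>y'' = (q - E) y\<close> in integrated form, as \<open>q\<close> is
  only integrable; \<open>V\<close> is \<open>y'\<close>. The half-line suffices because the
  singular sequence is supported there. The constant mass per period makes the norm on an interval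
  grow like its length.\<close>

locale bloch_solution =
  fixes q y V w :: "real \<Rightarrow> complex" and E By Bv c :: real and C1 C2 :: complex
  assumes w: "w x = (q x - of_real E) * y x"
    and w_int: "w absolutely_integrable_on {0..b}"
    and V: "x \<ge> 0 \<Longrightarrow> V x = C2 + integral {0..x} w"
    and y: "x \<ge> 0 \<Longrightarrow> y x = C1 + integral {0..x} V"
    and By: "x \<ge> 0 \<Longrightarrow> norm (y x) \<le> By" and Bv: "x \<ge> 0 \<Longrightarrow> norm (V x) \<le> Bv"
    and c_pos: "c > 0" and mass: "integral {real j..real (Suc j)} (\<lambda>x. (norm (y x))\<^sup>2) = c"
begin

lemma w_integrable: "w integrable_on {0..b}"
  using w_int set_lebesgue_integral_eq_integral(1) by blast

lemma V_continuous: "continuous_on {0..b} V"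
proof -
  have "continuous_on {0..b} (\<lambda>x. C2 + integral {0..x} w)"
    by (intro continuous_intros indefinite_integral_continuous_1 w_integrable)
  then show ?thesis by (subst continuous_on_cong) (auto simp: V)
qed

lemma V_integrable: "V integrable_on {0..b}"
  by (rule integrable_continuous_interval[OF V_continuous])

lemma y_continuous: "continuous_on {0..b} y"
proof -
  have "continuous_on {0..b} (\<lambda>x. C1 + integral {0..x} V)"
    by (intro continuous_intros indefinite_integral_continuous_1 V_integrable)
  then show ?thesis by (subst continuous_on_cong) (auto simp: y)
qed

lemma y_derivative:
  assumes "x > 0"
  shows "(y has_vector_derivative V x) (at x)"
proof -
  have "((\<lambda>u. integral {0..u} V) has_vector_derivative V x) (at x within {0..x+1})"
    by (rule integral_has_vector_derivative[OF V_continuous]) (use assms in auto)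
  then have "((\<lambda>u. integral {0..u} V) has_vector_derivative V x) (at x)"
    using assms by (subst (asm) at_within_interior[of x]) auto
  then have "((\<lambda>u. C1 + integral {0..u} V) has_vector_derivative V x) (at x)"
    by (auto intro!: derivative_eq_intros)
  then show ?thesis
    by (rule has_vector_derivative_transform_within_open[of _ _ _ "{0<..}"]) (use assms y in auto)
qed

lemma y_lipschitz: "0 \<le> l \<Longrightarrow> l \<le> r \<Longrightarrow> norm (y r - y l) \<le> Bv * (r - l)"
proof -
  assume lr: "0 \<le> l" "l \<le> r"
  have "integral {0..l} V + integral {l..r} V = integral {0..r} V"
    by (rule Henstock_Kurzweil_Integration.integral_combine) (use lr V_integrable in auto)
  then have "y r - y l = integral {l..r} V" using lr y by (auto simp: algebra_simps)
  also have "norm \<dots> \<le> Bv * (r - l)"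
    by (rule integral_bound) (use lr Bv in \<open>auto intro: continuous_on_subset[OF V_continuous[of r]]\<close>)
  finally show ?thesis .
qed

lemma V_difference: "0 \<le> l \<Longrightarrow> l \<le> r \<Longrightarrow> norm (V r - V l) \<le> integral {l..r} (\<lambda>x. norm (w x))"
proof -
  assume lr: "0 \<le> l" "l \<le> r"
  have "integral {0..l} w + integral {l..r} w = integral {0..r} w"
    by (rule Henstock_Kurzweil_Integration.integral_combine) (use lr w_integrable in auto)
  then have "V r - V l = integral {l..r} w" using lr V by (auto simp: algebra_simps)
  also have "norm \<dots> \<le> integral {l..r} (\<lambda>x. norm (w x))"
  proof (rule Henstock_Kurzweil_Integration.integral_norm_bound_integral)
    show "w integrable_on {l..r}" by (rule integrable_on_subinterval[OF w_integrable[of r]]) (use lr in auto)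
    have "(\<lambda>x. norm (w x)) integrable_on {0..r}" using w_int unfolding absolutely_integrable_on_def by simp
    then show "(\<lambda>x. norm (w x)) integrable_on {l..r}" by (rule integrable_on_subinterval) (use lr in auto)
  qed auto
  finally show ?thesis .
qed

lemma By_nonneg: "By \<ge> 0" using By[of 0] norm_ge_zero[of "y 0"] by linarith
lemma Bv_nonneg: "Bv \<ge> 0" using Bv[of 0] norm_ge_zero[of "V 0"] by linarith

lemma mass_sum: "integral {real L..real (L + k)} (\<lambda>x. (norm (y x))\<^sup>2) = real k * c"
proof (induction k)
  case (Suc k)
  have "(\<lambda>x. (norm (y x))\<^sup>2) integrable_on {real L..real (L + Suc k)}"
    by (rule integrable_continuous_interval) (intro continuous_intros continuous_on_subset[OF y_continuous[of "real (L + Suc k)"]], auto)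
  then have "integral {real L..real (L + k)} (\<lambda>x. (norm (y x))\<^sup>2) + integral {real (L + k)..real (L + Suc k)} (\<lambda>x. (norm (y x))\<^sup>2)
     = integral {real L..real (L + Suc k)} (\<lambda>x. (norm (y x))\<^sup>2)"
    by (intro Henstock_Kurzweil_Integration.integral_combine) auto
  then show ?case using Suc mass[of "L + k"] by (simp add: algebra_simps)
qed simp

end

text \<open>A cubed parabola: explicit, with \<open>\<zeta>\<close> and its first two derivatives
  vanishing at 0 and \<open>N\<close>. The normalisation by \<open>N\<^sup>2\<close> keeps
  \<open>\<zeta>\<close> bounded and makes the derivatives of order \<open>1 / N\<close> and
  \<open>1 / N\<^sup>2\<close>.\<close>

locale cutoff =
  fixes N :: real assumes N: "N \<ge> 1"
begin

definition b :: "real \<Rightarrow> real" where "b x = x * (N - x) / N\<^sup>2"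
definition b' :: "real \<Rightarrow> real" where "b' x = (N - 2 * x) / N\<^sup>2"
definition \<zeta> :: "real \<Rightarrow> real" where "\<zeta> x = b x ^ 3"
definition \<zeta>' :: "real \<Rightarrow> real" where "\<zeta>' x = 3 * (b x)\<^sup>2 * b' x"
definition \<zeta>'' :: "real \<Rightarrow> real" where "\<zeta>'' x = 6 * b x * (b' x)\<^sup>2 - 6 * (b x)\<^sup>2 / N\<^sup>2"

lemma b_deriv: "(b has_real_derivative b' x) (at x within S)"
  unfolding b_def b'_def using N by (auto intro!: derivative_eq_intros simp: field_simps power2_eq_square)

lemma b'_deriv: "(b' has_real_derivative - 2 / N\<^sup>2) (at x within S)"
  unfolding b'_def using N by (auto intro!: derivative_eq_intros simp: field_simps power2_eq_square)

lemma \<zeta>_deriv: "(\<zeta> has_real_derivative \<zeta>' x) (at x within S)"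
  unfolding \<zeta>_def \<zeta>'_def by (auto intro!: derivative_eq_intros b_deriv simp: power2_eq_square)

lemma \<zeta>'_deriv: "(\<zeta>' has_real_derivative \<zeta>'' x) (at x within S)"
  unfolding \<zeta>'_def \<zeta>''_def
  by (auto intro!: derivative_eq_intros b_deriv b'_deriv simp: power2_eq_square algebra_simps)

lemma continuous_cutoff [continuous_intros]:
  "continuous_on S b" "continuous_on S b'" "continuous_on S \<zeta>" "continuous_on S \<zeta>'" "continuous_on S \<zeta>''"
proof -
  show b: "continuous_on S b" "continuous_on S b'"
    using N unfolding b_def[abs_def] b'_def[abs_def] by (auto intro!: continuous_intros)
  show "continuous_on S \<zeta>" "continuous_on S \<zeta>'" "continuous_on S \<zeta>''"
    using N unfolding \<zeta>_def[abs_def] \<zeta>'_def[abs_def] \<zeta>''_def[abs_def] by (auto intro!: continuous_intros b)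
qed

lemma b_bounds:
  assumes "x \<in> {0..N}"
  shows "0 \<le> b x" "b x \<le> x" "b x \<le> N - x" "b x \<le> 1" "\<bar>b' x\<bar> \<le> 1 / N"
proof -
  have x: "0 \<le> x" "x \<le> N" using assms by auto
  show "0 \<le> b x" unfolding b_def using x by simp
  have N2: "N * 1 \<le> N * N" using N by (intro mult_left_mono) auto
  have "x * (N - x) \<le> x * N" using x by (intro mult_left_mono) auto
  also have "\<dots> \<le> x * N\<^sup>2" using x N2 by (intro mult_left_mono) (auto simp: power2_eq_square)
  finally show "b x \<le> x" unfolding b_def using N by (simp add: pos_divide_le_eq)
  have "x * (N - x) \<le> N * (N - x)" using x by (intro mult_right_mono) auto
  also have "\<dots> \<le> N\<^sup>2 * (N - x)" using x N2 by (intro mult_right_mono) (auto simp: power2_eq_square)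
  finally show "b x \<le> N - x" unfolding b_def using N by (simp add: pos_divide_le_eq mult.commute)
  have "x * (N - x) \<le> N * N" using x by (intro mult_mono) auto
  then show "b x \<le> 1" unfolding b_def using N by (simp add: power2_eq_square pos_divide_le_eq)
  have "\<bar>b' x\<bar> = \<bar>N - 2 * x\<bar> / N\<^sup>2" by (simp add: b'_def)
  also have "\<dots> \<le> N / N\<^sup>2" using x by (intro divide_right_mono) auto
  also have "\<dots> = 1 / N" using N by (simp add: power2_eq_square)
  finally show "\<bar>b' x\<bar> \<le> 1 / N" .
qed

lemma \<zeta>_bounds:
  assumes "x \<in> {0..N}"
  shows "\<bar>\<zeta> x\<bar> \<le> 1" "\<bar>\<zeta> x\<bar> \<le> x\<^sup>2" "\<bar>\<zeta> x\<bar> \<le> (N - x)\<^sup>2" "\<bar>\<zeta>' x\<bar> \<le> 3 / N" "\<bar>\<zeta>'' x\<bar> \<le> 12 / N\<^sup>2"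
proof -
  note B = b_bounds[OF assms]
  have b2: "(b x)\<^sup>2 \<le> 1" using B by (simp add: power_le_one)
  have b3: "\<bar>\<zeta> x\<bar> \<le> (b x)\<^sup>2"
    using B mult_left_mono[OF B(4), of "(b x)\<^sup>2"] by (simp add: \<zeta>_def power3_eq_cube power2_eq_square)
  show "\<bar>\<zeta> x\<bar> \<le> 1" using b3 b2 by linarith
  show "\<bar>\<zeta> x\<bar> \<le> x\<^sup>2" using b3 power_mono[OF B(2) B(1), of 2] by linarith
  show "\<bar>\<zeta> x\<bar> \<le> (N - x)\<^sup>2" using b3 power_mono[OF B(3) B(1), of 2] by linarith
  have "\<bar>\<zeta>' x\<bar> = 3 * ((b x)\<^sup>2 * \<bar>b' x\<bar>)" by (simp add: \<zeta>'_def abs_mult)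
  also have "\<dots> \<le> 3 * (1 * (1 / N))" using b2 B by (intro mult_left_mono mult_mono) auto
  finally show "\<bar>\<zeta>' x\<bar> \<le> 3 / N" by simp
  have bb: "(b' x)\<^sup>2 \<le> (1 / N)\<^sup>2" using B(5) power_mono[of "\<bar>b' x\<bar>" "1 / N" 2] by simp
  have "\<bar>\<zeta>'' x\<bar> \<le> \<bar>6 * b x * (b' x)\<^sup>2\<bar> + \<bar>6 * (b x)\<^sup>2 / N\<^sup>2\<bar>" unfolding \<zeta>''_def by (rule abs_triangle_ineq4)
  also have "\<dots> = 6 * (b x * (b' x)\<^sup>2) + 6 * (b x)\<^sup>2 / N\<^sup>2" using B by (simp add: abs_mult)
  also have "\<dots> \<le> 6 * (1 * (1 / N)\<^sup>2) + 6 * 1 / N\<^sup>2"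
    using B b2 bb by (intro add_mono mult_left_mono mult_mono divide_right_mono) auto
  also have "\<dots> = 12 / N\<^sup>2" by (simp add: power_divide)
  finally show "\<bar>\<zeta>'' x\<bar> \<le> 12 / N\<^sup>2" .
qed

lemma \<zeta>_endpoints [simp]: "\<zeta> 0 = 0" "\<zeta> N = 0" "\<zeta>' 0 = 0" "\<zeta>' N = 0" "\<zeta>'' 0 = 0" "\<zeta>'' N = 0"
  by (simp_all add: \<zeta>_def \<zeta>'_def \<zeta>''_def b_def)

text \<open>The parabola \<open>x * (N - x) / N\<^sup>2\<close> equals 1/4 * 3/4 at the quarter
  points and is larger between them.\<close>

lemma \<zeta>_middle:
  assumes "x \<in> {N/4..3*N/4}" shows "(3/16) ^ 3 \<le> \<zeta> x"
proof -
  have "0 \<le> (x - N/4) * (3*N/4 - x)" using assms by (intro mult_nonneg_nonneg) auto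
  moreover have "(x - N/4) * (3*N/4 - x) = x * (N - x) - 3/16 * N\<^sup>2" by (simp add: power2_eq_square field_simps)
  ultimately have "3/16 * N\<^sup>2 \<le> x * (N - x)" by linarith
  then have "3/16 \<le> b x" unfolding b_def using N by (simp add: pos_le_divide_eq)
  then show ?thesis unfolding \<zeta>_def by (intro power_mono) auto
qed

lemma lipschitz_of_deriv:
  fixes h :: "real \<Rightarrow> real"
  assumes "\<And>x. x \<in> {0..N} \<Longrightarrow> (h has_real_derivative h' x) (at x within {0..N})"
    "\<And>x. x \<in> {0..N} \<Longrightarrow> \<bar>h' x\<bar> \<le> K" "l \<in> {0..N}" "r \<in> {0..N}"
  shows "\<bar>h r - h l\<bar> \<le> K * \<bar>r - l\<bar>"
  using field_differentiable_bound[of "{0..N}" h h' K r l] assms by (simp add: convex_real_interval)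

end

section \<open>The cut-off solution as a singular sequence\<close>

locale weyl_sequence = bloch_solution + cutoff
begin

definition u :: "real \<Rightarrow> complex" where "u x = (if x \<in> {0..N} then \<zeta> x *\<^sub>R y x else 0)"
definition u' :: "real \<Rightarrow> complex" where "u' x = (if x \<in> {0..N} then \<zeta> x *\<^sub>R V x + \<zeta>' x *\<^sub>R y x else 0)"
text \<open>The commutator of \<open>- d\<^sup>2/dx\<^sup>2\<close> with the cutoff, applied to
  \<open>y\<close>; it is what \<open>(L - E) u\<close> amounts to almost everywhere.\<close>

definition rest :: "real \<Rightarrow> complex" where
  "rest x = (if x \<in> {0..N} then - (2 *\<^sub>R (\<zeta>' x *\<^sub>R V x) + \<zeta>'' x *\<^sub>R y x) else 0)"

lemma u_derivative: "(u has_vector_derivative u' x) (at x)"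
proof -
  consider "x < 0 \<or> x > N" | "x = 0" | "x = N" | "0 < x" "x < N" by linarith
  then show ?thesis
  proof cases
    case 1
    then have "u' x = 0" by (auto simp: u'_def)
    moreover have "(u has_vector_derivative 0) (at x)"
      by (rule has_vector_derivative_zero_locally[of "- {0..N}"]) (use 1 in \<open>auto simp: u_def\<close>)
    ultimately show ?thesis by simp
  next
    case 2
    \<comment> \<open>Here \<open>\<bar>\<zeta> z\<bar> \<le> z\<^sup>2\<close> turns boundedness of
      \<open>y\<close> into a quadratic zero of \<open>u\<close>.\<close>
    have "norm (u z) \<le> By * (z - 0)\<^sup>2" for z
    proof (cases "z \<in> {0..N}")
      case True
      then have "\<bar>\<zeta> z\<bar> * norm (y z) \<le> z\<^sup>2 * By"
        using \<zeta>_bounds(2)[OF True] By[of z] by (intro mult_mono) auto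
      then show ?thesis using True by (simp add: u_def mult.commute)
    qed (use By_nonneg in \<open>auto simp: u_def\<close>)
    then have "(u has_vector_derivative 0) (at 0)" by (rule has_vector_derivative_zero_quadratic)
    then show ?thesis using 2 N by (simp add: u'_def)
  next
    case 3
    have "norm (u z) \<le> By * (z - N)\<^sup>2" for z
    proof (cases "z \<in> {0..N}")
      case True
      then have "\<bar>\<zeta> z\<bar> * norm (y z) \<le> (N - z)\<^sup>2 * By"
        using \<zeta>_bounds(3)[OF True] By[of z] by (intro mult_mono) auto
      then show ?thesis using True by (simp add: u_def mult.commute power2_commute)
    qed (use By_nonneg in \<open>auto simp: u_def\<close>)
    then have "(u has_vector_derivative 0) (at N)" by (rule has_vector_derivative_zero_quadratic)
    then show ?thesis using 3 N by (simp add: u'_def)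
  next
    case 4
    have "((\<lambda>x. \<zeta> x *\<^sub>R y x) has_vector_derivative \<zeta> x *\<^sub>R V x + \<zeta>' x *\<^sub>R y x) (at x)"
      by (rule has_vector_derivative_scaleR[OF \<zeta>_deriv y_derivative]) (use 4 in auto)
    moreover have "u' x = \<zeta> x *\<^sub>R V x + \<zeta>' x *\<^sub>R y x" using 4 by (simp add: u'_def)
    ultimately have A: "((\<lambda>x. \<zeta> x *\<^sub>R y x) has_vector_derivative u' x) (at x)" by simp
    show ?thesis
      by (rule has_vector_derivative_transform_within_open[OF A open_greaterThanLessThan[of 0 N]])
         (use 4 in \<open>simp_all add: u_def\<close>)
  qed
qed

lemma derivative_u: "derivative u = u'"
  unfolding derivative_def by (rule ext) (rule vector_derivative_at[OF u_derivative])

text \<open>\<open>V\<close> has derivative \<open>w\<close> only off a null set, by Lebesgue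
  differentiation; the two ends of the cutoff are added to that set. Outside it the terms with
  \<open>\<zeta>\<close> cancel by the equation and the commutator remains.\<close>

lemma hill_expr_u:
  obtains Z where "negligible Z" "\<And>x. x \<notin> Z \<Longrightarrow> hill_expr q u x = of_real E * u x + rest x"
proof -
  obtain Z where Z: "negligible Z"
    "\<And>x. x \<in> {0<..<N} - Z \<Longrightarrow> ((\<lambda>x. integral {0..x} w) has_vector_derivative w x) (at x)"
    by (rule lebesgue_differentiation[OF w_integrable[of N]]) blast
  show ?thesis
  proof (rule that[of "Z \<union> {0, N}"])
    show "negligible (Z \<union> {0, N})" using Z(1) by (simp add: negligible_Un)
    fix x assume x: "x \<notin> Z \<union> {0, N}"
    show "hill_expr q u x = of_real E * u x + rest x"
    proof (cases "0 < x \<and> x < N")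
      case True
      have "((\<lambda>x. C2 + integral {0..x} w) has_vector_derivative w x) (at x)"
        using Z(2)[of x] x True by (auto intro!: derivative_eq_intros)
      then have dV: "(V has_vector_derivative w x) (at x)"
        by (rule has_vector_derivative_transform_within_open[of _ _ _ "{0<..}"]) (use True V in auto)
      have dy: "(y has_vector_derivative V x) (at x)" using y_derivative True by simp
      have "((\<lambda>x. \<zeta> x *\<^sub>R V x + \<zeta>' x *\<^sub>R y x) has_vector_derivative
          (\<zeta> x *\<^sub>R w x + \<zeta>' x *\<^sub>R V x) + (\<zeta>' x *\<^sub>R V x + \<zeta>'' x *\<^sub>R y x)) (at x)"
        by (intro has_vector_derivative_add has_vector_derivative_scaleR \<zeta>_deriv \<zeta>'_deriv dV dy)
      then have "(u' has_vector_derivative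
          (\<zeta> x *\<^sub>R w x + \<zeta>' x *\<^sub>R V x) + (\<zeta>' x *\<^sub>R V x + \<zeta>'' x *\<^sub>R y x)) (at x)"
        by (rule has_vector_derivative_transform_within_open[OF _ open_greaterThanLessThan[of 0 N]])
           (use True in \<open>simp_all add: u'_def\<close>)
      then have "derivative u' x = (\<zeta> x *\<^sub>R w x + \<zeta>' x *\<^sub>R V x) + (\<zeta>' x *\<^sub>R V x + \<zeta>'' x *\<^sub>R y x)"
        unfolding derivative_def by (rule vector_derivative_at)
      then show ?thesis unfolding hill_expr_def derivative_u using True
        by (simp add: u_def rest_def w scaleR_conv_of_real algebra_simps)
    next
      case False
      then have out: "x < 0 \<or> x > N" using x by auto
      have "(u' has_vector_derivative 0) (at x)"
        by (rule has_vector_derivative_zero_locally[of "- {0..N}"]) (use out in \<open>auto simp: u'_def\<close>)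
      then have "derivative u' x = 0" unfolding derivative_def by (rule vector_derivative_at)
      then show ?thesis unfolding hill_expr_def derivative_u using out by (auto simp: u_def rest_def)
    qed
  qed
qed

lemma u'_bound: "norm (u' x) \<le> Bv + 3 * By"
proof (cases "x \<in> {0..N}")
  case True
  have "norm (u' x) \<le> \<bar>\<zeta> x\<bar> * norm (V x) + \<bar>\<zeta>' x\<bar> * norm (y x)"
    using True norm_triangle_ineq[of "\<zeta> x *\<^sub>R V x" "\<zeta>' x *\<^sub>R y x"] by (simp add: u'_def)
  also have "\<dots> \<le> 1 * Bv + 3 * By"
  proof (intro add_mono mult_mono)
    have "3 / N \<le> 3" using N by (simp add: pos_divide_le_eq)
    then show "\<bar>\<zeta>' x\<bar> \<le> 3" using \<zeta>_bounds(4)[OF True] by linarith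
  qed (use \<zeta>_bounds(1)[OF True] By[of x] Bv[of x] True in auto)
  finally show ?thesis by simp
next
  case False
  then show ?thesis using By_nonneg Bv_nonneg by (auto simp: u'_def)
qed

lemma u_locally_ac: "locally_absolutely_continuous u"
  unfolding locally_absolutely_continuous_def
proof (intro allI)
  fix a b :: real
  show "absolutely_continuous_on_interval a b u"
  proof (rule absolutely_continuous_onI_integral)
    show "(\<lambda>x. Bv + 3 * By) absolutely_integrable_on {a..b}" by (rule absolutely_integrable_continuous_real) auto
    show "0 \<le> Bv + 3 * By" using By_nonneg Bv_nonneg by simp
    fix l r :: real assume lr: "a \<le> l" "l \<le> r" "r \<le> b"
    have "norm (u r - u l) \<le> (Bv + 3 * By) * norm (r - l)"
    proof (rule differentiable_bound[of UNIV u "\<lambda>x h. h *\<^sub>R u' x"])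
      show "(u has_derivative (\<lambda>h. h *\<^sub>R u' x)) (at x)" for x
        using u_derivative by (simp add: has_vector_derivative_def)
      show "onorm (\<lambda>h. h *\<^sub>R u' x) \<le> Bv + 3 * By" for x
      proof (rule onorm_le)
        show "norm (h *\<^sub>R u' x) \<le> (Bv + 3 * By) * norm h" for h
          using mult_left_mono[OF u'_bound, of "\<bar>h\<bar>" x] by (simp add: mult.commute)
      qed
    qed auto
    then show "norm (u r - u l) \<le> integral {l..r} (\<lambda>x. Bv + 3 * By)" using lr by (simp add: mult.commute)
  qed
qed

text \<open>The norm of \<open>w\<close> accounts for the increments of \<open>V\<close>. The
  constant adds \<open>3 * Bv\<close> for those of \<open>\<zeta>\<close>, \<open>3 * Bv\<close> for
  those of \<open>y\<close> and \<open>12 * By\<close> for those of \<open>\<zeta>'\<close>.\<close>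

definition u'_density :: "real \<Rightarrow> real" where
  "u'_density x = (if x \<in> {0..N} then norm (w x) + (6 * Bv + 12 * By) else 0)"

lemma u'_difference_inside:
  assumes lr: "0 \<le> l" "l \<le> r" "r \<le> N"
  shows "norm (u' r - u' l) \<le> integral {l..r} (\<lambda>x. norm (w x) + (6 * Bv + 12 * By))"
proof -
  have mem: "l \<in> {0..N}" "r \<in> {0..N}" using lr by auto
  have N3: "3 / N \<le> 3" and N12: "12 / N\<^sup>2 \<le> 12"
    using N by (auto simp: pos_divide_le_eq power2_eq_square intro: order_trans[OF _ mult_mono[of 1 N 1 N]])
  have k1: "\<bar>\<zeta>' x\<bar> \<le> 3" if "x \<in> {0..N}" for x using \<zeta>_bounds(4)[OF that] N3 by linarith
  have k2: "\<bar>\<zeta>'' x\<bar> \<le> 12" if "x \<in> {0..N}" for x using \<zeta>_bounds(5)[OF that] N12 by linarith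
  have d1: "\<bar>\<zeta> r - \<zeta> l\<bar> \<le> 3 * (r - l)"
    using lipschitz_of_deriv[OF \<zeta>_deriv k1 mem] lr by simp
  have d2: "\<bar>\<zeta>' r - \<zeta>' l\<bar> \<le> 12 * (r - l)"
    using lipschitz_of_deriv[OF \<zeta>'_deriv k2 mem] lr by simp
  have c1: "\<bar>\<zeta>' r\<bar> \<le> 3" using \<zeta>_bounds(4)[OF mem(2)] N3 by linarith
  have ni: "(\<lambda>x. norm (w x)) integrable_on {l..r}"
  proof -
    have "(\<lambda>x. norm (w x)) integrable_on {0..N}" using w_int unfolding absolutely_integrable_on_def by simp
    then show ?thesis by (rule integrable_on_subinterval) (use lr in auto)
  qed
  have "u' r - u' l = \<zeta> r *\<^sub>R (V r - V l) + (\<zeta> r - \<zeta> l) *\<^sub>R V l + \<zeta>' r *\<^sub>R (y r - y l) + (\<zeta>' r - \<zeta>' l) *\<^sub>R y l"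
    using mem by (simp add: u'_def scaleR_conv_of_real algebra_simps)
  also have "norm \<dots> \<le> \<bar>\<zeta> r\<bar> * norm (V r - V l) + \<bar>\<zeta> r - \<zeta> l\<bar> * norm (V l) + \<bar>\<zeta>' r\<bar> * norm (y r - y l) + \<bar>\<zeta>' r - \<zeta>' l\<bar> * norm (y l)"
    by (intro order_trans[OF norm_triangle_ineq] add_mono) auto
  also have "\<dots> \<le> 1 * integral {l..r} (\<lambda>x. norm (w x)) + (3 * (r - l)) * Bv + 3 * (Bv * (r - l)) + (12 * (r - l)) * By"
    using \<zeta>_bounds(1)[OF mem(2)] V_difference[OF lr(1,2)] d1 Bv[OF lr(1)] c1 y_lipschitz[OF lr(1,2)] d2 By[OF lr(1)] lr Bv_nonneg
    by (intro add_mono mult_mono) auto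
  also have "\<dots> = integral {l..r} (\<lambda>x. norm (w x)) + (6 * Bv + 12 * By) * (r - l)" by (simp add: algebra_simps)
  also have "\<dots> = integral {l..r} (\<lambda>x. norm (w x)) + integral {l..r} (\<lambda>x. 6 * Bv + 12 * By)"
    using lr by (simp add: mult.commute)
  also have "\<dots> = integral {l..r} (\<lambda>x. norm (w x) + (6 * Bv + 12 * By))"
    by (rule Henstock_Kurzweil_Integration.integral_add[symmetric]) (use ni in auto)
  finally show ?thesis .
qed

lemma u'_locally_ac: "locally_absolutely_continuous u'"
  unfolding locally_absolutely_continuous_def
proof (intro allI)
  fix a b :: real
  let ?g = "\<lambda>x. norm (w x) + (6 * Bv + 12 * By)"
  have g0: "?g absolutely_integrable_on {0..N}"
    by (intro set_integral_add(1) absolutely_integrable_norm[unfolded o_def] w_int absolutely_integrable_continuous_real) auto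
  then have "u'_density absolutely_integrable_on UNIV"
    unfolding u'_density_def[abs_def] by (rule absolutely_integrable_restrict_UNIV[THEN iffD2])
  then have g1: "u'_density absolutely_integrable_on {a..b}"
    by (rule absolutely_integrable_on_subinterval) auto
  show "absolutely_continuous_on_interval a b u'"
  proof (rule absolutely_continuous_onI_integral[OF g1])
    show "0 \<le> u'_density x" for x using By_nonneg Bv_nonneg by (simp add: u'_density_def)
    fix l r :: real assume lr: "a \<le> l" "l \<le> r" "r \<le> b"
    have int: "integral {l..r} u'_density = integral ({0..N} \<inter> {l..r}) ?g"
      unfolding u'_density_def[abs_def] by (rule Henstock_Kurzweil_Integration.integral_restrict_Int)
    \<comment> \<open>Both \<open>\<zeta>\<close> and \<open>\<zeta>'\<close> vanish at 0 and
      \<open>N\<close>, so \<open>u'\<close> is constant on either side and arbitrary increments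
      reduce to increments inside \<open>{0..N}\<close>.\<close>
    have clamp: "u' x = u' (max 0 (min N x))" for x
      using N by (auto simp: u'_def max_def min_def)
    show "norm (u' r - u' l) \<le> integral {l..r} u'_density"
    proof (cases "l \<le> N \<and> 0 \<le> r")
      case True
      have "norm (u' (max 0 (min N r)) - u' (max 0 (min N l))) \<le> integral {max 0 (min N l)..max 0 (min N r)} ?g"
        by (rule u'_difference_inside) (use lr N in auto)
      moreover have "{max 0 (min N l)..max 0 (min N r)} = {0..N} \<inter> {l..r}"
        using True N lr by (auto simp: max_def min_def)
      ultimately show ?thesis unfolding int clamp[of r] clamp[of l] by simp
    next
      case False
      then have "u' r = 0" "u' l = 0" using lr by (auto simp: u'_def)
      moreover have "{0..N} \<inter> {l..r} = {}" using False lr by auto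
      ultimately show ?thesis unfolding int by simp
    qed
  qed
qed

lemma u_continuous: "continuous_on {0..N} u"
proof -
  have "continuous_on {0..N} (\<lambda>x. \<zeta> x *\<^sub>R y x)" by (intro continuous_intros y_continuous)
  then show ?thesis by (subst continuous_on_cong) (auto simp: u_def)
qed

lemma rest_continuous: "continuous_on {0..N} rest"
proof -
  have "continuous_on {0..N} (\<lambda>x. - (2 *\<^sub>R (\<zeta>' x *\<^sub>R V x) + \<zeta>'' x *\<^sub>R y x))"
    by (intro continuous_intros y_continuous V_continuous)
  then show ?thesis by (subst continuous_on_cong) (auto simp: rest_def)
qed

lemma square_integrable_compact_support:
  assumes "continuous_on {0..N} h" "\<And>x. x \<notin> {0..N} \<Longrightarrow> h x = 0"
  shows "h \<in> square_integrable" "(norm_L2 h)\<^sup>2 = integral {0..N} (\<lambda>x. (norm (h x))\<^sup>2)"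
proof -
  have c: "continuous_on {0..N} (\<lambda>x. (norm (h x))\<^sup>2)" by (intro continuous_intros assms)
  have z: "(norm (h x))\<^sup>2 = 0" if "x \<notin> {0..N}" for x using assms(2)[OF that] by simp
  show "h \<in> square_integrable" unfolding square_integrable_def
    using borel_measurable_compact_support[OF assms] integrable_lebesgue_compact_support[OF c z] by simp
  have "integral {0..N} (\<lambda>x. (norm (h x))\<^sup>2) \<ge> 0"
    by (rule integral_nonneg) (auto intro!: integrable_continuous_interval c)
  moreover have "(\<integral>x. (norm (h x))\<^sup>2 \<partial>lebesgue) = integral {0..N} (\<lambda>x. (norm (h x))\<^sup>2)"
    by (rule integral_lebesgue_compact_support[OF c z])
  ultimately show "(norm_L2 h)\<^sup>2 = integral {0..N} (\<lambda>x. (norm (h x))\<^sup>2)"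
    by (simp add: norm_L2_def)
qed

lemma u_square_integrable: "u \<in> square_integrable"
  by (rule square_integrable_compact_support[OF u_continuous]) (auto simp: u_def)

lemma square_integrable_AE:
  assumes f: "f \<in> square_integrable" and Z: "negligible Z" and eq: "\<And>x. x \<notin> Z \<Longrightarrow> g x = f x"
  shows "g \<in> square_integrable" "norm_L2 g = norm_L2 f"
proof -
  have mf: "f \<in> borel_measurable lebesgue" and i: "integrable lebesgue (\<lambda>x. (norm (f x))\<^sup>2)"
    using f by (auto simp: square_integrable_def)
  have mg: "g \<in> borel_measurable lebesgue" by (rule borel_measurable_lebesgue_AE[OF mf Z eq])
  have ae: "AE x in lebesgue. (norm (g x))\<^sup>2 = (norm (f x))\<^sup>2"
    unfolding eventually_ae_filter_negligible
    by (rule exI[of _ Z]) (metis (mono_tags, lifting) Z eq mem_Collect_eq subsetI)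
  have m2: "(\<lambda>x. (norm (g x))\<^sup>2) \<in> borel_measurable lebesgue" "(\<lambda>x. (norm (f x))\<^sup>2) \<in> borel_measurable lebesgue"
    using mf mg by measurable
  show "g \<in> square_integrable" unfolding square_integrable_def
    using mg integrable_cong_AE[OF m2 ae] i by simp
  show "norm_L2 g = norm_L2 f" unfolding norm_L2_def using integral_cong_AE[OF m2 ae] by simp
qed

lemma u_in_domain: "u \<in> hill_domain q"
proof -
  obtain Z where Z: "negligible Z" "\<And>x. x \<notin> Z \<Longrightarrow> hill_expr q u x = of_real E * u x + rest x"
    by (rule hill_expr_u) blast
  have "(\<lambda>x. of_real E * u x + rest x) \<in> square_integrable"
  proof (rule square_integrable_compact_support)
    show "continuous_on {0..N} (\<lambda>x. of_real E * u x + rest x)"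
      by (intro continuous_intros u_continuous rest_continuous)
  qed (auto simp: u_def rest_def)
  then have "hill_expr q u \<in> square_integrable" by (rule square_integrable_AE[OF _ Z])
  moreover have "u differentiable at x" for x
    using u_derivative by (rule differentiableI_vector)
  ultimately show ?thesis
    using u_square_integrable u_locally_ac u'_locally_ac by (simp add: hill_domain_def derivative_u)
qed

text \<open>Pointwise the defect is O(1/N) on an interval of length \<open>N\<close>, so its squared
  norm is O(1/N), whereas the squared norm of \<open>u\<close> grows linearly.\<close>

lemma norm_defect: "(norm_L2 (\<lambda>x. hill_expr q u x - of_real E * u x))\<^sup>2 \<le> (6 * Bv + 12 * By)\<^sup>2 / N"
proof -
  obtain Z where Z: "negligible Z" "\<And>x. x \<notin> Z \<Longrightarrow> hill_expr q u x = of_real E * u x + rest x"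
    by (rule hill_expr_u) blast
  have rz: "rest x = 0" if "x \<notin> {0..N}" for x using that by (auto simp: rest_def)
  have "norm_L2 (\<lambda>x. hill_expr q u x - of_real E * u x) = norm_L2 rest"
    by (rule square_integrable_AE(2)[OF square_integrable_compact_support(1)[OF rest_continuous rz] Z(1)]) (use Z(2) in auto)
  then have "(norm_L2 (\<lambda>x. hill_expr q u x - of_real E * u x))\<^sup>2 = integral {0..N} (\<lambda>x. (norm (rest x))\<^sup>2)"
    using square_integrable_compact_support(2)[OF rest_continuous rz] by simp
  also have "\<dots> \<le> integral {0..N} (\<lambda>x. ((6 * Bv + 12 * By) / N)\<^sup>2)"
  proof (rule integral_le)
    show "(\<lambda>x. (norm (rest x))\<^sup>2) integrable_on {0..N}"
      by (intro integrable_continuous_interval continuous_intros rest_continuous)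
    fix x assume x: "x \<in> {0..N}"
    have "norm (rest x) \<le> 2 * (\<bar>\<zeta>' x\<bar> * norm (V x)) + \<bar>\<zeta>'' x\<bar> * norm (y x)"
      using x norm_triangle_ineq[of "2 *\<^sub>R (\<zeta>' x *\<^sub>R V x)" "\<zeta>'' x *\<^sub>R y x"]
      by (simp add: rest_def norm_minus_commute del: norm_triangle_ineq minus_add_distrib)
    also have "\<dots> \<le> 2 * (3 / N * Bv) + 12 / N * By"
    proof (intro add_mono mult_left_mono mult_mono)
      have "12 / N\<^sup>2 \<le> 12 / N"
        using N mult_left_mono[of 1 N N] by (intro divide_left_mono) (auto simp: power2_eq_square)
      then show "\<bar>\<zeta>'' x\<bar> \<le> 12 / N" using \<zeta>_bounds(5)[OF x] by linarith
    qed (use \<zeta>_bounds(4)[OF x] By[of x] Bv[of x] x N in auto)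
    also have "\<dots> = (6 * Bv + 12 * By) / N" by (simp add: add_divide_distrib)
    finally show "(norm (rest x))\<^sup>2 \<le> ((6 * Bv + 12 * By) / N)\<^sup>2" by (intro power_mono) auto
  qed auto
  also have "\<dots> = (6 * Bv + 12 * By)\<^sup>2 / N" using N by (simp add: power_divide power2_eq_square)
  finally show ?thesis .
qed

text \<open>With \<open>N = 4 * L\<close> the middle half is \<open>{L..3 * L}\<close>, exactly
  \<open>2 * L\<close> periods of mass \<open>c\<close>, and there \<open>\<zeta>\<close> is at
  least \<open>(3/16) ^ 3\<close>.\<close>

lemma norm_u:
  assumes L: "N = real (4 * L)"
  shows "(norm_L2 u)\<^sup>2 \<ge> (3/16) ^ 6 * (2 * real L * c)"
proof -
  have uz: "u x = 0" if "x \<notin> {0..N}" for x using that by (auto simp: u_def)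
  have sub: "{real L..real (L + 2 * L)} \<subseteq> {0..N}" using L by auto
  have iu: "(\<lambda>x. (norm (u x))\<^sup>2) integrable_on {0..N}"
    by (intro integrable_continuous_interval continuous_intros u_continuous)
  have iy: "(\<lambda>x. (norm (y x))\<^sup>2) integrable_on {real L..real (L + 2 * L)}"
    by (intro integrable_continuous_interval continuous_intros continuous_on_subset[OF y_continuous[of N] sub])
  have "(3/16) ^ 6 * (2 * real L * c) = (3/16) ^ 6 * integral {real L..real (L + 2 * L)} (\<lambda>x. (norm (y x))\<^sup>2)"
    by (subst mass_sum) simp
  also have "\<dots> = integral {real L..real (L + 2 * L)} (\<lambda>x. (3/16) ^ 6 * (norm (y x))\<^sup>2)" by simp
  also have "\<dots> \<le> integral {real L..real (L + 2 * L)} (\<lambda>x. (norm (u x))\<^sup>2)"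
  proof (rule integral_le)
    show "(\<lambda>x. (3/16) ^ 6 * (norm (y x))\<^sup>2) integrable_on {real L..real (L + 2 * L)}"
      by (intro integrable_on_mult_right iy)
    show "(\<lambda>x. (norm (u x))\<^sup>2) integrable_on {real L..real (L + 2 * L)}"
      by (rule integrable_on_subinterval[OF iu sub])
    fix x assume x: "x \<in> {real L..real (L + 2 * L)}"
    then have "x \<in> {N/4..3*N/4}" using L by auto
    then have "(3/16) ^ 3 \<le> \<zeta> x" by (rule \<zeta>_middle)
    then have "((3/16) ^ 3)\<^sup>2 \<le> (\<zeta> x)\<^sup>2" by (intro power_mono) auto
    then have "((3/16) ^ 3)\<^sup>2 * (norm (y x))\<^sup>2 \<le> (\<zeta> x)\<^sup>2 * (norm (y x))\<^sup>2" by (intro mult_right_mono) auto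
    moreover have "norm (u x) = \<bar>\<zeta> x\<bar> * norm (y x)" using x sub by (auto simp: u_def)
    ultimately show "(3/16) ^ 6 * (norm (y x))\<^sup>2 \<le> (norm (u x))\<^sup>2"
      by (simp add: power_mult_distrib flip: power_mult)
  qed
  also have "\<dots> \<le> integral {0..N} (\<lambda>x. (norm (u x))\<^sup>2)"
    by (rule integral_subset_le[OF sub integrable_on_subinterval[OF iu sub] iu]) auto
  also have "\<dots> = (norm_L2 u)\<^sup>2" by (rule square_integrable_compact_support(2)[OF u_continuous uz, symmetric])
  finally show ?thesis .
qed

end

text \<open>The bounded inverse fails: a constant \<open>C\<close> would bound the linearly growing
  squared norms by the fixed number \<open>K\<close>.\<close>

theorem (in bloch_solution) in_hill_spectrum: "complex_of_real E \<in> hill_spectrum q"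
proof -
  have "complex_of_real E \<notin> resolvent_set (hill_domain q) (hill_expr q)"
  proof
    assume "complex_of_real E \<in> resolvent_set (hill_domain q) (hill_expr q)"
    then obtain C where C: "\<And>u. u \<in> hill_domain q \<Longrightarrow> norm_L2 u \<le> C * norm_L2 (\<lambda>x. hill_expr q u x - of_real E * u x)"
      unfolding resolvent_set_def by blast
    define K where "K = C\<^sup>2 * (6 * Bv + 12 * By)\<^sup>2"
    have le: "(3/16) ^ 6 * (2 * real L * c) \<le> K" if L: "L > 0" for L
    proof -
      interpret weyl_sequence q y V w E By Bv c C1 C2 "real (4 * L)"
        by unfold_locales (use L in auto)
      have "(norm_L2 u)\<^sup>2 \<le> (C * norm_L2 (\<lambda>x. hill_expr q u x - of_real E * u x))\<^sup>2"
      proof (rule power_mono[OF C[OF u_in_domain]])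
        have "0 \<le> (\<integral>x. (norm (u x))\<^sup>2 \<partial>lebesgue)" by (rule Bochner_Integration.integral_nonneg) simp
        then show "0 \<le> norm_L2 u" by (simp add: norm_L2_def)
      qed
      also have "\<dots> \<le> C\<^sup>2 * ((6 * Bv + 12 * By)\<^sup>2 / real (4 * L))"
        unfolding power_mult_distrib by (intro mult_left_mono norm_defect) auto
      also have "\<dots> = K / real (4 * L)" by (simp add: K_def)
      also have "\<dots> \<le> K / 1" using L by (intro divide_left_mono) (auto simp: K_def)
      finally show ?thesis using norm_u[OF refl] by simp
    qed
    obtain L :: nat where "K / ((3/16) ^ 6 * (2 * c)) < real L" using reals_Archimedean2 by blast
    then have "K < real L * ((3/16) ^ 6 * (2 * c))" using c_pos by (simp add: pos_divide_less_eq)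
    also have "\<dots> \<le> real (Suc L) * ((3/16) ^ 6 * (2 * c))" using c_pos by (intro mult_right_mono) auto
    also have "\<dots> = (3/16) ^ 6 * (2 * real (Suc L) * c)" by simp
    finally show False using le[of "Suc L"] by simp
  qed
  then show ?thesis by (simp add: hill_spectrum_def spectrum_def)
qed

subsection \<open>Bloch solutions from their Fourier coefficients\<close>

definition fourier_series :: "(int \<Rightarrow> complex) \<Rightarrow> real \<Rightarrow> complex" where
  "fourier_series a x = (\<Sum>\<^sub>\<infinity>m. a m * fourier_exp (- m) x)"

context
  fixes a :: "int \<Rightarrow> complex"
  assumes a: "(\<lambda>m. norm (a m)) summable_on UNIV"
begin

lemma fourier_series_uniform_limit:
  "uniform_limit UNIV (\<lambda>X x. \<Sum>m\<in>X. a m * fourier_exp (- m) x) (fourier_series a) (finite_subsets_at_top UNIV)"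
proof -
  have "uniform_limit UNIV (\<lambda>X x. \<Sum>m\<in>X. a m * fourier_exp (- m) x)
      (\<lambda>x. \<Sum>\<^sub>\<infinity>m. a m * fourier_exp (- m) x) (finite_subsets_at_top UNIV)"
    by (rule Weierstrass_m_test_general[OF _ a]) (simp add: norm_mult)
  then show ?thesis by (simp add: fourier_series_def[abs_def])
qed

lemma continuous_on_fourier_series: "continuous_on S (fourier_series a)"
proof -
  have "continuous_on UNIV (fourier_series a)"
    by (rule uniform_limit_theorem[OF _ fourier_series_uniform_limit])
       (auto intro!: always_eventually continuous_intros)
  then show ?thesis using continuous_on_subset by blast
qed

lemma norm_fourier_series: "norm (fourier_series a x) \<le> infsum (\<lambda>m. norm (a m)) UNIV"
proof -
  have "(\<lambda>m. norm (a m * fourier_exp (- m) x)) summable_on UNIV" using a by (simp add: norm_mult)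
  from norm_infsum_bound[OF this] show ?thesis by (simp add: fourier_series_def norm_mult)
qed

lemma fourier_series_periodic: "fourier_series a (x + 1) = fourier_series a x"
  by (simp add: fourier_series_def fourier_exp_periodic)

text \<open>Uniform convergence of the series permits termwise integration against any absolutely
  integrable \<open>h\<close>, in particular against the potential.\<close>

lemma integral_mult_fourier_series:
  assumes h: "h absolutely_integrable_on {0..1}"
  shows "((\<lambda>j. a j * integral {0..1} (\<lambda>x. h x * fourier_exp (- j) x)) has_sum
     integral {0..1} (\<lambda>x. h x * fourier_series a x)) UNIV"
  unfolding has_sum_def
proof (rule tendstoI)
  fix \<epsilon> :: real assume \<epsilon>: "\<epsilon> > 0"
  have ni: "(\<lambda>x. norm (h x)) integrable_on {0..1}" using h unfolding absolutely_integrable_on_def by simp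
  define B where "B = integral {0..1} (\<lambda>x. norm (h x))"
  have B: "B \<ge> 0" unfolding B_def by (rule integral_nonneg[OF ni]) simp
  have hi: "(\<lambda>x. h x * \<phi> x) integrable_on {0..1}" if "continuous_on {0..1} \<phi>" for \<phi>
    using absolutely_integrable_continuous_mult[OF h that] set_lebesgue_integral_eq_integral(1) by blast
  have "\<forall>\<^sub>F X in finite_subsets_at_top UNIV. \<forall>x\<in>UNIV. dist (\<Sum>m\<in>X. a m * fourier_exp (- m) x) (fourier_series a x) < \<epsilon> / (B + 1)"
    by (rule uniform_limitD[OF fourier_series_uniform_limit]) (use \<epsilon> B in simp)
  moreover have "\<forall>\<^sub>F X in finite_subsets_at_top UNIV. finite (X :: int set)"
    by (simp add: eventually_finite_subsets_at_top_weakI)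
  ultimately show "\<forall>\<^sub>F X in finite_subsets_at_top UNIV.
      dist (\<Sum>j\<in>X. a j * integral {0..1} (\<lambda>x. h x * fourier_exp (- j) x)) (integral {0..1} (\<lambda>x. h x * fourier_series a x)) < \<epsilon>"
  proof eventually_elim
    case (elim X)
    define S where "S = (\<lambda>x. \<Sum>m\<in>X. a m * fourier_exp (- m) x)"
    have cS: "continuous_on {0..1} S" unfolding S_def by (intro continuous_intros)
    have "(\<Sum>j\<in>X. a j * integral {0..1} (\<lambda>x. h x * fourier_exp (- j) x)) = integral {0..1} (\<lambda>x. \<Sum>j\<in>X. a j * (h x * fourier_exp (- j) x))"
      by (subst integral_sum) (use elim in \<open>auto intro!: integrable_on_mult_right hi continuous_intros\<close>)
    also have "\<dots> = integral {0..1} (\<lambda>x. h x * S x)"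
      by (simp add: S_def sum_distrib_left mult_ac)
    finally have "(\<Sum>j\<in>X. a j * integral {0..1} (\<lambda>x. h x * fourier_exp (- j) x)) - integral {0..1} (\<lambda>x. h x * fourier_series a x)
       = integral {0..1} (\<lambda>x. h x * (S x - fourier_series a x))"
      unfolding right_diff_distrib
      by (simp add: Henstock_Kurzweil_Integration.integral_diff hi cS continuous_on_fourier_series)
    also have "norm \<dots> \<le> integral {0..1} (\<lambda>x. norm (h x) * (\<epsilon> / (B + 1)))"
    proof (rule Henstock_Kurzweil_Integration.integral_norm_bound_integral)
      show "(\<lambda>x. h x * (S x - fourier_series a x)) integrable_on {0..1}"
        by (intro hi continuous_intros cS continuous_on_fourier_series)
      show "(\<lambda>x. norm (h x) * (\<epsilon> / (B + 1))) integrable_on {0..1}" by (intro integrable_on_mult_left ni)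
      show "norm (h x * (S x - fourier_series a x)) \<le> norm (h x) * (\<epsilon> / (B + 1))" for x
        using elim(1)[rule_format, of x] unfolding norm_mult S_def dist_norm by (intro mult_left_mono) auto
    qed
    also have "\<dots> = B * (\<epsilon> / (B + 1))" by (simp add: B_def)
    also have "\<dots> < \<epsilon>" using \<epsilon> B by (simp add: field_simps)
    finally show ?case by (simp add: dist_norm)
  qed
qed

lemma integral_fourier_series_coeff:
  "integral {0..1} (\<lambda>x. fourier_exp m x * fourier_series a x) = a m"
proof -
  have "((\<lambda>j. a j * integral {0..1} (\<lambda>x. fourier_exp m x * fourier_exp (- j) x)) has_sum
     integral {0..1} (\<lambda>x. fourier_exp m x * fourier_series a x)) UNIV"
    by (rule integral_mult_fourier_series) (intro absolutely_integrable_continuous_real continuous_intros)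
  also have "(\<lambda>j. a j * integral {0..1} (\<lambda>x. fourier_exp m x * fourier_exp (- j) x)) = (\<lambda>j. if j = m then a j else 0)"
  proof
    fix j
    have "(\<lambda>x. fourier_exp m x * fourier_exp (- j) x) = fourier_exp (m - j)"
      using fourier_exp_add[of m "- j"] by auto
    then show "a j * integral {0..1} (\<lambda>x. fourier_exp m x * fourier_exp (- j) x) = (if j = m then a j else 0)"
      by (simp add: integral_fourier_exp)
  qed
  finally show ?thesis using has_sum_single[of m a] has_sum_unique by blast
qed

end

lemma nonneg_real_step_induct:
  fixes x :: real
  assumes "\<And>x. x \<in> {0..1} \<Longrightarrow> P x" "\<And>x. x \<ge> 0 \<Longrightarrow> P x \<Longrightarrow> P (x + 1)" "x \<ge> 0"
  shows "P x"
proof -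
  have "P x" if "x \<in> {real n..real n + 1}" for n x
    using that
  proof (induction n arbitrary: x)
    case (Suc n)
    then have "P (x - 1)" by (intro Suc.IH) auto
    then show ?case using assms(2)[of "x - 1"] Suc.prems by auto
  qed (use assms in auto)
  moreover have "x \<in> {real (nat \<lfloor>x\<rfloor>)..real (nat \<lfloor>x\<rfloor>) + 1}" using assms(3) by auto
  ultimately show ?thesis by blast
qed

text \<open>Stated for a general algebra in order to cover \<open>w\<close>, with a complex
  multiplier, and \<open>norm (w x)\<close>, with multiplier 1.\<close>

lemma quasi_periodic_integrable:
  fixes h :: "real \<Rightarrow> 'a::{banach,real_normed_algebra}"
  assumes h: "h integrable_on {0..1}" and per: "\<And>x. x \<ge> 0 \<Longrightarrow> h (x + 1) = e * h x"
  shows "h integrable_on {0..b}"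
proof -
  have unit: "h integrable_on {real n..real n + 1}" for n
  proof (induction n)
    case (Suc n)
    have "(\<lambda>x. e * h x) integrable_on {real n..real n + 1}" by (rule integrable_on_mult_right[OF Suc.IH])
    then have "(h \<circ> (+) 1) integrable_on {real n..real n + 1}"
      by (rule integrable_eq) (use per in \<open>auto simp: add.commute\<close>)
    then have "h integrable_on {real n + 1..real n + 1 + 1}"
      unfolding integrable_on_def has_integral_shift_Icc_real by simp
    then show ?case by (simp add: add.commute)
  qed (use h in simp)
  have "h integrable_on {0..real n}" for n
  proof (induction n)
    case (Suc n)
    have "h integrable_on {0..real n + 1}"
      by (rule Henstock_Kurzweil_Integration.integrable_combine[OF _ _ Suc.IH unit]) auto
    then show ?case by (simp add: add.commute)
  qed (use integrable_on_refl[of h 0] in simp)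
  from this[of "nat \<lceil>b\<rceil>"] show ?thesis by (rule integrable_on_subinterval) (use real_nat_ceiling_ge[of b] in auto)
qed

text \<open>The constant solves \<open>C + integral {0..1} h = e * C\<close>, the condition at
  \<open>x = 0\<close>; this is possible because \<open>e \<noteq> 1\<close>.\<close>

lemma primitive_quasi_periodic:
  fixes h :: "real \<Rightarrow> complex"
  assumes h: "\<And>b. h integrable_on {0..b}" and per: "\<And>x. x \<ge> 0 \<Longrightarrow> h (x + 1) = e * h x"
    and e: "e \<noteq> 1" and P: "\<And>x. x \<ge> 0 \<Longrightarrow> P x = integral {0..1} h / (e - 1) + integral {0..x} h"
    and x: "x \<ge> 0"
  shows "P (x + 1) = e * P x"
proof -
  have "integral {0..1} h + integral {1..x+1} h = integral {0..x+1} h"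
    by (rule Henstock_Kurzweil_Integration.integral_combine) (use x h in auto)
  moreover have "integral {1..x+1} h = e * integral {0..x} h"
  proof -
    have "integral {0..x} (h \<circ> (+) 1) = integral {0+1..x+1} h" by (rule integral_shift_Icc_real)
    moreover have "integral {0..x} (h \<circ> (+) 1) = integral {0..x} (\<lambda>x. e * h x)"
      by (rule Henstock_Kurzweil_Integration.integral_cong) (use per in \<open>auto simp: add.commute\<close>)
    ultimately show ?thesis by simp
  qed
  ultimately have "integral {0..x+1} h = integral {0..1} h + e * integral {0..x} h" by simp
  moreover have "integral {0..1} h / (e - 1) + integral {0..1} h = e * (integral {0..1} h / (e - 1))"
    using e by (simp add: field_simps)
  ultimately show ?thesis using P[of x] P[of "x + 1"] x by (simp add: distrib_left)
qed

text \<open>The series for \<open>y\<close> may not be differentiable term by term. Instead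
  \<open>w = (q - E) y\<close> is integrated twice, each time with the quasi-periodic constant,
  giving \<open>Y\<close>. Integration by parts shows that mode \<open>m\<close> of \<open>w\<close>
  is \<open>- \<eta>\<^sup>2\<close> times that of \<open>Y\<close>; by the recurrence it is also
  \<open>- \<eta>\<^sup>2 * a m\<close>. So \<open>Y\<close> and \<open>y\<close> have the same
  coefficients and coincide.\<close>

theorem fourier_solution_in_spectrum:
  fixes a :: "int \<Rightarrow> complex"
  assumes q: "q absolutely_integrable_on {0..1}" and qper: "\<And>x. q (x + 1) = q x"
    and a: "(\<lambda>m. norm (a m)) summable_on UNIV" and nz: "a m0 \<noteq> 0" and \<kappa>: "cis \<kappa> \<noteq> 1"
    and eq: "\<And>m. ((\<lambda>j. a j * fourier_coeff q (j - m)) has_sum of_real (E - (\<kappa> - 2 * pi * of_int m)\<^sup>2) * a m) UNIV"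
  shows "complex_of_real E \<in> hill_spectrum q"
proof -
  define A where "A = fourier_series a"
  define e where "e = cis \<kappa>"
  define y where "y = (\<lambda>x. cis (\<kappa> * x) * A x)"
  define w where "w = (\<lambda>x. (q x - of_real E) * y x)"
  have cA: "continuous_on S A" for S unfolding A_def by (rule continuous_on_fourier_series[OF a])
  have cy: "continuous_on S y" for S unfolding y_def by (intro continuous_intros cA)
  have Aper: "A (x + 1) = A x" for x unfolding A_def by (rule fourier_series_periodic[OF a])
  have yper: "y (x + 1) = e * y x" for x
  proof -
    have "cis (\<kappa> * (x + 1)) = e * cis (\<kappa> * x)" by (simp add: e_def cis_mult distrib_left add.commute)
    then show ?thesis by (simp add: y_def Aper)
  qed
  have wper: "w (x + 1) = e * w x" for x by (simp add: w_def qper yper)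
  have e1: "e \<noteq> 1" using \<kappa> by (simp add: e_def)
  have ne: "norm e = 1" by (simp add: e_def)
  have w01: "w absolutely_integrable_on {0..1}"
  proof -
    have "(\<lambda>x. q x - of_real E) absolutely_integrable_on {0..1}"
      by (intro set_integral_diff(1) q absolutely_integrable_continuous_real) auto
    then show ?thesis unfolding w_def by (rule absolutely_integrable_continuous_mult) (rule cy)
  qed
  have wi: "w integrable_on {0..b}" for b
    by (rule quasi_periodic_integrable[of _ e]) (use w01 wper in \<open>auto simp: absolutely_integrable_on_def\<close>)
  have nwi: "(\<lambda>x. norm (w x)) integrable_on {0..b}" for b
    by (rule quasi_periodic_integrable[of _ 1]) (use w01 wper ne in \<open>auto simp: absolutely_integrable_on_def norm_mult\<close>)
  have wai: "w absolutely_integrable_on {0..b}" for b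
    using wi nwi by (simp add: absolutely_integrable_on_def)
  define C2 where "C2 = integral {0..1} w / (e - 1)"
  define V where "V = (\<lambda>x. C2 + integral {0..x} w)"
  have Vper: "V (x + 1) = e * V x" if "x \<ge> 0" for x
    by (rule primitive_quasi_periodic[OF wi wper e1 _ that]) (simp add: V_def C2_def)
  have cV: "continuous_on {0..b} V" for b
    unfolding V_def by (intro continuous_intros indefinite_integral_continuous_1 wi)
  have Vi: "V integrable_on {0..b}" for b by (rule integrable_continuous_interval[OF cV])
  define C1 where "C1 = integral {0..1} V / (e - 1)"
  define Y where "Y = (\<lambda>x. C1 + integral {0..x} V)"
  have Yper: "Y (x + 1) = e * Y x" if "x \<ge> 0" for x
    by (rule primitive_quasi_periodic[OF Vi Vper e1 _ that]) (simp_all add: Y_def C1_def)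
  have cY: "continuous_on {0..b} Y" for b
    unfolding Y_def by (intro continuous_intros indefinite_integral_continuous_1 Vi)
  have coeffY: "integral {0..1} (\<lambda>x. Y x * cis (- (\<kappa> - 2 * pi * of_int m) * x)) = a m" for m
  proof -
    define \<eta> where "\<eta> = \<kappa> - 2 * pi * of_int m"
    define \<phi> where "\<phi> = (\<lambda>x. cis (- \<eta> * x))"
    define \<phi>' where "\<phi>' = (\<lambda>x. (- \<i> * of_real \<eta>) * \<phi> x)"
    \<comment> \<open>Needed to divide by \<open>\<eta>\<^sup>2\<close> at the end; again a
      consequence of the multiplier not being 1.\<close>
    have \<eta>0: "\<eta> \<noteq> 0"
    proof
      assume "\<eta> = 0"
      then have "\<kappa> = 2 * pi * of_int m" by (simp add: \<eta>_def)
      then show False using \<kappa> by (simp add: cis_multiple_2pi)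
    qed
    have c\<phi>: "continuous_on S \<phi>" for S unfolding \<phi>_def by (intro continuous_intros)
    have c\<phi>': "continuous_on S \<phi>'" for S unfolding \<phi>'_def by (intro continuous_intros c\<phi>)
    have d\<phi>: "(\<phi> has_vector_derivative \<phi>' x) (at x within {0..1})" for x
    proof -
      have *: "\<phi> = (\<lambda>x. exp ((- \<i> * of_real \<eta>) * of_real x))"
        by (rule ext) (simp add: \<phi>_def cis_conv_exp mult_ac)
      have "((\<lambda>z. exp ((- \<i> * of_real \<eta>) * z)) has_field_derivative (- \<i> * of_real \<eta>) * exp ((- \<i> * of_real \<eta>) * of_real x)) (at (of_real x))"
        by (rule derivative_eq_intros refl | simp)+
      then show ?thesis unfolding \<phi>'_def * by (rule has_vector_derivative_real_field)
    qed
    have \<phi>1: "e * \<phi> 1 = 1"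
      by (simp add: e_def \<phi>_def \<eta>_def cis_mult cis_multiple_2pi)
    have parts: "(\<i> * of_real \<eta>) * integral {0..1} (\<lambda>x. F x * \<phi> x) = integral {0..1} (\<lambda>x. h x * \<phi> x)"
      if h: "h absolutely_integrable_on {0..1}" and F: "\<And>x. x \<in> {0..1} \<Longrightarrow> F x = c + integral {0..x} h" and F1: "F 1 = e * F 0" for F h c
    proof -
      have "integral {0..1} (\<lambda>x. F x * \<phi>' x) = F 1 * \<phi> 1 - F 0 * \<phi> 0 - integral {0..1} (\<lambda>x. h x * \<phi> x)"
        by (rule integral_by_parts_primitive[OF h zero_le_one c\<phi>' d\<phi> F])
      also have "F 1 * \<phi> 1 = F 0" using F1 \<phi>1 by (simp add: mult_ac)
      also have "\<phi> 0 = 1" by (simp add: \<phi>_def)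
      also have "integral {0..1} (\<lambda>x. F x * \<phi>' x) = (- \<i> * of_real \<eta>) * integral {0..1} (\<lambda>x. F x * \<phi> x)"
        unfolding \<phi>'_def by (simp add: mult.left_commute[of "F _"])
      finally show ?thesis by simp
    qed
    have p1: "(\<i> * of_real \<eta>) * integral {0..1} (\<lambda>x. Y x * \<phi> x) = integral {0..1} (\<lambda>x. V x * \<phi> x)"
      by (rule parts[OF absolutely_integrable_continuous_real[OF cV]]) (use Yper[of 0] in \<open>auto simp: Y_def\<close>)
    have p2: "(\<i> * of_real \<eta>) * integral {0..1} (\<lambda>x. V x * \<phi> x) = integral {0..1} (\<lambda>x. w x * \<phi> x)"
      by (rule parts[OF w01]) (use Vper[of 0] in \<open>auto simp: V_def\<close>)
    have "w x * \<phi> x = q x * fourier_exp m x * A x - of_real E * (fourier_exp m x * A x)" for x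
    proof -
      have "cis (\<kappa> * x) * \<phi> x = fourier_exp m x"
        by (simp add: \<phi>_def \<eta>_def fourier_exp_def cis_mult algebra_simps)
      then have "w x * \<phi> x = (q x - of_real E) * (fourier_exp m x * A x)"
        by (simp add: w_def y_def mult_ac)
      then show ?thesis by (simp add: algebra_simps)
    qed
    then have "integral {0..1} (\<lambda>x. w x * \<phi> x) =
        integral {0..1} (\<lambda>x. q x * fourier_exp m x * A x) - of_real E * integral {0..1} (\<lambda>x. fourier_exp m x * A x)"
    proof -
      have qa: "(\<lambda>x. q x * fourier_exp m x) absolutely_integrable_on {0..1}"
        by (intro absolutely_integrable_continuous_mult q continuous_intros)
      have "(\<lambda>x. q x * fourier_exp m x * A x) integrable_on {0..1}"
        using absolutely_integrable_continuous_mult[OF qa cA] set_lebesgue_integral_eq_integral(1) by blast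
      moreover have "(\<lambda>x. of_real E * (fourier_exp m x * A x)) integrable_on {0..1}"
        by (intro integrable_continuous_interval continuous_intros cA)
      ultimately show ?thesis using \<open>\<And>x. w x * \<phi> x = _ x\<close>
        by (simp add: Henstock_Kurzweil_Integration.integral_diff)
    qed
    moreover have "integral {0..1} (\<lambda>x. q x * fourier_exp m x * A x) = of_real (E - \<eta>\<^sup>2) * a m"
    proof -
      have "((\<lambda>j. a j * integral {0..1} (\<lambda>x. q x * fourier_exp m x * fourier_exp (- j) x)) has_sum
          integral {0..1} (\<lambda>x. q x * fourier_exp m x * fourier_series a x)) UNIV"
        by (intro integral_mult_fourier_series a absolutely_integrable_continuous_mult q continuous_intros)
      moreover have "integral {0..1} (\<lambda>x. q x * fourier_exp m x * fourier_exp (- j) x) = fourier_coeff q (j - m)" for j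
        unfolding fourier_coeff_def using fourier_exp_add[of m "- j"] by (simp add: mult.assoc)
      ultimately show ?thesis using eq[of m] has_sum_unique unfolding A_def \<eta>_def by fastforce
    qed
    moreover have "integral {0..1} (\<lambda>x. fourier_exp m x * A x) = a m"
      unfolding A_def by (rule integral_fourier_series_coeff[OF a])
    ultimately have "integral {0..1} (\<lambda>x. w x * \<phi> x) = of_real (E - \<eta>\<^sup>2) * a m - of_real E * a m"
      by (simp only:)
    then have "integral {0..1} (\<lambda>x. w x * \<phi> x) = - (of_real \<eta>)\<^sup>2 * a m"
      by (simp add: left_diff_distrib)
    moreover have "integral {0..1} (\<lambda>x. w x * \<phi> x) = - (of_real \<eta>)\<^sup>2 * integral {0..1} (\<lambda>x. Y x * \<phi> x)"
    proof -
      have "integral {0..1} (\<lambda>x. w x * \<phi> x) = (\<i> * of_real \<eta>) * ((\<i> * of_real \<eta>) * integral {0..1} (\<lambda>x. Y x * \<phi> x))"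
        unfolding p1 p2 ..
      also have "\<dots> = (\<i> * \<i>) * (of_real \<eta>)\<^sup>2 * integral {0..1} (\<lambda>x. Y x * \<phi> x)" by (simp only: power2_eq_square mult_ac)
      finally show ?thesis by simp
    qed
    ultimately have "integral {0..1} (\<lambda>x. Y x * \<phi> x) = a m" using \<eta>0 by simp
    then show ?thesis unfolding \<phi>_def \<eta>_def .
  qed
  have Yy: "Y x = y x" if "x \<ge> 0" for x
    using _ _ that
  proof (rule nonneg_real_step_induct)
    fix x :: real assume x: "x \<in> {0..1}"
    \<comment> \<open>Removing the factor \<open>cis (\<kappa> * x)\<close> makes both functions
      take equal values at 0 and 1, as uniqueness of Fourier coefficients requires.\<close>
    have "Y x * cis (- \<kappa> * x) = A x"
    proof (rule fourier_coeff_unique[of "\<lambda>x. Y x * cis (- \<kappa> * x)" A, OF _ _ _ _ _ x])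
      show "continuous_on {0..1} (\<lambda>x. Y x * cis (- \<kappa> * x))" by (intro continuous_intros cY)
      show "Y 0 * cis (- \<kappa> * 0) = Y 1 * cis (- \<kappa> * 1)"
        using Yper[of 0] by (simp add: e_def mult_ac cis_mult)
      show "continuous_on {0..1} A" by (rule cA)
      show "A 0 = A 1" using Aper[of 0] by simp
      fix k
      have "fourier_coeff (\<lambda>x. Y x * cis (- \<kappa> * x)) k = integral {0..1} (\<lambda>x. Y x * cis (- (\<kappa> - 2 * pi * of_int (- k)) * x))"
        unfolding fourier_coeff_def fourier_exp_def mult.assoc cis_mult by (simp add: algebra_simps)
      also have "\<dots> = a (- k)" by (rule coeffY)
      also have "\<dots> = fourier_coeff A k"
        using integral_fourier_series_coeff[OF a, of "- k"] unfolding fourier_coeff_def A_def by (simp add: mult.commute)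
      finally show "fourier_coeff (\<lambda>x. Y x * cis (- \<kappa> * x)) k = fourier_coeff A k" .
    qed
    then have "Y x * (cis (- \<kappa> * x) * cis (\<kappa> * x)) = y x" by (simp add: y_def mult_ac)
    then show "Y x = y x" by (simp add: cis_mult)
  next
    fix x :: real assume "x \<ge> 0" "Y x = y x"
    then show "Y (x + 1) = y (x + 1)" by (simp add: Yper yper)
  qed
  obtain Bv where Bv: "\<And>x. x \<in> {0..1} \<Longrightarrow> norm (V x) \<le> Bv"
  proof -
    have "bounded (V ` {0..1})" by (intro compact_imp_bounded compact_continuous_image cV) auto
    then obtain B where "\<forall>z\<in>V ` {0..1}. norm z \<le> B" unfolding bounded_iff by blast
    then show ?thesis using that[of B] by blast
  qed
  define c where "c = integral {0..1} (\<lambda>x. (norm (A x))\<^sup>2)"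
  have cA2: "continuous_on S (\<lambda>x. (norm (A x))\<^sup>2)" for S by (intro continuous_intros cA)
  have ny: "norm (y x) = norm (A x)" for x by (simp add: y_def norm_mult)
  have "c > 0"
  proof -
    have "c \<ge> 0" unfolding c_def by (intro integral_nonneg integrable_continuous_interval cA2) auto
    moreover have "c \<noteq> 0"
    proof
      assume "c = 0"
      then have "\<forall>x\<in>{0..1}. (norm (A x))\<^sup>2 = 0"
        unfolding c_def by (subst (asm) integral_eq_0_iff) (auto intro: cA2)
      then have "integral {0..1} (\<lambda>x. fourier_exp m0 x * A x) = integral {0..1} (\<lambda>x::real. 0)"
        by (intro Henstock_Kurzweil_Integration.integral_cong) auto
      then show False using integral_fourier_series_coeff[OF a, of m0] nz unfolding A_def by simp
    qed
    ultimately show ?thesis by simp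
  qed
  interpret bloch_solution q y V w E "infsum (\<lambda>m. norm (a m)) UNIV" Bv c C1 C2
  proof
    show "w x = (q x - of_real E) * y x" for x by (simp add: w_def)
    show "w absolutely_integrable_on {0..b}" for b by (rule wai)
    show "V x = C2 + integral {0..x} w" if "x \<ge> 0" for x by (simp add: V_def)
    show "y x = C1 + integral {0..x} V" if "x \<ge> 0" for x using Yy[OF that] by (simp add: Y_def)
    show "norm (y x) \<le> infsum (\<lambda>m. norm (a m)) UNIV" if "x \<ge> 0" for x
      unfolding ny A_def by (rule norm_fourier_series[OF a])
    show "norm (V x) \<le> Bv" if "x \<ge> 0" for x
      using _ _ that
    proof (rule nonneg_real_step_induct)
      show "norm (V x) \<le> Bv" if "x \<in> {0..1}" for x by (rule Bv[OF that])
      show "norm (V (x + 1)) \<le> Bv" if "x \<ge> 0" "norm (V x) \<le> Bv" for x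
        using that by (simp add: Vper norm_mult ne)
    qed
    show "c > 0" by fact
    show "integral {real j..real (Suc j)} (\<lambda>x. (norm (y x))\<^sup>2) = c" for j
    proof (induction j)
      case (Suc j)
      have "integral {real j..real (Suc j)} ((\<lambda>x. (norm (y x))\<^sup>2) \<circ> (+) 1) = integral {real j + 1..real (Suc j) + 1} (\<lambda>x. (norm (y x))\<^sup>2)"
        by (rule integral_shift_Icc_real)
      moreover have "((\<lambda>x. (norm (y x))\<^sup>2) \<circ> (+) 1) = (\<lambda>x. (norm (y x))\<^sup>2)"
        using Aper by (auto simp: ny add.commute)
      ultimately show ?case using Suc.IH by (simp add: add.commute)
    qed (simp add: ny c_def)
  qed
  show ?thesis by (rule in_hill_spectrum)
qed

subsection \<open>The Fourier coefficients of the potential\<close>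

lemma absolutely_continuous_imp_continuous:
  assumes "absolutely_continuous_on_interval a b u"
  shows "continuous_on {a..b} u"
  unfolding continuous_on_iff
proof (intro ballI allI impI)
  fix x e :: real assume x: "x \<in> {a..b}" and e: "e > 0"
  obtain d where d: "d > 0" and D: "\<And>(n::nat) l r.
        (\<forall>i<n. a \<le> l i \<and> l i \<le> r i \<and> r i \<le> b) \<and>
        (\<forall>i<n. \<forall>j<n. i \<noteq> j \<longrightarrow> {l i<..<r i} \<inter> {l j<..<r j} = {}) \<and>
        (\<Sum>i<n. r i - l i) < d \<longrightarrow> (\<Sum>i<n. norm (u (r i) - u (l i))) < e"
    using assms[unfolded absolutely_continuous_on_interval_def, rule_format, OF e] by blast
  have "dist (u z) (u x) < e" if z: "z \<in> {a..b}" "dist z x < d" for z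
    using D[of 1 "\<lambda>_. min x z" "\<lambda>_. max x z"] x z
    by (auto simp: dist_norm min_def max_def norm_minus_commute split: if_splits)
  then show "\<exists>d>0. \<forall>z\<in>{a..b}. dist z x < d \<longrightarrow> dist (u z) (u x) < e" using d by blast
qed

lemma derivative_periodic:
  assumes d: "\<And>x. u differentiable at x" and per: "\<And>x. u (x + 1) = u x"
  shows "derivative u (x + 1) = derivative u x"
proof -
  have "(u has_vector_derivative derivative u (x + 1)) (at (x + 1))"
    unfolding derivative_def using d by (simp add: vector_derivative_works)
  then have "((u \<circ> (\<lambda>x. x + 1)) has_vector_derivative 1 *\<^sub>R derivative u (x + 1)) (at x)"
    by (intro vector_diff_chain_at) (auto intro!: derivative_eq_intros)
  moreover have "u \<circ> (\<lambda>x. x + 1) = u" using per by auto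
  ultimately have "(u has_vector_derivative derivative u (x + 1)) (at x)" by simp
  then show ?thesis unfolding derivative_def[of u x] by (simp add: vector_derivative_at)
qed

text \<open>The induction stops at order \<open>s - 1\<close>, the last derivative that exists
  everywhere. The final gain of decay has to come from its absolute continuity.\<close>

lemma periodic_W1_derivatives:
  assumes q: "q \<in> periodic_W1 s" and k: "k < s"
  shows "(derivative ^^ k) q (x + 1) = (derivative ^^ k) q x"
    and "fourier_coeff ((derivative ^^ k) q) j = (2 * of_real pi * \<i> * of_int j) ^ k * fourier_coeff q j"
proof -
  have per: "(derivative ^^ k) q (x + 1) = (derivative ^^ k) q x" if "k < s" for k x
    using that
  proof (induction k arbitrary: x)
    case 0
    then show ?case using q by (simp add: periodic_W1_def)
  next
    case (Suc k)
    have "(derivative ^^ k) q differentiable at x" for x using q Suc.prems by (simp add: periodic_W1_def)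
    then show ?case using Suc by (simp add: derivative_periodic)
  qed
  show "(derivative ^^ k) q (x + 1) = (derivative ^^ k) q x" by (rule per[OF k])
  show "fourier_coeff ((derivative ^^ k) q) j = (2 * of_real pi * \<i> * of_int j) ^ k * fourier_coeff q j"
    using k
  proof (induction k)
    case (Suc k)
    let ?u = "(derivative ^^ k) q"
    have d: "?u differentiable at x" for x using q Suc.prems by (simp add: periodic_W1_def)
    have "fourier_coeff (derivative ?u) j = 2 * of_real pi * \<i> * of_int j * fourier_coeff ?u j"
    proof (rule fourier_coeff_derivative)
      show "(?u has_vector_derivative derivative ?u x) (at x within {0..1})" for x
        unfolding derivative_def[of ?u x]
        by (rule has_vector_derivative_at_within[OF vector_derivative_works[THEN iffD1, OF d]])
      have "absolutely_continuous_on_interval 0 1 ((derivative ^^ Suc k) q)"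
        using q Suc.prems unfolding periodic_W1_def locally_absolutely_continuous_def by blast
      then show "continuous_on {0..1} (derivative ?u)"
        using absolutely_continuous_imp_continuous by simp
      show "?u 0 = ?u 1" using per[of k 0] Suc.prems by simp
    qed
    then show ?case using Suc by simp
  qed simp
qed

section \<open>The primitive of the potential and the decay of its Fourier coefficients\<close>

locale mean_zero_potential =
  fixes q :: "real \<Rightarrow> complex"
  assumes q_int: "q absolutely_integrable_on {0..1}" and q_mean: "integral {0..1} q = 0"
begin

lemma q_integrable: "q integrable_on {0..1}"
  using q_int set_lebesgue_integral_eq_integral(1) by blast

lemma norm_q_integrable: "(\<lambda>x. norm (q x)) integrable_on {0..1}"
  using q_int unfolding absolutely_integrable_on_def by simp

text \<open>The constant gives \<open>Q\<close> mean zero. Its coefficient at 0 then vanishes,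
  matching the omitted terms \<open>j = 0\<close> and \<open>j = n\<close> in
  \<open>second_order\<close>.\<close>

definition Q :: "real \<Rightarrow> complex" where
  "Q x = - integral {0..1} (\<lambda>x. integral {0..x} q) + integral {0..x} q"

lemma Q_continuous: "continuous_on {0..1} Q"
  unfolding Q_def by (intro continuous_intros indefinite_integral_continuous_1 q_integrable)

lemma Q_endpoints: "Q 0 = Q 1"
  by (simp add: Q_def q_mean)

lemma Q_difference:
  assumes "0 \<le> l" "l \<le> r" "r \<le> 1"
  shows "norm (Q r - Q l) \<le> integral {l..r} (\<lambda>x. norm (q x))"
proof -
  have "integral {0..l} q + integral {l..r} q = integral {0..r} q"
    by (rule Henstock_Kurzweil_Integration.integral_combine)
       (use assms in \<open>auto intro: integrable_on_subinterval[OF q_integrable]\<close>)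
  then have "Q r - Q l = integral {l..r} q" by (auto simp: Q_def algebra_simps)
  also have "norm \<dots> \<le> integral {l..r} (\<lambda>x. norm (q x))"
    by (rule Henstock_Kurzweil_Integration.integral_norm_bound_integral)
       (use assms in \<open>auto intro: integrable_on_subinterval[OF q_integrable] integrable_on_subinterval[OF norm_q_integrable]\<close>)
  finally show ?thesis .
qed

lemma Q_absolutely_continuous: "absolutely_continuous_on_interval 0 1 Q"
  by (rule absolutely_continuous_onI_integral[where g = "\<lambda>x. norm (q x)"])
     (use Q_difference absolutely_integrable_norm[OF q_int] in \<open>auto simp: o_def\<close>)

lemma fourier_coeff_Q: "fourier_coeff q k = 2 * of_real pi * \<i> * of_int k * fourier_coeff Q k"
  by (rule fourier_coeff_primitive[OF q_int q_mean]) (simp add: Q_def)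

lemma fourier_coeff_Q_0: "fourier_coeff Q 0 = 0"
proof -
  let ?F = "\<lambda>x. integral {0..x} q"
  have "?F integrable_on {0..1}"
    by (intro integrable_continuous_interval indefinite_integral_continuous_1 q_integrable)
  then have "integral {0..1} (\<lambda>x. - integral {0..1} ?F + ?F x) = integral {0..1} (\<lambda>x::real. - integral {0..1} ?F) + integral {0..1} ?F"
    by (intro Henstock_Kurzweil_Integration.integral_add) auto
  then show ?thesis by (simp add: fourier_coeff_def Q_def)
qed

lemma Q_square_absolutely_continuous: "absolutely_continuous_on_interval 0 1 (\<lambda>x. Q x * Q x)"
proof -
  obtain B where B: "B > 0" "\<And>x. x \<in> {0..1} \<Longrightarrow> norm (Q x) \<le> B"
  proof -
    have "bounded (Q ` {0..1})" by (intro compact_imp_bounded compact_continuous_image Q_continuous) auto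
    then obtain B where "B > 0" "\<forall>z\<in>Q ` {0..1}. norm z \<le> B" unfolding bounded_pos by blast
    then show ?thesis using that[of B] by blast
  qed
  show ?thesis
  proof (rule absolutely_continuous_onI_integral[where g = "\<lambda>x. norm (2 * of_real B * q x)"])
    have "(\<lambda>x. 2 * of_real B * q x) absolutely_integrable_on {0..1}"
      by (rule set_integrable_mult_right) (rule q_int)
    from absolutely_integrable_norm[OF this]
    show "(\<lambda>x. norm (2 * of_real B * q x)) absolutely_integrable_on {0..1}" by (simp add: o_def)
    fix l r :: real assume lr: "0 \<le> l" "l \<le> r" "r \<le> 1"
    have "Q r * Q r - Q l * Q l = (Q r + Q l) * (Q r - Q l)" by (simp add: algebra_simps)
    also have "norm \<dots> \<le> (2 * B) * integral {l..r} (\<lambda>x. norm (q x))"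
      unfolding norm_mult
    proof (rule mult_mono)
      show "norm (Q r + Q l) \<le> 2 * B" using norm_triangle_ineq[of "Q r" "Q l"] B(2)[of r] B(2)[of l] lr by simp
    qed (use B Q_difference[OF lr] in auto)
    also have "\<dots> = integral {l..r} (\<lambda>x. norm (2 * of_real B * q x))" using B(1) by (simp add: norm_mult)
    finally show "norm (Q r * Q r - Q l * Q l) \<le> integral {l..r} (\<lambda>x. norm (2 * of_real B * q x))" .
  qed auto
qed

text \<open>In the case \<open>s = 0\<close> the sum defining \<open>second_order\<close> cannot be estimated term by term; it is,
  up to sign, a Fourier coefficient of the absolutely continuous function \<open>Q\<^sup>2\<close>.\<close>

lemma second_order_eq_fourier_coeff:
  assumes p: "\<And>j. complex_of_real (p (- j)) = fourier_coeff q (\<sigma> * j)" and \<sigma>: "\<sigma> = 1 \<or> \<sigma> = -1"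
  shows "complex_of_real (second_order p n) = - fourier_coeff (\<lambda>x. Q x * Q x) (\<sigma> * int n)"
proof -
  define T where "T = (\<lambda>j. p (- j) * p (j - int n) *
     (if j = 0 \<or> j = int n then 0 else 1 / (4 * pi\<^sup>2 * of_int j * of_int (int n - j))))"
  have b: "bij_betw (\<lambda>j. \<sigma> * j) (UNIV :: int set) UNIV"
    by (rule bij_betwI[of _ _ _ "\<lambda>j. \<sigma> * j"]) (use \<sigma> in auto)
  have "((\<lambda>j. fourier_coeff Q (\<sigma> * j) * fourier_coeff Q (\<sigma> * int n - \<sigma> * j)) has_sum fourier_coeff (\<lambda>x. Q x * Q x) (\<sigma> * int n)) UNIV"
    using fourier_coeff_square[OF Q_continuous Q_endpoints, of "\<sigma> * int n"]
    by (subst has_sum_reindex_bij_betw[OF b])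
  then have h: "((\<lambda>j. - (fourier_coeff Q (\<sigma> * j) * fourier_coeff Q (\<sigma> * int n - \<sigma> * j))) has_sum - fourier_coeff (\<lambda>x. Q x * Q x) (\<sigma> * int n)) UNIV"
    by (simp add: has_sum_uminus)
  \<comment> \<open>Passing from \<open>q\<close> to \<open>Q\<close> produces
    \<open>(2 * pi * \<i>)\<^sup>2 * \<sigma>\<^sup>2 * j * (n - j)\<close>, which cancels the
    denominator \<open>4 * pi\<^sup>2 * j * (n - j)\<close> up to the sign from
    \<open>\<i>\<^sup>2\<close>.\<close>
  have "complex_of_real (T j) = - (fourier_coeff Q (\<sigma> * j) * fourier_coeff Q (\<sigma> * int n - \<sigma> * j))" for j
  proof (cases "j = 0 \<or> j = int n")
    case True
    then show ?thesis by (auto simp: T_def fourier_coeff_Q_0)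
  next
    case False
    have p1: "complex_of_real (p (- j)) = 2 * of_real pi * \<i> * of_int (\<sigma> * j) * fourier_coeff Q (\<sigma> * j)"
      unfolding p by (rule fourier_coeff_Q)
    have p2: "complex_of_real (p (j - int n)) = 2 * of_real pi * \<i> * of_int (\<sigma> * int n - \<sigma> * j) * fourier_coeff Q (\<sigma> * int n - \<sigma> * j)"
      using p[of "int n - j"] fourier_coeff_Q[of "\<sigma> * int n - \<sigma> * j"] by (simp add: right_diff_distrib)
    have s2: "of_int \<sigma> * of_int \<sigma> = (1 :: complex)" using \<sigma> by auto
    define J D :: complex where "J = of_int j" and "D = of_int (int n - j)"
    have JD: "J \<noteq> 0" "D \<noteq> 0" using False unfolding J_def D_def of_int_eq_0_iff by auto
    have "complex_of_real (T j) = complex_of_real (p (- j)) * complex_of_real (p (j - int n)) * (1 / (4 * (of_real pi)\<^sup>2 * J * D))"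
      using False by (simp add: T_def J_def D_def)
    also have "\<dots> = (2 * of_real pi * \<i> * (of_int \<sigma> * J) * fourier_coeff Q (\<sigma> * j)) * (2 * of_real pi * \<i> * (of_int \<sigma> * D) * fourier_coeff Q (\<sigma> * int n - \<sigma> * j)) * (1 / (4 * (of_real pi)\<^sup>2 * J * D))"
      unfolding p1 p2 J_def D_def by (simp add: right_diff_distrib)
    also have "\<dots> = (of_int \<sigma> * of_int \<sigma>) * (\<i> * \<i>) * (fourier_coeff Q (\<sigma> * j) * fourier_coeff Q (\<sigma> * int n - \<sigma> * j)) * ((4 * (of_real pi)\<^sup>2 * J * D) / (4 * (of_real pi)\<^sup>2 * J * D))"
      by (simp add: power2_eq_square mult_ac)
    also have "\<dots> = - (fourier_coeff Q (\<sigma> * j) * fourier_coeff Q (\<sigma> * int n - \<sigma> * j))"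
      unfolding s2 using JD by simp
    finally show ?thesis .
  qed
  with h have hs: "((\<lambda>j. complex_of_real (T j)) has_sum - fourier_coeff (\<lambda>x. Q x * Q x) (\<sigma> * int n)) UNIV" by simp
  have "second_order p n = Re (- fourier_coeff (\<lambda>x. Q x * Q x) (\<sigma> * int n))"
    using infsumI[OF has_sum_Re[OF hs]] unfolding second_order_def T_def by simp
  moreover have "Im (- fourier_coeff (\<lambda>x. Q x * Q x) (\<sigma> * int n)) = 0"
    using infsumI[OF has_sum_Im[OF hs]] by simp
  ultimately show ?thesis by (simp add: complex_eq_iff)
qed

text \<open>\<open>Q\<^sup>2\<close> is absolutely continuous with equal values at 0 and 1, so its
  coefficients are o(1/n), exactly what \<open>s = 0\<close> demands. The sign
  \<open>\<sigma>\<close> selects one of the two couplings.\<close>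

lemma second_order_rough_tendsto:
  assumes p: "\<And>j. complex_of_real (p (- j)) = fourier_coeff q (\<sigma> * j)" and \<sigma>: "\<sigma> = 1 \<or> \<sigma> = -1"
  shows "(\<lambda>n. real n * second_order p n) \<longlonglongrightarrow> 0"
proof (rule LIMSEQ_I)
  fix r :: real assume r: "r > 0"
  have "continuous_on {0..1} (\<lambda>x. Q x * Q x)" by (intro continuous_intros Q_continuous)
  then obtain K where K: "\<And>k. \<bar>k\<bar> \<ge> K \<Longrightarrow> \<bar>of_int k\<bar> * norm (fourier_coeff (\<lambda>x. Q x * Q x) k) \<le> r / 2"
    by (rule fourier_coeff_absolutely_continuous_decay[OF Q_square_absolutely_continuous, of "r/2"])
       (use r Q_endpoints in auto)
  have "norm (real n * second_order p n - 0) < r" if n: "n \<ge> nat K" for n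
  proof -
    have "norm (complex_of_real (second_order p n)) = norm (fourier_coeff (\<lambda>x. Q x * Q x) (\<sigma> * int n))"
      unfolding second_order_eq_fourier_coeff[OF p \<sigma>] by simp
    then have "\<bar>second_order p n\<bar> = norm (fourier_coeff (\<lambda>x. Q x * Q x) (\<sigma> * int n))" by simp
    moreover have "\<bar>\<sigma> * int n\<bar> \<ge> K" using \<sigma> n by auto
    ultimately show ?thesis using K[of "\<sigma> * int n"] r \<sigma> by (auto simp: abs_mult)
  qed
  then show "\<exists>no. \<forall>n\<ge>no. norm (real n * second_order p n - 0) < r" by blast
qed

text \<open>For \<open>s = 0\<close> this is the Riemann-Lebesgue lemma, obtained from the o(1/k)
  decay for the primitive \<open>Q\<close>. For \<open>s > 0\<close> the derivative of order
  \<open>s - 1\<close> plays the role of \<open>Q\<close> and contributes \<open>s - 1\<close>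
  further powers.\<close>

lemma fourier_coeff_decay:
  assumes q: "q \<in> periodic_W1 s" and e: "e > 0"
  obtains K where "\<And>k. \<bar>k\<bar> \<ge> K \<Longrightarrow> norm (fourier_coeff q k) * \<bar>of_int k\<bar> ^ s \<le> e"
proof (cases s)
  case 0
  obtain K where K: "\<And>k. \<bar>k\<bar> \<ge> K \<Longrightarrow> \<bar>of_int k\<bar> * norm (fourier_coeff Q k) \<le> e / (2 * pi)"
    by (rule fourier_coeff_absolutely_continuous_decay[OF Q_absolutely_continuous Q_continuous Q_endpoints, of "e / (2 * pi)"])
       (use e in auto)
  show ?thesis
  proof (rule that)
    fix k :: int assume "\<bar>k\<bar> \<ge> K"
    from K[OF this] show "norm (fourier_coeff q k) * \<bar>of_int k\<bar> ^ s \<le> e"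
      unfolding fourier_coeff_Q 0 by (simp add: norm_mult pos_le_divide_eq mult_ac)
  qed
next
  case (Suc j)
  let ?u = "(derivative ^^ j) q"
  have ac: "absolutely_continuous_on_interval 0 1 ?u"
    using q Suc unfolding periodic_W1_def locally_absolutely_continuous_def by blast
  have "?u 0 = ?u 1" using periodic_W1_derivatives(1)[OF q, of j 0] Suc by simp
  then obtain K where K: "\<And>k. \<bar>k\<bar> \<ge> K \<Longrightarrow> \<bar>of_int k\<bar> * norm (fourier_coeff ?u k) \<le> e"
    by (rule fourier_coeff_absolutely_continuous_decay[OF ac absolutely_continuous_imp_continuous[OF ac]]) (use e in auto)
  show ?thesis
  proof (rule that)
    fix k :: int assume "\<bar>k\<bar> \<ge> K"
    have "norm (fourier_coeff q k) * \<bar>of_int k\<bar> ^ s = \<bar>of_int k\<bar> * (1 * (\<bar>of_int k\<bar> ^ j * norm (fourier_coeff q k)))"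
      by (simp add: Suc mult_ac)
    also have "\<dots> \<le> \<bar>of_int k\<bar> * ((2 * pi) ^ j * (\<bar>of_int k\<bar> ^ j * norm (fourier_coeff q k)))"
      using pi_gt3 by (intro mult_left_mono mult_right_mono one_le_power) auto
    also have "\<dots> = \<bar>of_int k\<bar> * norm (fourier_coeff ?u k)"
      using periodic_W1_derivatives(2)[OF q, of j k] Suc
      by (simp add: norm_mult norm_power power_mult_distrib)
    also have "\<dots> \<le> e" by (rule K) fact
    finally show "norm (fourier_coeff q k) * \<bar>of_int k\<bar> ^ s \<le> e" .
  qed
qed

end

text \<open>By PT symmetry, conjugating the integrand amounts to reflecting it at 0; periodicity
  brings \<open>{-1..0}\<close> back to \<open>{0..1}\<close>.\<close>

lemma fourier_coeff_real:
  assumes per: "\<And>x. q (x + 1) = q x" and PT: "\<And>x. cnj (q (- x)) = q x"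
  shows "Im (fourier_coeff q k) = 0"
proof -
  let ?h = "\<lambda>x. q x * fourier_exp (- k) x"
  have "cnj (fourier_coeff q k) = integral {0..1} (\<lambda>x. cnj (?h x))"
    unfolding fourier_coeff_def by (rule integral_cnj)
  also have "(\<lambda>x. cnj (?h x)) = (\<lambda>x. ?h (- x))"
    using PT[of "- _"] by (auto simp: fourier_exp_def cis_cnj)
  also have "integral {0..1} (\<lambda>x. ?h (- x)) = integral {-1..0} ?h"
    using Henstock_Kurzweil_Integration.integral_reflect_real[of 0 "-1" ?h] by simp
  also have "\<dots> = integral {-1..0} (?h \<circ> (+) 1)"
    using per fourier_exp_periodic by (simp add: o_def add.commute)
  also have "\<dots> = integral {-1 + 1..0 + 1} ?h" by (rule integral_shift_Icc_real)
  also have "\<dots> = fourier_coeff q k" by (simp add: fourier_coeff_def)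
  finally show ?thesis by (simp add: complex_eq_iff)
qed

text \<open>The real part of \<open>q x\<close> times \<open>cos - \<i> sin\<close> is already
  \<open>f cos + g sin\<close>; the opposite frequency flips the sign of the sine.\<close>

lemma Re_fourier_coeff:
  assumes q: "q absolutely_integrable_on {0..1}"
  shows "Re (fourier_coeff q (int n)) = fourier_cos (\<lambda>x. Re (q x)) n + fourier_sin (\<lambda>x. Im (q x)) n"
    and "Re (fourier_coeff q (- int n)) = fourier_cos (\<lambda>x. Re (q x)) n - fourier_sin (\<lambda>x. Im (q x)) n"
proof -
  have cont: "continuous_on {0..1} (\<lambda>x. complex_of_real (cos (2 * pi * real n * x)))"
    "continuous_on {0..1} (\<lambda>x. complex_of_real (sin (2 * pi * real n * x)))"
    by (intro continuous_intros)+
  have qc: "(\<lambda>x. q x * complex_of_real (cos (2 * pi * real n * x))) integrable_on {0..1}"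
    and qs: "(\<lambda>x. q x * complex_of_real (sin (2 * pi * real n * x))) integrable_on {0..1}"
    using absolutely_integrable_continuous_mult[OF q cont(1)] absolutely_integrable_continuous_mult[OF q cont(2)]
      set_lebesgue_integral_eq_integral(1) by blast+
  have c: "(\<lambda>x. Re (q x) * cos (2 * pi * real n * x)) integrable_on {0..1}"
    using integrable_linear[OF qc bounded_linear_Re] by (simp add: o_def)
  have s: "(\<lambda>x. Im (q x) * sin (2 * pi * real n * x)) integrable_on {0..1}"
    using integrable_linear[OF qs bounded_linear_Im] by (simp add: o_def)
  have Re: "Re (fourier_coeff q k) = integral {0..1} (\<lambda>x. Re (q x * fourier_exp (- k) x))" for k
  proof -
    have "(\<lambda>x. q x * fourier_exp (- k) x) absolutely_integrable_on {0..1}"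
      by (intro absolutely_integrable_continuous_mult q continuous_intros)
    then have "(\<lambda>x. q x * fourier_exp (- k) x) integrable_on {0..1}"
      using set_lebesgue_integral_eq_integral(1) by blast
    from integral_linear[OF this bounded_linear_Re] show ?thesis by (simp add: fourier_coeff_def o_def)
  qed
  show "Re (fourier_coeff q (int n)) = fourier_cos (\<lambda>x. Re (q x)) n + fourier_sin (\<lambda>x. Im (q x)) n"
    unfolding Re fourier_cos_def fourier_sin_def
    by (subst Henstock_Kurzweil_Integration.integral_add[OF c s, symmetric]) (simp add: fourier_exp_def)
  show "Re (fourier_coeff q (- int n)) = fourier_cos (\<lambda>x. Re (q x)) n - fourier_sin (\<lambda>x. Im (q x)) n"
    unfolding Re fourier_cos_def fourier_sin_def
    by (subst Henstock_Kurzweil_Integration.integral_diff[OF c s, symmetric]) (simp add: fourier_exp_def)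
qed

theorem theorem6:
  fixes q :: "real \<Rightarrow> complex" and s :: nat and f g :: "real \<Rightarrow> real"
  assumes "q absolutely_integrable_on {0..1}"
    and "integral {0..1} q = 0"
    and "\<And>x. q (x + 1) = q x"
    and "\<And>x. cnj (q (- x)) = q x"
    and "q \<in> periodic_W1 s"
    and "f = (\<lambda>x. Re (q x))"
    and "g = (\<lambda>x. Im (q x))"
    and "\<exists>\<delta>>1. \<exists>\<beta>>0. \<exists>m>0. \<forall>n::nat. real n > m \<longrightarrow>
           \<bar>fourier_sin g n\<bar> > \<beta> * real n powi (- int s - 1) \<and>
           \<bar>fourier_sin g n\<bar> > \<delta> * \<bar>fourier_cos f n\<bar>"
  shows "finite_zone q"
proof -
  interpret mean_zero_potential q using assms(1,2) by unfold_locales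
  \<comment> \<open>The argument is negated because the modes are \<open>exp (-2 pi i m x)\<close>:
    multiplication by \<open>q\<close> then has the matrix entries
    \<open>fourier_coeff q (j - m) = p (m - j)\<close>.\<close>
  define p where "p = (\<lambda>k. Re (fourier_coeff q (- k)))"
  have pc: "complex_of_real (p k) = fourier_coeff q (- k)" for k
    using fourier_coeff_real[OF assms(3,4), of "- k"] by (simp add: p_def complex_eq_iff)
  have decay: "\<exists>K. \<forall>k. \<bar>k\<bar> \<ge> K \<longrightarrow> \<bar>p k\<bar> * \<bar>of_int k\<bar> ^ s \<le> e" if e: "e > 0" for e
  proof -
    obtain K where K: "\<And>k. \<bar>k\<bar> \<ge> K \<Longrightarrow> norm (fourier_coeff q k) * \<bar>of_int k\<bar> ^ s \<le> e"
      by (rule fourier_coeff_decay[OF assms(5) e]) blast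
    have "\<bar>p k\<bar> * \<bar>of_int k\<bar> ^ s \<le> e" if "\<bar>k\<bar> \<ge> K" for k
    proof -
      have "\<bar>p k\<bar> = norm (fourier_coeff q (- k))" using pc[of k] by (metis norm_of_real)
      then show ?thesis using K[of "- k"] that by simp
    qed
    then show ?thesis by blast
  qed
  obtain M where M: "M > 0" "\<And>k. \<bar>p k\<bar> * sobolev_weight s k \<le> M"
  proof -
    obtain K where K: "\<And>k. \<bar>k\<bar> \<ge> K \<Longrightarrow> \<bar>p k\<bar> * \<bar>of_int k\<bar> ^ s \<le> 1" using decay[of 1] by auto
    define h where "h = (\<lambda>k. \<bar>p k\<bar> * sobolev_weight s k)"
    \<comment> \<open>Beyond \<open>K\<close> the decay bound 1 and
      \<open>1 + \<bar>k\<bar> \<le> 2 * \<bar>k\<bar>\<close> give at most \<open>2 ^ s\<close>;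
      the finitely many remaining values are simply added up.\<close>
    define B where "B = (\<Sum>k\<in>{-\<bar>K\<bar>..\<bar>K\<bar>}. h k)"
    have h0: "h k \<ge> 0" for k by (simp add: h_def sobolev_weight_def)
    have "h k \<le> 2 ^ s + B" for k
    proof (cases "k \<in> {-\<bar>K\<bar>..\<bar>K\<bar>}")
      case True
      then have "h k \<le> B" unfolding B_def by (intro member_le_sum) (use h0 in auto)
      then show ?thesis using zero_le_power[of "2::real" s] by linarith
    next
      case False
      then have k: "\<bar>k\<bar> \<ge> K" "\<bar>k\<bar> \<ge> 1" by auto
      have k1: "1 \<le> \<bar>real_of_int k\<bar>" using k(2) by linarith
      have "h k \<le> \<bar>p k\<bar> * (2 * \<bar>of_int k\<bar>) ^ s"
        unfolding h_def sobolev_weight_def using k1 by (intro mult_left_mono power_mono) auto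
      also have "\<dots> = 2 ^ s * (\<bar>p k\<bar> * \<bar>of_int k\<bar> ^ s)" by (simp add: power_mult_distrib)
      also have "\<dots> \<le> 2 ^ s * 1" by (intro mult_left_mono K k) auto
      also have "\<dots> \<le> 2 ^ s + B" unfolding B_def using h0 by (simp add: sum_nonneg)
      finally show ?thesis .
    qed
    moreover have "2 ^ s + B > 0" unfolding B_def using h0 by (simp add: add_pos_nonneg sum_nonneg)
    ultimately show ?thesis using that[of "2 ^ s + B"] unfolding h_def by blast
  qed
  interpret potential_coeffs p s M using M by unfold_locales
  interpret reflected: potential_coeffs "\<lambda>k. p (- k)" s M by (rule potential_coeffs_reflect)
  have so: "(\<lambda>n. real n ^ (s + 1) * second_order p n) \<longlonglongrightarrow> 0"
    "(\<lambda>n. real n ^ (s + 1) * second_order (\<lambda>k. p (- k)) n) \<longlonglongrightarrow> 0"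
  proof -
    have decay': "\<exists>K. \<forall>k. \<bar>k\<bar> \<ge> K \<longrightarrow> \<bar>p (- k)\<bar> * \<bar>of_int k\<bar> ^ s \<le> e" if "e > 0" for e
      using decay[OF that] by (metis abs_minus_cancel of_int_minus)
    show "(\<lambda>n. real n ^ (s + 1) * second_order p n) \<longlonglongrightarrow> 0"
    proof (cases "s = 0")
      case True
      then show ?thesis using second_order_rough_tendsto[of p 1] pc by simp
    qed (use second_order_smooth_tendsto decay in simp)
    show "(\<lambda>n. real n ^ (s + 1) * second_order (\<lambda>k. p (- k)) n) \<longlonglongrightarrow> 0"
    proof (cases "s = 0")
      case True
      then show ?thesis using second_order_rough_tendsto[of "\<lambda>k. p (- k)" "-1"] pc by simp
    qed (use reflected.second_order_smooth_tendsto decay' in simp)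
  qed
  obtain \<delta> \<beta> m where \<delta>: "\<delta> > 1" and \<beta>: "\<beta> > 0" and
    low: "\<And>n::nat. real n > m \<Longrightarrow> \<bar>fourier_sin g n\<bar> > \<beta> * real n powi (- int s - 1) \<and> \<bar>fourier_sin g n\<bar> > \<delta> * \<bar>fourier_cos f n\<bar>"
    using assms(8) by blast
  \<comment> \<open>From \<open>\<bar>F\<bar> \<le> \<bar>G\<bar> / \<delta>\<close> both
    \<open>\<bar>F + G\<bar>\<close> and \<open>\<bar>F - G\<bar>\<close> are at least
    \<open>(1 - 1 / \<delta>) * \<bar>G\<bar>\<close>, and \<open>\<bar>G\<bar>\<close> exceeds
    \<open>\<beta> * n^(-s-1)\<close>.\<close>
  define c where "c = (1 - 1 / \<delta>) * \<beta>"
  have c: "c > 0" using \<delta> \<beta> by (simp add: c_def)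
  \<comment> \<open>The extra 1 makes the inequality \<open>n > m\<close> strict and
    \<open>n\<close> positive.\<close>
  define N0 where "N0 = nat \<lceil>m\<rceil> + 1"
  have ind: "p (- int n) * p (int n) < 0 \<and> c \<le> \<bar>p (- int n)\<bar> * real n ^ (s + 1) \<and> c \<le> \<bar>p (int n)\<bar> * real n ^ (s + 1)"
    if n: "n \<ge> N0" for n
  proof -
    have nm: "real n > m" and npos: "n > 0" using n unfolding N0_def by linarith+
    define F G where "F = fourier_cos f n" and "G = fourier_sin g n"
    have G1: "\<beta> * real n powi (- int s - 1) < \<bar>G\<bar>" and G2: "\<delta> * \<bar>F\<bar> < \<bar>G\<bar>" using low[OF nm] by (auto simp: F_def G_def)
    have pm: "p (- int n) = F + G" "p (int n) = F - G"
      using Re_fourier_coeff[OF assms(1), of n] by (simp_all add: p_def F_def G_def assms(6,7))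
    have FG: "\<bar>F\<bar> \<le> \<bar>G\<bar> / \<delta>" using G2 \<delta> by (simp add: pos_le_divide_eq mult.commute)
    have FG': "\<bar>F\<bar> < \<bar>G\<bar>" using G2 \<delta> mult_right_mono[of 1 \<delta> "\<bar>F\<bar>"] by simp
    have "F\<^sup>2 < G\<^sup>2" using power_strict_mono[OF FG', of 2] by simp
    then have sgn: "(F + G) * (F - G) < 0" by (simp add: power2_eq_square algebra_simps)
    define X where "X = real n ^ (s + 1)"
    have X: "X > 0" using npos by (simp add: X_def)
    have "real n powi (- int s - 1) = inverse X"
    proof -
      have "- int s - 1 = - int (s + 1)" by simp
      then show ?thesis by (simp only: power_int_minus power_int_of_nat X_def)
    qed
    then have "\<beta> / X < \<bar>G\<bar>" using G1 by (simp add: divide_inverse)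
    then have "\<beta> < \<bar>G\<bar> * real n ^ (s + 1)" using X by (simp add: pos_divide_less_eq X_def)
    then have cG: "c \<le> (1 - 1 / \<delta>) * (\<bar>G\<bar> * real n ^ (s + 1))"
      unfolding c_def using \<delta> by (intro mult_left_mono) auto
    have "c \<le> \<bar>x\<bar> * real n ^ (s + 1)" if x: "\<bar>G\<bar> - \<bar>F\<bar> \<le> \<bar>x\<bar>" for x
    proof -
      have "(1 - 1 / \<delta>) * \<bar>G\<bar> \<le> \<bar>x\<bar>" using x FG by (simp add: algebra_simps)
      then have "(1 - 1 / \<delta>) * \<bar>G\<bar> * real n ^ (s + 1) \<le> \<bar>x\<bar> * real n ^ (s + 1)" by (intro mult_right_mono) auto
      then show ?thesis using cG by (simp add: mult.assoc)
    qed
    moreover have "\<bar>G\<bar> - \<bar>F\<bar> \<le> \<bar>F + G\<bar>" "\<bar>G\<bar> - \<bar>F\<bar> \<le> \<bar>F - G\<bar>" by linarith+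
    ultimately show ?thesis unfolding pm using sgn by blast
  qed
  obtain R where R: "\<And>E. E \<ge> R \<Longrightarrow> \<exists>(n::nat) t a. 0 < t \<and> t < 3 \<and> (\<exists>m. a m \<noteq> 0) \<and> (\<lambda>m. \<bar>a m\<bar>) summable_on UNIV \<and>
    (\<forall>m. ((\<lambda>j. p (m - j) * a j) has_sum (E - (pi * real n + t - 2 * pi * of_int m)\<^sup>2) * a m) UNIV)"
    by (rule resonance_solution[OF so c, of N0]) (use ind in blast)+
  have "complex_of_real E \<in> hill_spectrum q" if ER: "E \<ge> R" for E
  proof -
    obtain n :: nat and t a m0 where t: "0 < t" "t < 3" and a: "a m0 \<noteq> 0" "(\<lambda>m. \<bar>a m\<bar>) summable_on UNIV"
      and eq: "\<And>m. ((\<lambda>j. p (m - j) * a j) has_sum (E - (pi * real n + t - 2 * pi * of_int m)\<^sup>2) * a m) UNIV"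
      using R[OF ER] by blast
    show ?thesis
    proof (rule fourier_solution_in_spectrum[OF assms(1,3), of "\<lambda>m. complex_of_real (a m)" m0 "pi * real n + t"])
      show "(\<lambda>m. norm (complex_of_real (a m))) summable_on UNIV" using a(2) by simp
      show "complex_of_real (a m0) \<noteq> 0" using a(1) by simp
      \<comment> \<open>The imaginary part is \<open>sin t\<close> up to sign, which is nonzero
        because \<open>0 < t < 3 < pi\<close>.\<close>
      show "cis (pi * real n + t) \<noteq> 1"
      proof
        assume "cis (pi * real n + t) = 1"
        then have "sin (pi * real n + t) = 0" by (simp add: complex_eq_iff)
        then have "cos (pi * real n) * sin t = 0" by (simp add: sin_add)
        moreover have "sin t > 0" by (rule sin_gt_zero) (use t pi_gt3 in auto)
        ultimately show False by simp
      qed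
      fix m
      have "((\<lambda>j. complex_of_real (p (m - j) * a j)) has_sum complex_of_real ((E - (pi * real n + t - 2 * pi * of_int m)\<^sup>2) * a m)) UNIV"
        by (rule has_sum_of_real[OF eq])
      then show "((\<lambda>j. complex_of_real (a j) * fourier_coeff q (j - m)) has_sum
          complex_of_real (E - (pi * real n + t - 2 * pi * of_int m)\<^sup>2) * complex_of_real (a m)) UNIV"
        by (simp only: of_real_mult pc minus_diff_eq mult.commute)
    qed
  qed
  then show ?thesis unfolding finite_zone_def Re_spectrum_def by (intro exI[of _ R]) auto
qed

end
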